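(* Let $(M,\theta,g)$ be a compact orientable $K$-contact manifold without boundary, of dimension $2n+1$, and let the contactomorphism group $\mathcal{D}_\theta(M)$ carry the right-invariant metric given at the identity by $\langle S_\theta f,S_\theta h\rangle=\int_M fh\,d\mu$. Then the sectional curvature of $\mathcal{D}_\theta(M)$ is nonnegative; that is, $K(X,Y)\ge 0$ for all linearly independent $X,Y\in T_e\mathcal{D}_\theta(M)$.
   Context: A contact form on a $(2n+1)$-dimensional manifold $M$ is a $1$-form $\theta$ with $\theta\wedge(d\theta)^n\neq 0$ everywhere. Its Reeb field $E$ is the vector field determined by $\theta(E)=1$, $\iota_E d\theta=0$. A Riemannian metric $g=(\cdot,\cdot)_g$ on $M$ is associated to $\theta$ if (1) $\theta(u)=(u,E)_g$ for all $u\in TM$, and (2) there is a $(1,1)$-tensor field $\phi$ with $\phi^2(u)=-u+\theta(u)E$ and $d\theta(u,v)=(u,\phi v)_g$ for all $u,v$. If in addition $E$ is a Killing field, $(M,\theta,g)$ is called $K$-contact. $d\mu$ denotes the Riemannian volume form of $g$. $\mathcal{D}_\theta(M)$ is the group of diffeomorphisms $\eta$ of $M$ such that $\eta^*\theta$ is a positive function times $\theta$; it is a regular smooth (infinite-dimensional) Lie group. Its Lie algebra $T_e\mathcal{D}_\theta(M)$ consists of the vector fields $u$ with $\mathcal{L}_u\theta=\lambda\theta$ for some function $\lambda$. Each such $u$ is uniquely determined by its stream function $f=\theta(u)\in C^\infty(M)$, and every $f\in C^\infty(M)$ occurs; one writes $u=S_\theta f$. The Lie bracket of vector fields is $[S_\theta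 f,S_\theta h]=S_\theta\{f,h\}$ with $\{f,h\}=S_\theta f(h)-hE(f)$, and the convention is $\mathrm{ad}_XY=-[X,Y]$. For $X,Y$ in the Lie algebra, let $B(X,Y)=\mathrm{ad}^*_YX$ be defined by $\langle B(X,Y),Z\rangle=\langle X,\mathrm{ad}_YZ\rangle$ for all $Z$. The sectional curvature is $K(X,Y)=C(X,Y)/|X\wedge Y|^2$, where $|X\wedge Y|^2=\langle X,X\rangle\langle Y,Y\rangle-\langle X,Y\rangle^2$ and $C$ is given by Arnold's formula for right-invariant metrics, $$C(X,Y)=\langle d,d\rangle+2\langle a,b\rangle-3\langle a,a\rangle-4\langle B_X,B_Y\rangle,$$ with $2d=B(X,Y)+B(Y,X)$, $2b=B(X,Y)-B(Y,X)$, $2a=\mathrm{ad}_XY$, $2B_X=B(X,X)$, $2B_Y=B(Y,Y)$. *)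

theory Defs
  imports "HOL-Analysis.Analysis"
begin

section \<open>Smooth manifolds without boundary\<close>

text \<open>Meant for open sets \<open>S\<close>, where \<open>at x\<close> and \<open>at x within S\<close> agree.\<close>

primrec Ck_on :: "nat \<Rightarrow> 'a::real_normed_vector set \<Rightarrow> ('a \<Rightarrow> 'b::real_normed_vector) \<Rightarrow> bool" where
  "Ck_on 0 S f \<longleftrightarrow> continuous_on S f"
| "Ck_on (Suc k) S f \<longleftrightarrow>
     (\<forall>x\<in>S. f differentiable (at x)) \<and> (\<forall>v. Ck_on k S (\<lambda>x. frechet_derivative f (at x) v))"

definition smooth_on :: "'a::real_normed_vector set \<Rightarrow> ('a \<Rightarrow> 'b::real_normed_vector) \<Rightarrow> bool" where
  "smooth_on S f \<longleftrightarrow> (\<forall>k. Ck_on k S f)"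

text \<open>A chart is a pair of its domain and its coordinate map; the values of the coordinate map
  outside the domain are irrelevant. The manifold is the whole type \<open>'m\<close>, and its dimension
  is \<open>CARD('d)\<close>.\<close>

type_synonym ('m, 'd) chart = "'m set \<times> ('m \<Rightarrow> real ^ 'd)"

definition is_chart :: "('m::topological_space, 'd::finite) chart \<Rightarrow> bool" where
  "is_chart = (\<lambda>(U, c). open U \<and> open (c ` U) \<and> inj_on c U \<and>
     continuous_on U c \<and> continuous_on (c ` U) (inv_into U c))"

text \<open>Atlases need not be maximal.\<close>

definition smooth_atlas :: "('m::topological_space, 'd::finite) chart set \<Rightarrow> bool" where
  "smooth_atlas A \<longleftrightarrow> (\<forall>C\<in>A. is_chart C) \<and> (\<Union>(U, c)\<in>A. U) = UNIV \<and>
     (\<forall>(U, c)\<in>A. \<forall>(V, d)\<in>A. smooth_on (c ` (U \<inter> V)) (d \<circ> inv_into U c))"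

definition orientable :: "('m::topological_space, 'd::finite) chart set \<Rightarrow> bool" where
  "orientable A \<longleftrightarrow> (\<exists>A'. smooth_atlas A' \<and> smooth_atlas (A \<union> A') \<and>
     (\<forall>(U, c)\<in>A'. \<forall>(V, d)\<in>A'. \<forall>x\<in>c ` (U \<inter> V).
        det (matrix (frechet_derivative (d \<circ> inv_into U c) (at x))) > 0))"

definition smooth_funs :: "('m::topological_space, 'd::finite) chart set \<Rightarrow> ('m \<Rightarrow> real) set" where
  "smooth_funs A = {f. \<forall>(U, c)\<in>A. smooth_on (c ` U) (f \<circ> inv_into U c)}"


section \<open>Tangent vectors and tensor fields\<close>

text \<open>Tangent vectors at \<open>p\<close> are the derivations at \<open>p\<close> of the algebra of smooth functions. They are
  made to vanish on functions that are not smooth, so that two tangent vectors (and two vector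
  fields) are equal in HOL as soon as they agree on smooth functions.\<close>

type_synonym 'm tangent = "('m \<Rightarrow> real) \<Rightarrow> real"
type_synonym 'm vfield = "'m \<Rightarrow> 'm tangent"

definition tangent_space :: "('m::topological_space, 'd::finite) chart set \<Rightarrow> 'm \<Rightarrow> 'm tangent set" where
  "tangent_space A p = {v.
     (\<forall>f. f \<notin> smooth_funs A \<longrightarrow> v f = 0) \<and>
     (\<forall>f\<in>smooth_funs A. \<forall>h\<in>smooth_funs A. v (\<lambda>q. f q + h q) = v f + v h) \<and>
     (\<forall>a. \<forall>f\<in>smooth_funs A. v (\<lambda>q. a * f q) = a * v f) \<and>
     (\<forall>f\<in>smooth_funs A. \<forall>h\<in>smooth_funs A. v (\<lambda>q. f q * h q) = f p * v h + h p * v f)}"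

definition tan_add :: "'m tangent \<Rightarrow> 'm tangent \<Rightarrow> 'm tangent" where
  "tan_add u v = (\<lambda>f. u f + v f)"

definition tan_scale :: "real \<Rightarrow> 'm tangent \<Rightarrow> 'm tangent" where
  "tan_scale a v = (\<lambda>f. a * v f)"

definition vector_fields :: "('m::topological_space, 'd::finite) chart set \<Rightarrow> 'm vfield set" where
  "vector_fields A = {X. (\<forall>p. X p \<in> tangent_space A p) \<and>
     (\<forall>f\<in>smooth_funs A. (\<lambda>p. X p f) \<in> smooth_funs A)}"

definition lie_bracket :: "'m vfield \<Rightarrow> 'm vfield \<Rightarrow> 'm vfield" where
  "lie_bracket X Y = (\<lambda>p f. X p (\<lambda>q. Y q f) - Y p (\<lambda>q. X q f))"

definition linear_form_on :: "'m tangent set \<Rightarrow> ('m tangent \<Rightarrow> real) \<Rightarrow> bool" where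
  "linear_form_on T \<alpha> \<longleftrightarrow> (\<forall>u\<in>T. \<forall>v\<in>T. \<alpha> (tan_add u v) = \<alpha> u + \<alpha> v) \<and>
     (\<forall>a. \<forall>u\<in>T. \<alpha> (tan_scale a u) = a * \<alpha> u)"

text \<open>Smoothness of a tensor field is expressed by its values on smooth vector fields.\<close>

definition one_forms ::
    "('m::topological_space, 'd::finite) chart set \<Rightarrow> ('m \<Rightarrow> 'm tangent \<Rightarrow> real) set" where
  "one_forms A = {\<theta>. (\<forall>p. linear_form_on (tangent_space A p) (\<theta> p)) \<and>
     (\<forall>X\<in>vector_fields A. (\<lambda>p. \<theta> p (X p)) \<in> smooth_funs A)}"

definition endo_fields ::
    "('m::topological_space, 'd::finite) chart set \<Rightarrow> ('m \<Rightarrow> 'm tangent \<Rightarrow> 'm tangent) set" where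
  "endo_fields A = {\<phi>.
     (\<forall>p. \<forall>u\<in>tangent_space A p. \<phi> p u \<in> tangent_space A p \<and>
        (\<forall>v\<in>tangent_space A p. \<phi> p (tan_add u v) = tan_add (\<phi> p u) (\<phi> p v)) \<and>
        (\<forall>a. \<phi> p (tan_scale a u) = tan_scale a (\<phi> p u))) \<and>
     (\<forall>X\<in>vector_fields A. (\<lambda>p. \<phi> p (X p)) \<in> vector_fields A)}"

definition riemannian_metric ::
    "('m::topological_space, 'd::finite) chart set \<Rightarrow> ('m \<Rightarrow> 'm tangent \<Rightarrow> 'm tangent \<Rightarrow> real) \<Rightarrow> bool" where
  "riemannian_metric A g \<longleftrightarrow>
     (\<forall>p. \<forall>u\<in>tangent_space A p. linear_form_on (tangent_space A p) (g p u) \<and>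
        (\<forall>v\<in>tangent_space A p. g p u v = g p v u) \<and> (u \<noteq> (\<lambda>f. 0) \<longrightarrow> g p u u > 0)) \<and>
     (\<forall>X\<in>vector_fields A. \<forall>Y\<in>vector_fields A. (\<lambda>p. g p (X p) (Y p)) \<in> smooth_funs A)"

text \<open>\<open>coord_vec A (U, c) p i\<close> is the coordinate vector of the chart \<open>(U, c)\<close> in the direction \<open>i\<close>
  at the point \<open>p \<in> U\<close>.\<close>

definition coord_vec ::
    "('m::topological_space, 'd::finite) chart set \<Rightarrow> ('m, 'd) chart \<Rightarrow> 'm \<Rightarrow> 'd \<Rightarrow> 'm tangent" where
  "coord_vec A = (\<lambda>(U, c) p i f. if f \<in> smooth_funs A
     then frechet_derivative (f \<circ> inv_into U c) (at (c p)) (axis i 1) else 0)"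

definition gram :: "('m::topological_space, 'd::finite) chart set \<Rightarrow>
    ('m \<Rightarrow> 'm tangent \<Rightarrow> 'm tangent \<Rightarrow> real) \<Rightarrow> ('m, 'd) chart \<Rightarrow> 'm \<Rightarrow> real ^ 'd ^ 'd" where
  "gram A g C p = (\<chi> i j. g p (coord_vec A C p i) (coord_vec A C p j))"

text \<open>\<open>\<mu>\<close> is the measure given by the Riemannian volume form of \<open>g\<close>: in every chart it has the density
  \<open>sqrt (det g\<^sub>i\<^sub>j)\<close>. As the charts cover the manifold, this determines \<open>\<mu>\<close> uniquely.\<close>

definition riemannian_volume :: "('m::topological_space, 'd::finite) chart set \<Rightarrow>
    ('m \<Rightarrow> 'm tangent \<Rightarrow> 'm tangent \<Rightarrow> real) \<Rightarrow> 'm measure \<Rightarrow> bool" where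
  "riemannian_volume A g \<mu> \<longleftrightarrow> sets \<mu> = sets borel \<and>
     (\<forall>(U, c)\<in>A. \<forall>S\<in>sets borel. S \<subseteq> U \<longrightarrow>
        emeasure \<mu> S =
          (\<integral>\<^sup>+x\<in>c ` S. ennreal (sqrt (det (gram A g (U, c) (inv_into U c x)))) \<partial>lborel))"


section \<open>Contact geometry\<close>

text \<open>The exterior derivative of a 1-form, without the factor 1/2 used by some authors.\<close>

definition ext_deriv :: "('m \<Rightarrow> 'm tangent \<Rightarrow> real) \<Rightarrow> 'm vfield \<Rightarrow> 'm vfield \<Rightarrow> 'm \<Rightarrow> real" where
  "ext_deriv \<theta> X Y p =
     X p (\<lambda>q. \<theta> q (Y q)) - Y p (\<lambda>q. \<theta> q (X q)) - \<theta> p (lie_bracket X Y p)"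

text \<open>The value of \<open>\<theta> \<and> (d\<theta>)\<^sup>n\<close> on the vector fields \<open>V 0, \<dots>, V (2n)\<close> at \<open>p\<close>; the factor is
  \<open>1 / (1! * (2!)\<^sup>n)\<close>.\<close>

definition contact_volume :: "nat \<Rightarrow> ('m \<Rightarrow> 'm tangent \<Rightarrow> real) \<Rightarrow> (nat \<Rightarrow> 'm vfield) \<Rightarrow> 'm \<Rightarrow> real" where
  "contact_volume n \<theta> V p = (1 / 2 ^ n) *
     (\<Sum>\<sigma> | \<sigma> permutes {..<2 * n + 1}. of_int (sign \<sigma>) * \<theta> p (V (\<sigma> 0) p) *
        (\<Prod>i<n. ext_deriv \<theta> (V (\<sigma> (2 * i + 1))) (V (\<sigma> (2 * i + 2))) p))"

definition contact_form ::
    "('m::topological_space, 'd::finite) chart set \<Rightarrow> nat \<Rightarrow> ('m \<Rightarrow> 'm tangent \<Rightarrow> real) \<Rightarrow> bool" where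
  "contact_form A n \<theta> \<longleftrightarrow> \<theta> \<in> one_forms A \<and>
     (\<forall>p. \<exists>V. (\<forall>i. V i \<in> vector_fields A) \<and> contact_volume n \<theta> V p \<noteq> 0)"

definition reeb_field ::
    "('m::topological_space, 'd::finite) chart set \<Rightarrow> ('m \<Rightarrow> 'm tangent \<Rightarrow> real) \<Rightarrow> 'm vfield \<Rightarrow> bool" where
  "reeb_field A \<theta> E \<longleftrightarrow> E \<in> vector_fields A \<and> (\<forall>p. \<theta> p (E p) = 1) \<and>
     (\<forall>X\<in>vector_fields A. \<forall>p. ext_deriv \<theta> E X p = 0)"

definition associated_metric :: "('m::topological_space, 'd::finite) chart set \<Rightarrow>
    ('m \<Rightarrow> 'm tangent \<Rightarrow> real) \<Rightarrow> 'm vfield \<Rightarrow> ('m \<Rightarrow> 'm tangent \<Rightarrow> 'm tangent \<Rightarrow> real) \<Rightarrow> bool" where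
  "associated_metric A \<theta> E g \<longleftrightarrow> riemannian_metric A g \<and>
     (\<forall>p. \<forall>u\<in>tangent_space A p. \<theta> p u = g p u (E p)) \<and>
     (\<exists>\<phi>\<in>endo_fields A.
        (\<forall>p. \<forall>u\<in>tangent_space A p.
           \<phi> p (\<phi> p u) = tan_add (tan_scale (- 1) u) (tan_scale (\<theta> p u) (E p))) \<and>
        (\<forall>X\<in>vector_fields A. \<forall>Y\<in>vector_fields A. \<forall>p.
           ext_deriv \<theta> X Y p = g p (X p) (\<phi> p (Y p))))"

definition killing_field :: "('m::topological_space, 'd::finite) chart set \<Rightarrow>
    ('m \<Rightarrow> 'm tangent \<Rightarrow> 'm tangent \<Rightarrow> real) \<Rightarrow> 'm vfield \<Rightarrow> bool" where
  "killing_field A g E \<longleftrightarrow> E \<in> vector_fields A \<and>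
     (\<forall>X\<in>vector_fields A. \<forall>Y\<in>vector_fields A. \<forall>p.
        E p (\<lambda>q. g q (X q) (Y q)) - g p (lie_bracket E X p) (Y p) - g p (X p) (lie_bracket E Y p) = 0)"

definition K_contact :: "('m::topological_space, 'd::finite) chart set \<Rightarrow> nat \<Rightarrow>
    ('m \<Rightarrow> 'm tangent \<Rightarrow> real) \<Rightarrow> ('m \<Rightarrow> 'm tangent \<Rightarrow> 'm tangent \<Rightarrow> real) \<Rightarrow> bool" where
  "K_contact A n \<theta> g \<longleftrightarrow> contact_form A n \<theta> \<and>
     (\<exists>E. reeb_field A \<theta> E \<and> associated_metric A \<theta> E g \<and> killing_field A g E)"


section \<open>Curvature of the contactomorphism group\<close>

definition lie_deriv_form ::
    "'m vfield \<Rightarrow> ('m \<Rightarrow> 'm tangent \<Rightarrow> real) \<Rightarrow> 'm vfield \<Rightarrow> 'm \<Rightarrow> real" where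
  "lie_deriv_form u \<theta> X p = u p (\<lambda>q. \<theta> q (X q)) - \<theta> p (lie_bracket u X p)"

text \<open>The Lie algebra of the group of contactomorphisms.\<close>

definition contact_fields :: "('m::topological_space, 'd::finite) chart set \<Rightarrow>
    ('m \<Rightarrow> 'm tangent \<Rightarrow> real) \<Rightarrow> 'm vfield set" where
  "contact_fields A \<theta> = {u \<in> vector_fields A. \<exists>l :: 'm \<Rightarrow> real.
     \<forall>X\<in>vector_fields A. \<forall>p. lie_deriv_form u \<theta> X p = l p * \<theta> p (X p)}"

definition stream_fun :: "('m \<Rightarrow> 'm tangent \<Rightarrow> real) \<Rightarrow> 'm vfield \<Rightarrow> 'm \<Rightarrow> real" where
  "stream_fun \<theta> u p = \<theta> p (u p)"

definition contact_inner ::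
    "('m \<Rightarrow> 'm tangent \<Rightarrow> real) \<Rightarrow> 'm measure \<Rightarrow> 'm vfield \<Rightarrow> 'm vfield \<Rightarrow> real" where
  "contact_inner \<theta> \<mu> X Y = (LINT p|\<mu>. stream_fun \<theta> X p * stream_fun \<theta> Y p)"

definition vf_lincomb :: "real \<Rightarrow> 'm vfield \<Rightarrow> real \<Rightarrow> 'm vfield \<Rightarrow> 'm vfield" where
  "vf_lincomb a X b Y = (\<lambda>p. tan_add (tan_scale a (X p)) (tan_scale b (Y p)))"

definition vf_independent :: "'m vfield \<Rightarrow> 'm vfield \<Rightarrow> bool" where
  "vf_independent X Y \<longleftrightarrow> (\<forall>a b. vf_lincomb a X b Y = (\<lambda>p f. 0) \<longrightarrow> a = 0 \<and> b = 0)"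

definition ad :: "'m vfield \<Rightarrow> 'm vfield \<Rightarrow> 'm vfield" where
  "ad X Y = (\<lambda>p f. - lie_bracket X Y p f)"

text \<open>\<open>coad A \<theta> \<mu> X Y\<close> is \<open>B(X, Y)\<close>, the adjoint of \<open>ad Y\<close> applied to \<open>X\<close>.\<close>

definition coad :: "('m::topological_space, 'd::finite) chart set \<Rightarrow> ('m \<Rightarrow> 'm tangent \<Rightarrow> real) \<Rightarrow>
    'm measure \<Rightarrow> 'm vfield \<Rightarrow> 'm vfield \<Rightarrow> 'm vfield" where
  "coad A \<theta> \<mu> X Y = (THE W. W \<in> contact_fields A \<theta> \<and>
     (\<forall>Z\<in>contact_fields A \<theta>. contact_inner \<theta> \<mu> W Z = contact_inner \<theta> \<mu> X (ad Y Z)))"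

text \<open>Arnold's formula for right-invariant metrics.\<close>

definition arnold_C :: "('m::topological_space, 'd::finite) chart set \<Rightarrow> ('m \<Rightarrow> 'm tangent \<Rightarrow> real) \<Rightarrow>
    'm measure \<Rightarrow> 'm vfield \<Rightarrow> 'm vfield \<Rightarrow> real" where
  "arnold_C A \<theta> \<mu> X Y =
     (let B = coad A \<theta> \<mu>; ip = contact_inner \<theta> \<mu>;
          d = vf_lincomb (1/2) (B X Y) (1/2) (B Y X);
          b = vf_lincomb (1/2) (B X Y) (- 1/2) (B Y X);
          a = (\<lambda>p. tan_scale (1/2) (ad X Y p));
          BX = (\<lambda>p. tan_scale (1/2) (B X X p));
          BY = (\<lambda>p. tan_scale (1/2) (B Y Y p))
      in ip d d + 2 * ip a b - 3 * ip a a - 4 * ip BX BY)"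

definition sectional_curvature :: "('m::topological_space, 'd::finite) chart set \<Rightarrow>
    ('m \<Rightarrow> 'm tangent \<Rightarrow> real) \<Rightarrow> 'm measure \<Rightarrow> 'm vfield \<Rightarrow> 'm vfield \<Rightarrow> real" where
  "sectional_curvature A \<theta> \<mu> X Y = arnold_C A \<theta> \<mu> X Y /
     (contact_inner \<theta> \<mu> X X * contact_inner \<theta> \<mu> Y Y - (contact_inner \<theta> \<mu> X Y)\<^sup>2)"

end

theory Submission
  imports Defs
begin

text \<open>Let \<open>f, h\<close> be the stream functions of the contact fields \<open>X, Y\<close>, and let \<open>\<lambda>\<^sub>X = E f\<close>, \<open>\<lambda>\<^sub>Y = E h\<close>
  be their conformal factors. The divergence of \<open>Y\<close> is \<open>(n + 1) \<lambda>\<^sub>Y\<close>, since the Riemannian volume is a constant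
  multiple of the contact volume. Integrating by parts, \<open>B(X, Y)\<close> is the contact field with stream function
  \<open>Y f + (n + 2) \<lambda>\<^sub>Y f\<close>. All terms of Arnold's formula are then explicit, and they combine into the integral
  of a square, \<open>C(X, Y) = \<integral> (P + (n + 3) Q)\<^sup>2 / 4\<close> with \<open>P = \<theta> [Y, X]\<close> and \<open>Q = \<lambda>\<^sub>Y f - \<lambda>\<^sub>X h\<close>.

  The divergence is computed without the wedge product: the bilinear form \<open>m = d\<theta> + \<theta> \<otimes> \<theta>\<close> satisfies
  \<open>(det m)\<^sup>2 = (det g)\<^sup>2\<close> in every frame, and the Lie derivative of \<open>m\<close> along \<open>Y\<close> follows from that of \<open>\<theta>\<close>.\<close>

section \<open>Calculus of smooth functions\<close>

text \<open>The form d\<theta> alone is degenerate along the Reeb field; adding \<theta> \<otimes>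
  \<theta> repairs this, and the determinant of the sum is, up to a constant, the square of the
  density of the contact volume. Only squares of determinants are compared, so no sign of a frame
  has to be chosen. The constants: the divergence gives n + 1, the conformal factor inside
  \<open>ad\<close> adds one for B, and rewriting Y f as P + \<lambda>_Y f adds another. With s =
  \<lambda>_Y f and t = \<lambda>_X h, Arnold's formula contains (s + t)^2 - 4 s t = (s - t)^2,
  which is why a perfect square remains. Two features of the definitions shape the rest. Tangent
  vectors are derivations of global smooth functions, so coordinate frames must be cut off and
  extended, and Hadamard's lemma is what shows that they span. And B is a definite description, so
  it can be evaluated only after a contact field has been built for every stream function and the L2
  product has been shown to be definite on smooth functions.\<close>

lemma Ck_on_cong:
  assumes "open S" "\<And>x. x \<in> S \<Longrightarrow> f x = g x" "Ck_on k S f"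
  shows "Ck_on k S g"
  using assms(2,3)
proof (induction k arbitrary: f g)
  case 0
  then show ?case using continuous_on_cong by (metis Ck_on.simps(1))
next
  case (Suc k)
  have d: "f differentiable at x" if "x \<in> S" for x
    using Suc.prems that by simp
  have d': "g differentiable at x" if "x \<in> S" for x
    using d[OF that] Suc.prems(1) that assms(1)
    by (meson differentiable_def has_derivative_transform_within_open)
  have eq: "frechet_derivative f (at x) = frechet_derivative g (at x)" if "x \<in> S" for x
    by (rule frechet_derivative_transform_within_open[OF d[OF that] assms(1) that]) (simp add: Suc.prems)
  have "Ck_on k S (\<lambda>x. frechet_derivative g (at x) v)" for v
    by (rule Suc.IH[of "\<lambda>x. frechet_derivative f (at x) v"]) (use eq Suc.prems in simp_all)
  with d' show ?case by simp
qed

lemma Ck_on_subset: "Ck_on k T f \<Longrightarrow> S \<subseteq> T \<Longrightarrow> Ck_on k S f"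
  by (induction k arbitrary: f) (auto elim: continuous_on_subset)

lemma Ck_on_local:
  assumes "\<And>x. x \<in> S \<Longrightarrow> \<exists>N. open N \<and> x \<in> N \<and> Ck_on k N f"
  shows "Ck_on k S f"
  using assms
proof (induction k arbitrary: f)
  case 0
  then show ?case
    by (metis Ck_on.simps(1) continuous_at_imp_continuous_on continuous_on_eq_continuous_at)
next
  case (Suc k)
  have "Ck_on k S (\<lambda>x. frechet_derivative f (at x) v)" for v
  proof (rule Suc.IH)
    fix x assume "x \<in> S"
    then obtain N where "open N" "x \<in> N" "Ck_on (Suc k) N f" using Suc.prems by blast
    then show "\<exists>N. open N \<and> x \<in> N \<and> Ck_on k N (\<lambda>x. frechet_derivative f (at x) v)"
      by (intro exI[of _ N]) simp
  qed
  moreover have "f differentiable (at x)" if "x \<in> S" for x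
    using Suc.prems[OF that] by auto
  ultimately show ?case by simp
qed

lemma Ck_on_SucD: "Ck_on (Suc k) S f \<Longrightarrow> x \<in> S \<Longrightarrow> (f has_derivative frechet_derivative f (at x)) (at x)"
  by (simp add: frechet_derivative_works[symmetric])

text \<open>Any explicit derivative may be used, since uniqueness identifies it with
  \<open>frechet_derivative\<close>. The closure lemmas below draw their induction steps from this
  rule.\<close>

lemma Ck_on_SucI:
  assumes "open S" "\<And>x. x \<in> S \<Longrightarrow> (f has_derivative f' x) (at x)" "\<And>v. Ck_on k S (\<lambda>x. f' x v)"
  shows "Ck_on (Suc k) S f"
proof -
  have eq: "f' x = frechet_derivative f (at x)" if "x \<in> S" for x
    using assms(2)[OF that] by (rule frechet_derivative_at)
  have "Ck_on k S (\<lambda>x. frechet_derivative f (at x) v)" for v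
    by (rule Ck_on_cong[OF assms(1) _ assms(3)[of v]]) (simp add: eq)
  then show ?thesis using assms(2) by (auto simp: differentiable_def)
qed

text \<open>Not built into the definition, whose successor case mentions derivatives only; the
  induction bottoms out at differentiable functions being continuous.\<close>

lemma Ck_on_SucE: "Ck_on (Suc k) S f \<Longrightarrow> Ck_on k S f"
proof (induction k arbitrary: f)
  case 0
  then have "\<forall>x\<in>S. isCont f x"
    by (simp add: differentiable_imp_continuous_within)
  then show ?case by (simp add: continuous_at_imp_continuous_on)
next
  case (Suc k)
  then show ?case by (metis Ck_on.simps(2))
qed

lemma Ck_on_const [simp]: "Ck_on k S (\<lambda>x. c)"
  by (induction k arbitrary: c) auto

lemma Ck_on_bounded_linear_compose:
  assumes "open S" "bounded_linear h" "Ck_on k S f"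
  shows "Ck_on k S (\<lambda>x. h (f x))"
  using assms(3)
proof (induction k arbitrary: f)
  case 0
  then show ?case using bounded_linear.continuous_on[OF assms(2)] by simp
next
  case (Suc k)
  show ?case
    by (rule Ck_on_SucI[OF assms(1) bounded_linear.has_derivative[OF assms(2) Ck_on_SucD[OF Suc.prems]]])
       (use Suc in simp_all)
qed

lemma Ck_on_bounded_linear:
  assumes "open S" "bounded_linear h"
  shows "Ck_on k S h"
proof (cases k)
  case 0
  then show ?thesis using assms by (simp add: linear_continuous_on)
next
  case (Suc j)
  show ?thesis unfolding Suc
    by (rule Ck_on_SucI[OF assms(1) bounded_linear_imp_has_derivative[OF assms(2)]]) simp
qed

lemma Ck_on_add:
  assumes "open S" "Ck_on k S f" "Ck_on k S g"
  shows "Ck_on k S (\<lambda>x. f x + g x)"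
  using assms(2,3)
proof (induction k arbitrary: f g)
  case 0
  then show ?case by (simp add: continuous_on_add continuous_on_mult)
next
  case (Suc k)
  show ?case
    by (rule Ck_on_SucI[OF assms(1) has_derivative_add[OF Suc.prems[THEN Ck_on_SucD]]])
       (use Suc in simp_all)
qed

lemma Ck_on_mult:
  fixes f g :: "'a::real_normed_vector \<Rightarrow> real"
  assumes "open S" "Ck_on k S f" "Ck_on k S g"
  shows "Ck_on k S (\<lambda>x. f x * g x)"
  using assms(2,3)
proof (induction k arbitrary: f g)
  case 0
  then show ?case by (simp add: continuous_on_add continuous_on_mult)
next
  case (Suc k)
  have "Ck_on k S f" "Ck_on k S g" by (rule Suc.prems[THEN Ck_on_SucE])+
  with Suc show ?case
    by (intro Ck_on_SucI[OF assms(1) has_derivative_mult[OF Suc.prems[THEN Ck_on_SucD]]]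
        Ck_on_add[OF assms(1)]) simp_all
qed

lemma Ck_on_sum:
  assumes "open S" "\<And>i. i \<in> I \<Longrightarrow> Ck_on k S (f i)"
  shows "Ck_on k S (\<lambda>x. \<Sum>i\<in>I. f i x)"
  using assms(2)
  by (induction I rule: infinite_finite_induct) (auto intro: Ck_on_add[OF assms(1)])

lemma Ck_on_inverse:
  fixes f :: "'a::real_normed_vector \<Rightarrow> real"
  assumes "open S" "Ck_on k S f" "\<And>x. x \<in> S \<Longrightarrow> f x \<noteq> 0"
  shows "Ck_on k S (\<lambda>x. inverse (f x))"
  using assms(2)
proof (induction k)
  case 0
  then show ?case using assms(3) by (simp add: continuous_on_inverse)
next
  case (Suc k)
  have "Ck_on k S (\<lambda>x. inverse (f x))"
    by (rule Suc.IH[OF Ck_on_SucE[OF Suc.prems]])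
  then have "Ck_on k S (\<lambda>x. (-1) * (inverse (f x) * frechet_derivative f (at x) v * inverse (f x)))" for v
    using Suc.prems by (intro Ck_on_mult assms(1)) simp_all
  then show ?case
    by (intro Ck_on_SucI[OF assms(1) Deriv.has_derivative_inverse[OF assms(3) Ck_on_SucD[OF Suc.prems]]]) simp_all
qed

lemma Ck_on_compose:
  fixes f :: "'b::euclidean_space \<Rightarrow> real" and g :: "'a::real_normed_vector \<Rightarrow> 'b"
  assumes "open S" "open T" "g ` S \<subseteq> T" "Ck_on k S g" "Ck_on k T f"
  shows "Ck_on k S (\<lambda>x. f (g x))"
  using assms(4,5)
proof (induction k arbitrary: f)
  case 0
  then show ?case using assms(3) by (metis Ck_on.simps(1) continuous_on_compose2)
next
  case (Suc k)
  have gk: "Ck_on k S g" by (rule Suc.prems(1)[THEN Ck_on_SucE])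
  \<comment> \<open>The chain rule evaluates Df in the direction Dg(v), which moves with x, whereas
    \<open>Ck_on\<close> controls fixed directions only; expanding in \<open>Basis\<close> reduces
    to those.\<close>
  have lin: "frechet_derivative f (at (g x)) w =
      (\<Sum>b\<in>Basis. (w \<bullet> b) * frechet_derivative f (at (g x)) b)" if "x \<in> S" for x w
  proof -
    have "linear (frechet_derivative f (at (g x)))"
      using Ck_on_SucD[OF Suc.prems(2)] assms(3) that has_derivative_linear by blast
    then show ?thesis
      by (subst euclidean_representation[of w, symmetric])
         (simp only: linear_sum linear_scale real_scaleR_def)
  qed
  show ?case
  proof (rule Ck_on_SucI[OF assms(1)])
    show "((\<lambda>x. f (g x)) has_derivative
        (\<lambda>v. frechet_derivative f (at (g x)) (frechet_derivative g (at x) v))) (at x)" if "x \<in> S" for x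
      using has_derivative_compose[OF Ck_on_SucD[OF Suc.prems(1) that] Ck_on_SucD[OF Suc.prems(2)]]
        that assms(3) by auto
    have "Ck_on k S (\<lambda>x. \<Sum>b\<in>Basis. (frechet_derivative g (at x) v \<bullet> b) * frechet_derivative f (at (g x)) b)" for v
    proof (intro Ck_on_sum Ck_on_mult assms(1))
      fix b :: 'b
      show "Ck_on k S (\<lambda>x. frechet_derivative g (at x) v \<bullet> b)"
        using Suc.prems(1) by (intro Ck_on_bounded_linear_compose[OF assms(1) bounded_linear_inner_left]) simp
      show "Ck_on k S (\<lambda>x. frechet_derivative f (at (g x)) b)"
        using Suc.prems(2) by (intro Suc.IH[OF gk]) simp
    qed
    then show "Ck_on k S (\<lambda>x. frechet_derivative f (at (g x)) (frechet_derivative g (at x) v))" for v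
      by (rule Ck_on_cong[OF assms(1), rotated]) (use lin in auto)
  qed
qed

lemma smooth_on_cong: "open S \<Longrightarrow> (\<And>x. x \<in> S \<Longrightarrow> f x = g x) \<Longrightarrow> smooth_on S f \<Longrightarrow> smooth_on S g"
  unfolding smooth_on_def by (intro allI, rule Ck_on_cong[of _ f]) simp_all

lemma smooth_on_subset: "smooth_on T f \<Longrightarrow> S \<subseteq> T \<Longrightarrow> smooth_on S f"
  unfolding smooth_on_def by (intro allI, rule Ck_on_subset[of _ T]) simp_all

lemma smooth_on_local:
  assumes "\<And>x. x \<in> S \<Longrightarrow> \<exists>N. open N \<and> x \<in> N \<and> smooth_on N f"
  shows "smooth_on S f"
  unfolding smooth_on_def
proof (intro allI Ck_on_local)
  fix k x assume "x \<in> S"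
  then show "\<exists>N. open N \<and> x \<in> N \<and> Ck_on k N f"
    using assms[of x] unfolding smooth_on_def by auto
qed

lemma smooth_on_const [simp]: "smooth_on S (\<lambda>x. c)"
  by (simp add: smooth_on_def)

lemma smooth_on_bounded_linear: "open S \<Longrightarrow> bounded_linear h \<Longrightarrow> smooth_on S h"
  by (simp add: smooth_on_def Ck_on_bounded_linear)

lemma smooth_on_add: "open S \<Longrightarrow> smooth_on S f \<Longrightarrow> smooth_on S g \<Longrightarrow> smooth_on S (\<lambda>x. f x + g x)"
  by (simp add: smooth_on_def Ck_on_add)

lemma smooth_on_mult:
  fixes f g :: "'a::real_normed_vector \<Rightarrow> real"
  shows "open S \<Longrightarrow> smooth_on S f \<Longrightarrow> smooth_on S g \<Longrightarrow> smooth_on S (\<lambda>x. f x * g x)"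
  by (simp add: smooth_on_def Ck_on_mult)

lemma smooth_on_sum:
  "open S \<Longrightarrow> (\<And>i. i \<in> I \<Longrightarrow> smooth_on S (f i)) \<Longrightarrow> smooth_on S (\<lambda>x. \<Sum>i\<in>I. f i x)"
  by (simp add: smooth_on_def Ck_on_sum)

lemma smooth_on_inverse:
  fixes f :: "'a::real_normed_vector \<Rightarrow> real"
  shows "open S \<Longrightarrow> smooth_on S f \<Longrightarrow> (\<And>x. x \<in> S \<Longrightarrow> f x \<noteq> 0) \<Longrightarrow> smooth_on S (\<lambda>x. inverse (f x))"
  by (simp add: smooth_on_def Ck_on_inverse)

lemma smooth_on_compose:
  fixes f :: "'b::euclidean_space \<Rightarrow> real" and g :: "'a::real_normed_vector \<Rightarrow> 'b"
  assumes "open S" "open T" "g ` S \<subseteq> T" "smooth_on S g" "smooth_on T f"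
  shows "smooth_on S (\<lambda>x. f (g x))"
  unfolding smooth_on_def
proof
  show "Ck_on k S (\<lambda>x. f (g x))" for k
    by (rule Ck_on_compose[OF assms(1-3)]) (use assms(4,5) in \<open>simp_all add: smooth_on_def\<close>)
qed

lemma smooth_on_frechet_derivative:
  "smooth_on S f \<Longrightarrow> smooth_on S (\<lambda>x. frechet_derivative f (at x) v)"
  unfolding smooth_on_def
proof
  assume *: "\<forall>k. Ck_on k S f"
  show "Ck_on k S (\<lambda>x. frechet_derivative f (at x) v)" for k
    using *[rule_format, of "Suc k"] by simp
qed

lemma smooth_on_has_derivative:
  "smooth_on S f \<Longrightarrow> x \<in> S \<Longrightarrow> (f has_derivative frechet_derivative f (at x)) (at x)"
  by (rule Ck_on_SucD[of 0 S]) (simp_all only: smooth_on_def)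

lemma smooth_on_continuous_on: "smooth_on S f \<Longrightarrow> continuous_on S f"
  unfolding smooth_on_def Ck_on.simps(1)[symmetric] by simp

text \<open>The family \<open>exp (-1/t) / t ^ n\<close> is closed under differentiation up to linear combinations,
  so all its members are shown to be \<open>C\<^sup>k\<close> simultaneously.\<close>

definition flat :: "nat \<Rightarrow> real \<Rightarrow> real" where
  "flat n t = (if t > 0 then exp (- (1 / t)) / t ^ n else 0)"

text \<open>With x = 1/t this is the decay of x^n / exp x at infinity.\<close>

lemma flat_tendsto_0: "((\<lambda>t. exp (- (1 / t)) / t ^ n) \<longlongrightarrow> 0) (at_right (0::real))"
proof -
  have "((\<lambda>x::real. x ^ n / exp x) \<longlongrightarrow> 0) at_top" by (rule tendsto_power_div_exp_0)
  then have "((\<lambda>t::real. (inverse t) ^ n / exp (inverse t)) \<longlongrightarrow> 0) (at_right 0)"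
    using filterlim_compose filterlim_inverse_at_top_right by blast
  then show ?thesis
    by (simp add: exp_minus inverse_eq_divide power_divide field_simps)
qed

lemma flat_has_derivative:
  "(flat n has_real_derivative (flat (n + 2) t - real n * flat (n + 1) t)) (at t)"
proof -
  consider "t > 0" | "t < 0" | "t = 0" by linarith
  then show ?thesis
  proof cases
    case 1
    \<comment> \<open>The power rule leaves an exponent with truncated subtraction; this relates it
      to the full power and sets exponent 0 apart.\<close>
    have pow: "k = 0 \<or> t ^ k = t * t ^ (k - Suc 0)" for k
      by (cases k) auto
    have "((\<lambda>t. exp (- (1 / t)) / t ^ n) has_real_derivative (flat (n + 2) t - real n * flat (n + 1) t)) (at t)"
      using 1 pow by (cases n) (auto intro!: derivative_eq_intros simp: flat_def field_simps power2_eq_square)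
    then show ?thesis
      by (rule has_field_derivative_transform_within_open[where S = "{0<..}"]) (use 1 in \<open>auto simp: flat_def\<close>)
  next
    case 2
    have "((\<lambda>t. 0::real) has_real_derivative (flat (n + 2) t - real n * flat (n + 1) t)) (at t)"
      using 2 by (auto simp: flat_def)
    then show ?thesis
      by (rule has_field_derivative_transform_within_open[where S = "{..<0}"]) (use 2 in \<open>auto simp: flat_def\<close>)
  next
    case 3
    have "((\<lambda>y. (flat n y - flat n 0) / (y - 0)) \<longlongrightarrow> 0) (at 0)"
    proof (rule filterlim_split_at)
      have "eventually (\<lambda>y. (flat n y - flat n 0) / (y - 0) = 0) (at_left (0::real))"
        by (auto simp: eventually_at_left_field flat_def intro: exI[of _ "-1"])
      then show "((\<lambda>y. (flat n y - flat n 0) / (y - 0)) \<longlongrightarrow> 0) (at_left 0)"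
        by (rule tendsto_eventually)
      \<comment> \<open>To the right of 0 the difference quotient of member n of the family is
        member n + 1, whose limit is known.\<close>
      have "eventually (\<lambda>y. exp (- (1 / y)) / y ^ Suc n = (flat n y - flat n 0) / (y - 0)) (at_right (0::real))"
        by (auto simp: eventually_at_right_field flat_def intro: exI[of _ "1"])
      with flat_tendsto_0[of "Suc n"] show "((\<lambda>y. (flat n y - flat n 0) / (y - 0)) \<longlongrightarrow> 0) (at_right 0)"
        using tendsto_cong by fast
    qed
    then show ?thesis
      using 3 by (simp add: has_field_derivative_iff flat_def)
  qed
qed

lemma Ck_on_flat: "Ck_on k UNIV (flat n)"
proof (induction k arbitrary: n)
  case 0
  then show ?case
    using flat_has_derivative DERIV_continuous_on by (auto simp: continuous_on_eq_continuous_at intro: DERIV_isCont)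
next
  case (Suc k)
  show ?case
  proof (rule Ck_on_SucI[OF open_UNIV flat_has_derivative[unfolded has_field_derivative_def]])
    fix v :: real
    have "Ck_on k UNIV (\<lambda>x. (flat (n+2) x + (- real n) * flat (n+1) x) * v)"
      by (intro Ck_on_mult Ck_on_add Suc.IH open_UNIV Ck_on_const)
    then show "Ck_on k UNIV (\<lambda>x. (flat (n+2) x - real n * flat (n+1) x) * v)" by simp
  qed
qed

section \<open>Smooth step and bump functions\<close>

definition smooth_step :: "real \<Rightarrow> real" where
  "smooth_step t = flat 0 t * inverse (flat 0 t + flat 0 (1 - t))"

text \<open>At least one of t and 1 - t is positive; hence the quotient defining
  \<open>smooth_step\<close> is smooth on the whole line.\<close>

lemma flat_sum_pos: "flat 0 t + flat 0 (1 - t) > 0"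
  by (cases "t > 0") (auto simp: flat_def intro: add_pos_pos)

lemma smooth_step_bounds: "0 \<le> smooth_step t" "smooth_step t \<le> 1"
  and smooth_step_0: "t \<le> 0 \<Longrightarrow> smooth_step t = 0"
  and smooth_step_1: "t \<ge> 1 \<Longrightarrow> smooth_step t = 1"
  by (auto simp: smooth_step_def flat_def divide_simps flat_sum_pos[unfolded flat_def] less_imp_le not_less)

lemma smooth_on_flat: "smooth_on UNIV (flat n)"
  by (simp add: smooth_on_def Ck_on_flat)

lemma smooth_on_smooth_step: "smooth_on UNIV smooth_step"
proof -
  have lin: "smooth_on UNIV (\<lambda>t::real. 1 + (-1) * t)"
    by (intro smooth_on_add smooth_on_mult smooth_on_const open_UNIV smooth_on_bounded_linear bounded_linear_ident)
  have "smooth_on UNIV (\<lambda>t. flat 0 (1 + (-1) * t))"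
    by (rule smooth_on_compose[OF open_UNIV open_UNIV subset_UNIV lin smooth_on_flat])
  then have "smooth_on UNIV (\<lambda>t. flat 0 t * inverse (flat 0 t + flat 0 (1 + (-1) * t)))"
    using flat_sum_pos by (intro smooth_on_mult smooth_on_inverse smooth_on_add smooth_on_flat open_UNIV)
       (simp_all add: less_imp_neq[symmetric])
  then show ?thesis by (simp add: smooth_step_def[abs_def])
qed

lemma exists_smooth_bump:
  fixes x0 :: "'a::euclidean_space"
  assumes "0 < r" "r < R"
  obtains b :: "'a \<Rightarrow> real" where "smooth_on UNIV b" "\<And>x. 0 \<le> b x" "\<And>x. b x \<le> 1"
    "\<And>x. dist x0 x \<le> r \<Longrightarrow> b x = 1" "\<And>x. dist x0 x \<ge> R \<Longrightarrow> b x = 0"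
proof
  \<comment> \<open>An affine function of the squared distance, hence a polynomial in x, with value
    1 on the sphere of radius r and 0 on that of radius R.\<close>
  define q where "q x = (R\<^sup>2 - (dist x0 x)\<^sup>2) / (R\<^sup>2 - r\<^sup>2)" for x
  have pos: "R\<^sup>2 - r\<^sup>2 > 0" using assms by (simp add: power_strict_mono)
  have eq: "(dist x0 x)\<^sup>2 = (\<Sum>b\<in>Basis. (x \<bullet> b + - (x0 \<bullet> b)) * (x \<bullet> b + - (x0 \<bullet> b)))" for x
    unfolding dist_norm power2_norm_eq_inner
    by (subst euclidean_inner, rule sum.cong) (simp_all add: inner_diff_left algebra_simps)
  have "smooth_on UNIV (\<lambda>x. (R\<^sup>2 + (-1) * (dist x0 x)\<^sup>2) * inverse (R\<^sup>2 - r\<^sup>2))"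
    unfolding eq
    by (intro smooth_on_mult smooth_on_add smooth_on_const smooth_on_sum open_UNIV
        smooth_on_bounded_linear bounded_linear_inner_left)
  then have q: "smooth_on UNIV q" by (simp add: q_def[abs_def] divide_inverse)
  show "smooth_on UNIV (\<lambda>x. smooth_step (q x))"
    by (rule smooth_on_compose[OF open_UNIV open_UNIV subset_UNIV q smooth_on_smooth_step])
  show "smooth_step (q x) = 1" if "dist x0 x \<le> r" for x
    using that assms pos by (intro smooth_step_1) (simp add: q_def power_mono)
  show "smooth_step (q x) = 0" if "dist x0 x \<ge> R" for x
    using that assms pos by (intro smooth_step_0) (simp add: q_def power_mono divide_le_0_iff)
qed (auto simp: smooth_step_bounds)

section \<open>Hadamard's lemma\<close>

text \<open>Differentiating in x under the integral brings out one factor t and a directional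
  derivative of H. The weight \<open>t ^ j\<close> and the arbitrary H make the family closed under
  this, so that the induction on k goes through.\<close>

lemma Ck_on_integral_segment:
  fixes H :: "'a::euclidean_space \<Rightarrow> real"
  assumes "open B" "convex B" "x0 \<in> B" "smooth_on B H"
  shows "Ck_on k B (\<lambda>x. integral {0..1} (\<lambda>t. t ^ j * H (x0 + t *\<^sub>R (x - x0))))"
  using assms(4)
proof (induction k arbitrary: j H)
  have seg: "x0 + t *\<^sub>R (x - x0) \<in> B" if "x \<in> B" "t \<in> {0..1}" for x t
  proof -
    have "(1 - t) *\<^sub>R x0 + t *\<^sub>R x \<in> B"
      using that assms(2,3) by (intro convexD_alt) auto
    then show ?thesis by (simp add: algebra_simps)
  qed
  have cont: "continuous_on (B \<times> {0..1}) (\<lambda>(x, t). t ^ j * H (x0 + t *\<^sub>R (x - x0)))"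
    if "smooth_on B H" for H :: "'a \<Rightarrow> real" and j
    unfolding case_prod_beta
    by (intro continuous_intros continuous_on_compose2[OF smooth_on_continuous_on[OF that]])
       (auto intro!: seg)
  have der: "((\<lambda>x. integral {0..1} (\<lambda>t. t ^ j * H (x0 + t *\<^sub>R (x - x0)))) has_derivative
      (\<lambda>v. integral {0..1} (\<lambda>t. t ^ (j + 1) * frechet_derivative H (at (x0 + t *\<^sub>R (x - x0))) v))) (at x)"
    if H: "smooth_on B H" and x: "x \<in> B" for H :: "'a \<Rightarrow> real" and j x
  proof -
    define D where "D x t v = t ^ (j + 1) * frechet_derivative H (at (x0 + t *\<^sub>R (x - x0))) v" for x t v
    have d: "((\<lambda>x. t ^ j * H (x0 + t *\<^sub>R (x - x0))) has_derivative D x t) (at x)"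
      if "x \<in> B" "t \<in> {0..1}" for x t
    proof -
      let ?H' = "frechet_derivative H (at (x0 + t *\<^sub>R (x - x0)))"
      have H': "(H has_derivative ?H') (at (x0 + t *\<^sub>R (x - x0)))"
        by (rule smooth_on_has_derivative[OF H seg[OF that]])
      have "((\<lambda>x. x0 + t *\<^sub>R (x - x0)) has_derivative (\<lambda>v. t *\<^sub>R v)) (at x)"
        by (auto intro!: derivative_eq_intros)
      from has_derivative_compose[OF this H']
      have "((\<lambda>x. t ^ j * H (x0 + t *\<^sub>R (x - x0))) has_derivative (\<lambda>v. t ^ j * ?H' (t *\<^sub>R v))) (at x)"
        by (rule has_derivative_mult_right)
      moreover have "(\<lambda>v. t ^ j * ?H' (t *\<^sub>R v)) = D x t"
        using linear_scale[OF has_derivative_linear[OF H']] by (auto simp: D_def)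
      ultimately show ?thesis by simp
    qed
    have bl: "blinfun_apply (Blinfun (D x t)) = D x t" if "x \<in> B" "t \<in> {0..1}" for x t
      using d[OF that] has_derivative_bounded_linear bounded_linear_Blinfun_apply by blast
    have c: "continuous_on (B \<times> {0..1}) (\<lambda>(x, t). D x t v)" for v
      using cont[OF smooth_on_frechet_derivative[OF H], of "j + 1" v] by (simp add: D_def)
    \<comment> \<open>The Leibniz rule asks for continuity of the derivative as a bounded linear
      map; in finite dimension it can be checked on basis vectors.\<close>
    have c': "continuous_on (B \<times> {0..1}) (\<lambda>(x, t). Blinfun (D x t))"
      unfolding case_prod_beta
    proof (rule continuous_on_blinfun_componentwise)
      fix i :: 'a
      have "continuous_on (B \<times> {0..1}) (\<lambda>y. blinfun_apply (Blinfun (D (fst y) (snd y))) i) \<longleftrightarrow>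
          continuous_on (B \<times> {0..1}) (\<lambda>(x, t). D x t i)"
        by (rule continuous_on_cong) (auto simp: bl)
      with c show "continuous_on (B \<times> {0..1}) (\<lambda>y. blinfun_apply (Blinfun (D (fst y) (snd y))) i)"
        by blast
    qed
    have i: "(\<lambda>t. t ^ j * H (x0 + t *\<^sub>R (x - x0))) integrable_on cbox 0 1" if "x \<in> B" for x
      by (rule integrable_continuous)
         (use that in \<open>auto intro!: continuous_intros continuous_on_compose2[OF smooth_on_continuous_on[OF H]] seg\<close>)
    have "((\<lambda>x. integral (cbox 0 1) (\<lambda>t. t ^ j * H (x0 + t *\<^sub>R (x - x0)))) has_derivative
        integral (cbox 0 1) (\<lambda>t. Blinfun (D x t))) (at x within B)"
      by (rule leibniz_rule[OF _ i _ x assms(2)])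
         (use d bl c' in \<open>auto simp: has_derivative_at_withinI\<close>)
    moreover have "blinfun_apply (integral (cbox 0 1) (\<lambda>t. Blinfun (D x t))) = (\<lambda>v. integral {0..1} (\<lambda>t. D x t v))"
    proof
      fix v
      have "(\<lambda>t. Blinfun (D x t)) integrable_on cbox 0 1"
        by (rule integrable_continuous, rule continuous_on_compose2[OF c', of _ "\<lambda>t. (x, t)", simplified])
           (use x in \<open>auto intro!: continuous_intros\<close>)
      then have "blinfun_apply (integral (cbox 0 1) (\<lambda>t. Blinfun (D x t))) v
          = integral (cbox 0 1) (\<lambda>t. blinfun_apply (Blinfun (D x t)) v)"
        by (rule blinfun_apply_integral)
      then show "blinfun_apply (integral (cbox 0 1) (\<lambda>t. Blinfun (D x t))) v = integral {0..1} (\<lambda>t. D x t v)"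
        using bl[OF x] by (auto intro: integral_cong)
    qed
    ultimately show ?thesis
      using x assms(1) by (simp add: D_def at_within_open[of x B])
  qed
  { case 0
    show ?case
      by (simp, rule integral_continuous_on_param[where a = 0 and b = "1::real", simplified, OF cont[OF 0]])
  next
    case (Suc k)
    show ?case
      by (rule Ck_on_SucI[OF assms(1) der[OF Suc.prems]]) (assumption, rule Suc.IH[OF smooth_on_frechet_derivative[OF Suc.prems]])
  }
qed

text \<open>The fundamental theorem of calculus along the segment from x0 to x, which convexity
  keeps inside B; \<open>G b\<close> averages the derivative of F in direction b over this
  segment.\<close>

lemma hadamard:
  fixes F :: "'a::euclidean_space \<Rightarrow> real"
  assumes "open B" "convex B" "x0 \<in> B" "smooth_on B F"
  obtains G where "\<And>b. smooth_on B (G b)" "\<And>b. G b x0 = frechet_derivative F (at x0) b"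
    "\<And>x. x \<in> B \<Longrightarrow> F x = F x0 + (\<Sum>b\<in>Basis. ((x - x0) \<bullet> b) * G b x)"
proof
  define G where "G b x = integral {0..1} (\<lambda>t. t ^ 0 * frechet_derivative F (at (x0 + t *\<^sub>R (x - x0))) b)" for b x
  show "smooth_on B (G b)" for b
    unfolding smooth_on_def G_def
    by (intro allI Ck_on_integral_segment[OF assms(1-3)] smooth_on_frechet_derivative assms(4))
  show "G b x0 = frechet_derivative F (at x0) b" for b
    by (simp add: G_def)
  fix x assume x: "x \<in> B"
  have seg: "x0 + t *\<^sub>R (x - x0) \<in> B" if "t \<in> {0..1}" for t
  proof -
    have "(1 - t) *\<^sub>R x0 + t *\<^sub>R x \<in> B"
      using that x assms(2,3) by (intro convexD_alt) auto
    then show ?thesis by (simp add: algebra_simps)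
  qed
  let ?D = "\<lambda>t b. frechet_derivative F (at (x0 + t *\<^sub>R (x - x0))) b"
  have der: "((\<lambda>t. F (x0 + t *\<^sub>R (x - x0))) has_vector_derivative (\<Sum>b\<in>Basis. ((x - x0) \<bullet> b) * ?D t b)) (at t within {0..1})"
    if "t \<in> {0..1}" for t
  proof -
    have F': "(F has_derivative ?D t) (at (x0 + t *\<^sub>R (x - x0)))"
      by (rule smooth_on_has_derivative[OF assms(4) seg[OF that]])
    have "((\<lambda>t. x0 + t *\<^sub>R (x - x0)) has_derivative (\<lambda>s. s *\<^sub>R (x - x0))) (at t within {0..1})"
      by (auto intro!: derivative_eq_intros)
    from has_derivative_compose[OF this F']
    have "((\<lambda>t. F (x0 + t *\<^sub>R (x - x0))) has_derivative (\<lambda>s. ?D t (s *\<^sub>R (x - x0)))) (at t within {0..1})" .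
    moreover have "?D t (x - x0) = (\<Sum>b\<in>Basis. ((x - x0) \<bullet> b) * ?D t b)"
      using has_derivative_linear[OF F']
      by (subst euclidean_representation[of "x - x0", symmetric])
         (simp only: linear_sum linear_scale real_scaleR_def)
    ultimately show ?thesis
      using linear_scale[OF has_derivative_linear[OF F']] by (simp add: has_vector_derivative_def)
  qed
  have int: "((\<lambda>t. ((x - x0) \<bullet> b) * ?D t b) has_integral ((x - x0) \<bullet> b) * G b x) {0..1}" for b
  proof (rule has_integral_mult_right)
    have "continuous_on {0..1} (\<lambda>t. ?D t b)"
      by (intro continuous_on_compose2[OF smooth_on_continuous_on[OF smooth_on_frechet_derivative[OF assms(4)]]] continuous_intros)
         (auto intro!: seg)
    then show "((\<lambda>t. ?D t b) has_integral G b x) {0..1}"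
      by (simp add: G_def integrable_continuous_real integrable_integral)
  qed
  have "((\<lambda>t. \<Sum>b\<in>Basis. ((x - x0) \<bullet> b) * ?D t b) has_integral F (x0 + 1 *\<^sub>R (x - x0)) - F (x0 + 0 *\<^sub>R (x - x0))) {0..1}"
    by (rule fundamental_theorem_of_calculus[OF _ der]) auto
  moreover have "((\<lambda>t. \<Sum>b\<in>Basis. ((x - x0) \<bullet> b) * ?D t b) has_integral (\<Sum>b\<in>Basis. ((x - x0) \<bullet> b) * G b x)) {0..1}"
    by (rule has_integral_sum) (auto intro: int)
  ultimately have "F (x0 + 1 *\<^sub>R (x - x0)) - F (x0 + 0 *\<^sub>R (x - x0)) = (\<Sum>b\<in>Basis. ((x - x0) \<bullet> b) * G b x)"
    by (rule has_integral_unique)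
  then show "F x = F x0 + (\<Sum>b\<in>Basis. ((x - x0) \<bullet> b) * G b x)" by simp
qed


section \<open>Tangent vectors and local frames\<close>

lemma sum_Basis_axis: "(\<Sum>b\<in>(Basis :: (real ^ 'd::finite) set). g b) = (\<Sum>i\<in>UNIV. g (axis i 1))"
proof -
  have "(Basis :: (real ^ 'd) set) = (\<lambda>i. axis i 1) ` UNIV"
    by (auto simp: Basis_vec_def)
  moreover have "inj (\<lambda>i::'d. axis i (1::real))"
    by (auto simp: inj_def axis_eq_axis)
  ultimately show ?thesis using sum.reindex[of "\<lambda>i::'d. axis i 1" UNIV g] by (simp add: comp_def)
qed

section \<open>Charts and smooth functions\<close>

locale smooth_manifold =
  fixes A :: "('m::t2_space, 'd::finite) chart set"
  assumes atlas: "smooth_atlas A"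
begin

lemma
  assumes "(U, c) \<in> A"
  shows chart_open: "open U" and chart_open_image: "open (c ` U)" and chart_inj: "inj_on c U"
    and chart_continuous: "continuous_on U c" and chart_inv_continuous: "continuous_on (c ` U) (inv_into U c)"
  using atlas assms unfolding smooth_atlas_def is_chart_def by auto

lemma chart_exists: obtains U c where "(U, c) \<in> A" "p \<in> U"
proof -
  have "p \<in> (\<Union>(U, c)\<in>A. U)" using atlas unfolding smooth_atlas_def by simp
  then show thesis using that by blast
qed

lemma chart_inv: "(U, c) \<in> A \<Longrightarrow> p \<in> U \<Longrightarrow> inv_into U c (c p) = p"
  by (simp add: chart_inj)

lemma chart_transition:
  "(U, c) \<in> A \<Longrightarrow> (V, d) \<in> A \<Longrightarrow> smooth_on (c ` (U \<inter> V)) (d \<circ> inv_into U c)"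
  using atlas unfolding smooth_atlas_def by fastforce

lemma chart_image_open_subset:
  assumes "(U, c) \<in> A" "open W" "W \<subseteq> U"
  shows "open (c ` W)"
proof -
  have "c ` W = c ` U \<inter> inv_into U c -` W"
    using assms(3) chart_inv[OF assms(1)] by auto
  moreover have "open (c ` U \<inter> inv_into U c -` W)"
    by (rule continuous_open_preimage[OF chart_inv_continuous chart_open_image]) (use assms in auto)
  ultimately show ?thesis by simp
qed

lemma chart_preimage_open: "(U, c) \<in> A \<Longrightarrow> open T \<Longrightarrow> open (U \<inter> c -` T)"
  by (rule continuous_open_preimage[OF chart_continuous chart_open])

lemma smooth_funsD: "f \<in> smooth_funs A \<Longrightarrow> (U, c) \<in> A \<Longrightarrow> smooth_on (c ` U) (f \<circ> inv_into U c)"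
  unfolding smooth_funs_def by blast

lemma smooth_funsI: "(\<And>U c. (U, c) \<in> A \<Longrightarrow> smooth_on (c ` U) (\<lambda>x. f (inv_into U c x))) \<Longrightarrow> f \<in> smooth_funs A"
  unfolding smooth_funs_def comp_def by blast

lemma smooth_funsD': "f \<in> smooth_funs A \<Longrightarrow> (U, c) \<in> A \<Longrightarrow> smooth_on (c ` U) (\<lambda>x. f (inv_into U c x))"
  using smooth_funsD unfolding comp_def .

lemma smooth_funs_const [simp]: "(\<lambda>p. a) \<in> smooth_funs A"
  by (rule smooth_funsI) simp

lemma smooth_funs_add [intro]:
  "f \<in> smooth_funs A \<Longrightarrow> h \<in> smooth_funs A \<Longrightarrow> (\<lambda>p. f p + h p) \<in> smooth_funs A"
  by (rule smooth_funsI) (simp add: smooth_on_add smooth_funsD' chart_open_image)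

lemma smooth_funs_mult [intro]:
  "f \<in> smooth_funs A \<Longrightarrow> h \<in> smooth_funs A \<Longrightarrow> (\<lambda>p. f p * h p) \<in> smooth_funs A"
  by (rule smooth_funsI) (simp add: smooth_on_mult smooth_funsD' chart_open_image)

lemma smooth_funs_minus [intro]: "f \<in> smooth_funs A \<Longrightarrow> (\<lambda>p. - f p) \<in> smooth_funs A"
  using smooth_funs_mult[of "\<lambda>p. - 1" f] by simp

lemma smooth_funs_diff [intro]:
  "f \<in> smooth_funs A \<Longrightarrow> h \<in> smooth_funs A \<Longrightarrow> (\<lambda>p. f p - h p) \<in> smooth_funs A"
  using smooth_funs_add[of f "\<lambda>p. - h p"] by (simp add: smooth_funs_minus)

lemma smooth_funs_sum [intro]:
  "(\<And>i. i \<in> I \<Longrightarrow> f i \<in> smooth_funs A) \<Longrightarrow> (\<lambda>p. \<Sum>i\<in>I. f i p) \<in> smooth_funs A"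
  by (induction I rule: infinite_finite_induct) auto

lemma smooth_funs_prod [intro]:
  "(\<And>i. i \<in> I \<Longrightarrow> f i \<in> smooth_funs A) \<Longrightarrow> (\<lambda>p. \<Prod>i\<in>I. f i p) \<in> smooth_funs A"
  by (induction I rule: infinite_finite_induct) auto

lemma smooth_funs_inverse:
  "f \<in> smooth_funs A \<Longrightarrow> (\<And>p. f p \<noteq> 0) \<Longrightarrow> (\<lambda>p. inverse (f p)) \<in> smooth_funs A"
  by (rule smooth_funsI) (simp add: smooth_on_inverse smooth_funsD' chart_open_image)

lemma smooth_funs_local:
  assumes "\<And>p. \<exists>W F. open W \<and> p \<in> W \<and> F \<in> smooth_funs A \<and> (\<forall>q\<in>W. f q = F q)"
  shows "f \<in> smooth_funs A"
proof (rule smooth_funsI, rule smooth_on_local)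
  fix U c x assume U: "(U, c) \<in> A" and x: "x \<in> c ` U"
  then obtain p where p: "p \<in> U" "x = c p" by auto
  obtain W F where W: "open W" "p \<in> W" "F \<in> smooth_funs A" "\<And>q. q \<in> W \<Longrightarrow> f q = F q"
    using assms[of p] by auto
  have o: "open (c ` (U \<inter> W))"
    using chart_open[OF U] W by (intro chart_image_open_subset[OF U]) auto
  have "smooth_on (c ` (U \<inter> W)) (\<lambda>x. f (inv_into U c x))"
  proof (rule smooth_on_cong[OF o])
    show "smooth_on (c ` (U \<inter> W)) (\<lambda>x. F (inv_into U c x))"
      by (rule smooth_on_subset[OF smooth_funsD'[OF W(3) U]]) auto
  qed (use W(4) chart_inv[OF U] in auto)
  then show "\<exists>N. open N \<and> x \<in> N \<and> smooth_on N (\<lambda>x. f (inv_into U c x))"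
    using o p W(2) by (intro exI[of _ "c ` (U \<inter> W)"]) auto
qed

lemma smooth_funs_continuous:
  assumes "f \<in> smooth_funs A"
  shows "continuous_on UNIV f"
proof (rule continuous_at_imp_continuous_on, rule ballI)
  fix p
  obtain U c where U: "(U, c) \<in> A" "p \<in> U" by (rule chart_exists)
  have "continuous_on U (\<lambda>q. (f \<circ> inv_into U c) (c q))"
    by (rule continuous_on_compose2[OF smooth_on_continuous_on[OF smooth_funsD[OF assms U(1)]] chart_continuous[OF U(1)]]) auto
  moreover have "continuous_on U (\<lambda>q. (f \<circ> inv_into U c) (c q)) = continuous_on U f"
    by (rule continuous_on_cong) (auto simp: chart_inv[OF U(1)])
  ultimately show "isCont f p"
    using chart_open[OF U(1)] U(2) by (simp add: continuous_on_eq_continuous_at)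
qed

text \<open>In any chart, a point of W is reached through the transition map, and a point outside W
  has the complement of K as a neighbourhood, where F is 0. This turns functions given in
  coordinates into global ones.\<close>

lemma smooth_funs_extend:
  assumes U: "(U, c) \<in> A" and W: "open W" "W \<subseteq> U" and K: "closed K" "K \<subseteq> W"
    and F: "\<And>q. q \<notin> K \<Longrightarrow> F q = 0" "smooth_on (c ` W) (\<lambda>x. F (inv_into U c x))"
  shows "F \<in> smooth_funs A"
proof (rule smooth_funsI, rule smooth_on_local)
  fix V d x assume V: "(V, d) \<in> A" and x: "x \<in> d ` V"
  then obtain q where q: "q \<in> V" "x = d q" by auto
  show "\<exists>N. open N \<and> x \<in> N \<and> smooth_on N (\<lambda>x. F (inv_into V d x))"
  proof (cases "q \<in> W")
    case True
    let ?N = "d ` (V \<inter> W)"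
    have o: "open ?N"
      using chart_open[OF V] W by (intro chart_image_open_subset[OF V]) auto
    have sub: "(c \<circ> inv_into V d) ` ?N \<subseteq> c ` W"
      using chart_inv[OF V] by auto
    have "smooth_on ?N (\<lambda>x. F (inv_into U c ((c \<circ> inv_into V d) x)))"
      by (rule smooth_on_compose[OF o chart_image_open_subset[OF U W] sub _ F(2)],
          rule smooth_on_subset[OF chart_transition[OF V U]]) (use W in auto)
    then have "smooth_on ?N (\<lambda>x. F (inv_into V d x))"
      by (rule smooth_on_cong[OF o, rotated]) (use W in \<open>auto simp: chart_inv[OF V] chart_inv[OF U] subset_iff\<close>)
    then show ?thesis using o q True by (intro exI[of _ ?N]) auto
  next
    case False
    let ?N = "d ` (V - K)"
    have o: "open ?N"
      using chart_open[OF V] K(1) by (intro chart_image_open_subset[OF V]) auto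
    have "smooth_on ?N (\<lambda>x. F (inv_into V d x))"
      by (rule smooth_on_cong[OF o _ smooth_on_const[of _ 0]]) (auto simp: chart_inv[OF V] F(1))
    then show ?thesis using o q False K(2) by (intro exI[of _ ?N]) auto
  qed
qed

section \<open>Bump functions on the manifold\<close>

lemma chart_bump:
  assumes U: "(U, c) \<in> A" and W: "open W" "W \<subseteq> U" "p \<in> W"
  obtains R \<beta> where "0 < R" "cball (c p) R \<subseteq> c ` W" "\<beta> \<in> smooth_funs A" "\<And>q. 0 \<le> \<beta> q" "\<And>q. \<beta> q \<le> 1"
    "\<And>q. q \<in> U \<inter> c -` ball (c p) (R / 2) \<Longrightarrow> \<beta> q = 1"
    "\<And>q. q \<notin> inv_into U c ` cball (c p) R \<Longrightarrow> \<beta> q = 0"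
    "compact (inv_into U c ` cball (c p) R)" "inv_into U c ` cball (c p) R \<subseteq> W"
proof -
  have "open (c ` W)" by (rule chart_image_open_subset[OF U W(1,2)])
  then obtain R where R: "0 < R" "cball (c p) R \<subseteq> c ` W"
    using W(3) by (meson imageI open_contains_cball)
  obtain b :: "real ^ 'd \<Rightarrow> real" where b: "smooth_on UNIV b" "\<And>x. 0 \<le> b x" "\<And>x. b x \<le> 1"
    "\<And>x. dist (c p) x \<le> R / 2 \<Longrightarrow> b x = 1" "\<And>x. dist (c p) x \<ge> R \<Longrightarrow> b x = 0"
    using exists_smooth_bump[of "R / 2" R "c p"] R(1) by auto
  define \<beta> where "\<beta> q = (if q \<in> U then b (c q) else 0)" for q
  let ?K = "inv_into U c ` cball (c p) R"
  have K: "compact ?K"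
    using R(2) W(2) by (intro compact_continuous_image continuous_on_subset[OF chart_inv_continuous[OF U]]) auto
  have KW: "?K \<subseteq> W" using R(2) W(2) chart_inv[OF U] by fastforce
  have 0: "\<beta> q = 0" if "q \<notin> ?K" for q
  proof (cases "q \<in> U")
    case True
    then have "c q \<notin> cball (c p) R"
      using that chart_inv[OF U True] by (metis imageI)
    then show ?thesis by (simp add: \<beta>_def b(5))
  qed (simp add: \<beta>_def)
  have sm: "smooth_on (c ` W) (\<lambda>x. \<beta> (inv_into U c x))"
    by (rule smooth_on_cong[OF \<open>open (c ` W)\<close> _ smooth_on_subset[OF b(1)]])
       (use W(2) in \<open>auto simp: \<beta>_def chart_inv[OF U] subset_iff\<close>)
  \<comment> \<open>The Hausdorff property enters here: the compact support is closed, so extension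
    by zero applies.\<close>
  have "\<beta> \<in> smooth_funs A"
    by (rule smooth_funs_extend[OF U W(1,2) compact_imp_closed[OF K] KW _ sm]) (rule 0)
  then show ?thesis
    by (rule that[OF R]) (use b 0 K KW in \<open>auto simp: \<beta>_def\<close>)
qed

lemma exists_bump:
  assumes "open W" "p \<in> W"
  obtains \<beta> N K where "\<beta> \<in> smooth_funs A" "\<And>q. 0 \<le> \<beta> q" "\<And>q. \<beta> q \<le> 1" "open N" "p \<in> N" "N \<subseteq> W"
    "\<And>q. q \<in> N \<Longrightarrow> \<beta> q = 1" "compact K" "K \<subseteq> W" "\<And>q. q \<notin> K \<Longrightarrow> \<beta> q = 0"
proof -
  obtain U c where U: "(U, c) \<in> A" "p \<in> U" by (rule chart_exists)
  have WU: "open (W \<inter> U)" "W \<inter> U \<subseteq> U" "p \<in> W \<inter> U"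
    using assms U chart_open[OF U(1)] by auto
  obtain R \<beta> where \<beta>: "0 < R" "cball (c p) R \<subseteq> c ` (W \<inter> U)" "\<beta> \<in> smooth_funs A" "\<And>q. 0 \<le> \<beta> q" "\<And>q. \<beta> q \<le> 1"
    "\<And>q. q \<in> U \<inter> c -` ball (c p) (R / 2) \<Longrightarrow> \<beta> q = 1"
    "\<And>q. q \<notin> inv_into U c ` cball (c p) R \<Longrightarrow> \<beta> q = 0"
    "compact (inv_into U c ` cball (c p) R)" "inv_into U c ` cball (c p) R \<subseteq> W \<inter> U"
    by (rule chart_bump[OF U(1) WU]) (rule that)
  show ?thesis
  proof (rule that[OF \<beta>(3-5), of "(U \<inter> c -` ball (c p) (R / 2)) \<inter> W" "inv_into U c ` cball (c p) R"])
    show "open ((U \<inter> c -` ball (c p) (R / 2)) \<inter> W)"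
      by (intro open_Int chart_preimage_open[OF U(1), unfolded] assms(1)) simp
  qed (use \<beta> U assms in auto)
qed

section \<open>Derivations and vector fields\<close>

lemma tangent_nonsmooth: "v \<in> tangent_space A p \<Longrightarrow> f \<notin> smooth_funs A \<Longrightarrow> v f = 0"
  and tangent_add: "v \<in> tangent_space A p \<Longrightarrow> f \<in> smooth_funs A \<Longrightarrow> h \<in> smooth_funs A \<Longrightarrow>
    v (\<lambda>q. f q + h q) = v f + v h"
  and tangent_scale: "v \<in> tangent_space A p \<Longrightarrow> f \<in> smooth_funs A \<Longrightarrow> v (\<lambda>q. a * f q) = a * v f"
  and tangent_mult: "v \<in> tangent_space A p \<Longrightarrow> f \<in> smooth_funs A \<Longrightarrow> h \<in> smooth_funs A \<Longrightarrow>
    v (\<lambda>q. f q * h q) = f p * v h + h p * v f"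
  unfolding tangent_space_def by auto

lemma tangent_minus: "v \<in> tangent_space A p \<Longrightarrow> f \<in> smooth_funs A \<Longrightarrow> v (\<lambda>q. - f q) = - v f"
  using tangent_scale[of v p f "- 1"] by simp

lemma tangent_diff: "v \<in> tangent_space A p \<Longrightarrow> f \<in> smooth_funs A \<Longrightarrow> h \<in> smooth_funs A \<Longrightarrow>
    v (\<lambda>q. f q - h q) = v f - v h"
  using tangent_add[of v p f "\<lambda>q. - h q"] tangent_minus[of v p h] smooth_funs_minus[of h] by simp

text \<open>The Leibniz rule for 1 * 1 forces v 1 = 0, and scaling does the rest.\<close>

lemma tangent_const [simp]:
  assumes "v \<in> tangent_space A p"
  shows "v (\<lambda>q. a) = 0"
proof -
  have "v (\<lambda>q. 1 * 1) = 1 * v (\<lambda>q. 1) + 1 * v (\<lambda>q. 1)"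
    by (rule tangent_mult[OF assms]) auto
  then have "v (\<lambda>q. 1) = 0" by simp
  then show ?thesis using tangent_scale[OF assms, of "\<lambda>q. 1" a] by simp
qed

lemma tangent_sum:
  assumes "v \<in> tangent_space A p" "\<And>i. i \<in> I \<Longrightarrow> f i \<in> smooth_funs A"
  shows "v (\<lambda>q. \<Sum>i\<in>I. f i q) = (\<Sum>i\<in>I. v (f i))"
  using assms(2)
proof (induction I rule: infinite_finite_induct)
  case (insert x F)
  then have "v (\<lambda>q. f x q + (\<Sum>i\<in>F. f i q)) = v (f x) + v (\<lambda>q. \<Sum>i\<in>F. f i q)"
    by (intro tangent_add[OF assms(1)]) auto
  with insert show ?case by simp
qed (simp_all add: tangent_const[OF assms(1)])

text \<open>A bump function supported in W makes \<beta> (f - h) vanish identically, and the Leibniz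
  rule at p, where \<beta> = 1 and f = h, leaves v (f - h) = 0.\<close>

lemma tangent_local:
  assumes v: "v \<in> tangent_space A p" and W: "open W" "p \<in> W"
    and fh: "f \<in> smooth_funs A" "h \<in> smooth_funs A" "\<And>q. q \<in> W \<Longrightarrow> f q = h q"
  shows "v f = v h"
proof -
  obtain \<beta> N K where \<beta>: "\<beta> \<in> smooth_funs A" "\<And>q. 0 \<le> \<beta> q" "\<And>q. \<beta> q \<le> 1" "open N" "p \<in> N" "N \<subseteq> W"
    "\<And>q. q \<in> N \<Longrightarrow> \<beta> q = 1" "compact K" "K \<subseteq> W" "\<And>q. q \<notin> K \<Longrightarrow> \<beta> q = 0"
    by (rule exists_bump[OF W]) (rule that)
  have "\<beta> q * (f q - h q) = 0" for q
    using \<beta>(9) \<beta>(10)[of q] fh(3)[of q] by auto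
  then have "v (\<lambda>q. \<beta> q * (f q - h q)) = 0" using tangent_const[OF v, of 0] by presburger
  moreover have "v (\<lambda>q. \<beta> q * (f q - h q)) = \<beta> p * v (\<lambda>q. f q - h q) + (f p - h p) * v \<beta>"
    by (rule tangent_mult[OF v]) (use \<beta> fh in auto)
  ultimately show ?thesis using \<beta>(5,7) fh W(2) tangent_diff[OF v fh(1,2)] by simp
qed

lemma tangent_space_zero [simp]: "(\<lambda>f. 0) \<in> tangent_space A p"
  by (simp add: tangent_space_def)

lemma tangent_space_add [intro]:
  "u \<in> tangent_space A p \<Longrightarrow> v \<in> tangent_space A p \<Longrightarrow> tan_add u v \<in> tangent_space A p"
  by (simp add: tangent_space_def tan_add_def algebra_simps)

lemma tangent_space_scale [intro]: "u \<in> tangent_space A p \<Longrightarrow> tan_scale a u \<in> tangent_space A p"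
  by (simp add: tangent_space_def tan_scale_def algebra_simps)

lemma tangent_space_sum:
  assumes "\<And>i. i \<in> I \<Longrightarrow> v i \<in> tangent_space A p"
  shows "(\<lambda>f. \<Sum>i\<in>I. v i f) \<in> tangent_space A p"
  using assms
proof (induction I rule: infinite_finite_induct)
  case (insert x F)
  then have "tan_add (v x) (\<lambda>f. \<Sum>i\<in>F. v i f) \<in> tangent_space A p" by auto
  then show ?case using insert by (simp add: tan_add_def)
qed simp_all

lemma vector_fieldsD: "X \<in> vector_fields A \<Longrightarrow> X p \<in> tangent_space A p"
  "X \<in> vector_fields A \<Longrightarrow> f \<in> smooth_funs A \<Longrightarrow> (\<lambda>p. X p f) \<in> smooth_funs A"
  by (auto simp: vector_fields_def)

lemma vector_fields_add [intro]:
  "X \<in> vector_fields A \<Longrightarrow> Y \<in> vector_fields A \<Longrightarrow> (\<lambda>p. tan_add (X p) (Y p)) \<in> vector_fields A"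
  by (auto simp: vector_fields_def) (auto simp: tan_add_def)

lemma vector_fields_scale [intro]:
  "a \<in> smooth_funs A \<Longrightarrow> X \<in> vector_fields A \<Longrightarrow> (\<lambda>p. tan_scale (a p) (X p)) \<in> vector_fields A"
  by (auto simp: vector_fields_def) (auto simp: tan_scale_def)

lemma vector_fields_sum:
  "(\<And>i. i \<in> I \<Longrightarrow> X i \<in> vector_fields A) \<Longrightarrow> (\<lambda>p f. \<Sum>i\<in>I. X i p f) \<in> vector_fields A"
  by (auto simp: vector_fields_def intro: tangent_space_sum)

lemma lie_bracket_vector_fields [intro]:
  assumes X: "X \<in> vector_fields A" and Y: "Y \<in> vector_fields A"
  shows "lie_bracket X Y \<in> vector_fields A"
proof -
  note T = vector_fieldsD(1)[OF X] vector_fieldsD(1)[OF Y]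
  note S = vector_fieldsD(2)[OF X] vector_fieldsD(2)[OF Y]
  have "lie_bracket X Y p \<in> tangent_space A p" for p
    unfolding tangent_space_def mem_Collect_eq
  proof (intro conjI allI ballI impI)
    \<comment> \<open>At a nonsmooth f both inner functions are constantly 0, and derivations kill
      constants, so the convention for nonsmooth functions is inherited.\<close>
    fix f assume "f \<notin> smooth_funs A"
    then show "lie_bracket X Y p f = 0"
      by (simp add: lie_bracket_def tangent_nonsmooth[OF T(1)] tangent_nonsmooth[OF T(2)] tangent_const[OF T(1)] tangent_const[OF T(2)])
  next
    fix f h assume fh: "f \<in> smooth_funs A" "h \<in> smooth_funs A"
    show "lie_bracket X Y p (\<lambda>q. f q + h q) = lie_bracket X Y p f + lie_bracket X Y p h"
      using fh by (simp add: lie_bracket_def tangent_add[OF T(1)] tangent_add[OF T(2)] S)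
    have "lie_bracket X Y p (\<lambda>q. f q * h q) =
        X p (\<lambda>q. f q * Y q h + h q * Y q f) - Y p (\<lambda>q. f q * X q h + h q * X q f)"
      using fh by (simp add: lie_bracket_def tangent_mult[OF T(1)] tangent_mult[OF T(2)])
    \<comment> \<open>The terms pairing a derivative of f with one of h are symmetric in X and Y and
      cancel.\<close>
    also have "\<dots> = f p * lie_bracket X Y p h + h p * lie_bracket X Y p f"
      using fh S by (simp add: lie_bracket_def tangent_add[OF T(1)] tangent_add[OF T(2)]
        tangent_mult[OF T(1)] tangent_mult[OF T(2)] smooth_funs_mult algebra_simps)
    finally show "lie_bracket X Y p (\<lambda>q. f q * h q) = f p * lie_bracket X Y p h + h p * lie_bracket X Y p f" .
  next
    fix a f assume f: "f \<in> smooth_funs A"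
    show "lie_bracket X Y p (\<lambda>q. a * f q) = a * lie_bracket X Y p f"
      using f by (simp add: lie_bracket_def tangent_scale[OF T(1)] tangent_scale[OF T(2)] S algebra_simps)
  qed
  then show ?thesis
    using S by (auto simp: vector_fields_def lie_bracket_def)
qed

section \<open>Coordinate frames\<close>

lemma coord_vec_tangent:
  assumes U: "(U, c) \<in> A" "q \<in> U"
  shows "coord_vec A (U, c) q i \<in> tangent_space A q"
proof -
  have d: "(f \<circ> inv_into U c has_derivative frechet_derivative (f \<circ> inv_into U c) (at (c q))) (at (c q))"
    if "f \<in> smooth_funs A" for f
    using smooth_on_has_derivative[OF smooth_funsD[OF that U(1)]] U(2) by auto
  have e: "coord_vec A (U, c) q i f = D (axis i 1)"
    if "f \<in> smooth_funs A" "(f \<circ> inv_into U c has_derivative D) (at (c q))" for f D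
    using that frechet_derivative_at by (fastforce simp: coord_vec_def)
  show ?thesis
    unfolding tangent_space_def mem_Collect_eq
  proof (intro conjI allI ballI impI)
    fix f h assume fh: "f \<in> smooth_funs A" "h \<in> smooth_funs A"
    note e' = e[OF fh(1) d[OF fh(1)]] e[OF fh(2) d[OF fh(2)]]
    have *: "((\<lambda>q. f q + h q) \<circ> inv_into U c has_derivative
        (\<lambda>v. frechet_derivative (f \<circ> inv_into U c) (at (c q)) v + frechet_derivative (h \<circ> inv_into U c) (at (c q)) v)) (at (c q))"
      using has_derivative_add[OF d[OF fh(1)] d[OF fh(2)]] by (simp add: comp_def)
    show "coord_vec A (U, c) q i (\<lambda>q. f q + h q) = coord_vec A (U, c) q i f + coord_vec A (U, c) q i h"
      unfolding e' e[OF smooth_funs_add[OF fh] *] ..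
    have *: "((\<lambda>q. f q * h q) \<circ> inv_into U c has_derivative
        (\<lambda>v. f q * frechet_derivative (h \<circ> inv_into U c) (at (c q)) v + frechet_derivative (f \<circ> inv_into U c) (at (c q)) v * h q)) (at (c q))"
      using has_derivative_mult[OF d[OF fh(1)] d[OF fh(2)]] by (simp add: comp_def chart_inv[OF U])
    show "coord_vec A (U, c) q i (\<lambda>q. f q * h q) = f q * coord_vec A (U, c) q i h + h q * coord_vec A (U, c) q i f"
      unfolding e' e[OF smooth_funs_mult[OF fh] *] by simp
  next
    fix a f assume f: "f \<in> smooth_funs A"
    have *: "((\<lambda>q. a * f q) \<circ> inv_into U c has_derivative
        (\<lambda>v. a * frechet_derivative (f \<circ> inv_into U c) (at (c q)) v)) (at (c q))"
      using has_derivative_mult_right[OF d[OF f]] by (simp add: comp_def)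
    show "coord_vec A (U, c) q i (\<lambda>q. a * f q) = a * coord_vec A (U, c) q i f"
      unfolding e[OF f d[OF f]] e[OF smooth_funs_mult[OF smooth_funs_const f] *] ..
  qed (simp add: coord_vec_def)
qed

text \<open>Fields and coordinate functions are global objects, since \<open>vector_fields A\<close>
  and \<open>smooth_funs A\<close> contain no others; only the frame relations are localised to W.
  The last clause makes the frame span, with coefficients \<open>v (\<xi> k)\<close>.\<close>

definition frame_on :: "'m set \<Rightarrow> ('d \<Rightarrow> 'm vfield) \<Rightarrow> ('d \<Rightarrow> 'm \<Rightarrow> real) \<Rightarrow> bool" where
  "frame_on W V \<xi> \<longleftrightarrow> open W \<and> (\<forall>i. V i \<in> vector_fields A) \<and> (\<forall>i. \<xi> i \<in> smooth_funs A) \<and>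
     (\<forall>q\<in>W. \<forall>i j. V i q (\<xi> j) = (if i = j then 1 else 0)) \<and>
     (\<forall>q\<in>W. \<forall>v\<in>tangent_space A q. v = (\<lambda>f. \<Sum>k\<in>UNIV. v (\<xi> k) * V k q f))"

lemma frame_on_subset: "frame_on W V \<xi> \<Longrightarrow> open W' \<Longrightarrow> W' \<subseteq> W \<Longrightarrow> frame_on W' V \<xi>"
  unfolding frame_on_def by blast

lemma frameD:
  assumes "frame_on W V \<xi>"
  shows "open W" "V i \<in> vector_fields A" "\<xi> i \<in> smooth_funs A"
    "q \<in> W \<Longrightarrow> V i q (\<xi> j) = (if i = j then 1 else 0)"
  using assms unfolding frame_on_def by auto

lemma frame_expand:
  assumes "frame_on W V \<xi>" "q \<in> W" "v \<in> tangent_space A q"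
  shows "v f = (\<Sum>k\<in>UNIV. v (\<xi> k) * V k q f)"
proof -
  have "v = (\<lambda>f. \<Sum>k\<in>UNIV. v (\<xi> k) * V k q f)"
    using assms unfolding frame_on_def by blast
  then show ?thesis by (rule fun_cong)
qed

text \<open>Coordinate vectors and coordinate functions of the chart are multiplied by a bump
  function equal to 1 on W. That they span is the classical identification of derivations with
  directional derivatives, by Hadamard's lemma on a coordinate ball.\<close>

lemma exists_frame:
  assumes U: "(U, c) \<in> A" "p \<in> U"
  obtains W V \<xi> where "frame_on W V \<xi>" "p \<in> W" "W \<subseteq> U"
    "\<And>q i. q \<in> W \<Longrightarrow> V i q = coord_vec A (U, c) q i"
proof -
  obtain R \<beta> where \<beta>: "0 < R" "cball (c p) R \<subseteq> c ` U" "\<beta> \<in> smooth_funs A"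
    "\<And>q. q \<in> U \<inter> c -` ball (c p) (R / 2) \<Longrightarrow> \<beta> q = 1"
    "\<And>q. q \<notin> inv_into U c ` cball (c p) R \<Longrightarrow> \<beta> q = 0"
    "compact (inv_into U c ` cball (c p) R)" "inv_into U c ` cball (c p) R \<subseteq> U"
    by (rule chart_bump[OF U(1) chart_open[OF U(1)] order_refl U(2)]) (rule that)
  let ?K = "inv_into U c ` cball (c p) R"
  let ?B = "ball (c p) (R / 2)"
  define W where "W = U \<inter> c -` ?B"
  have W: "open W" "W \<subseteq> U" "p \<in> W"
    using chart_preimage_open[OF U(1)] U \<beta>(1) by (auto simp: W_def)
  have cW: "c ` W = ?B"
  proof -
    have "?B \<subseteq> c ` U" using \<beta>(1,2) by (force simp: subset_iff)
    then show ?thesis by (auto simp: W_def)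
  qed
  define V where "V i q = tan_scale (\<beta> q) (coord_vec A (U, c) q i)" for i q
  define \<xi> where "\<xi> j q = \<beta> q * c q $ j" for j q
  have ext: "F \<in> smooth_funs A" if "\<And>q. F q = \<beta> q * G q" "smooth_on (c ` U) (\<lambda>x. G (inv_into U c x))" for F G
  proof (rule smooth_funs_extend[OF U(1) chart_open[OF U(1)] order_refl compact_imp_closed[OF \<beta>(6)] \<beta>(7)])
    show "smooth_on (c ` U) (\<lambda>x. F (inv_into U c x))"
      unfolding that(1) by (intro smooth_on_mult that(2) smooth_funsD'[OF \<beta>(3) U(1)] chart_open_image[OF U(1)])
  qed (simp add: that(1) \<beta>(5))
  have V: "V i \<in> vector_fields A" for i
    unfolding vector_fields_def mem_Collect_eq
  proof (intro conjI allI ballI)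
    fix q
    show "V i q \<in> tangent_space A q"
    proof (cases "q \<in> U")
      case True
      then show ?thesis unfolding V_def by (intro tangent_space_scale coord_vec_tangent[OF U(1)])
    next
      case False
      then have "\<beta> q = 0" using \<beta>(5,7) by blast
      then show ?thesis by (simp add: V_def tan_scale_def)
    qed
  next
    fix f assume f: "f \<in> smooth_funs A"
    show "(\<lambda>q. V i q f) \<in> smooth_funs A"
    proof (rule ext)
      show "V i q f = \<beta> q * frechet_derivative (f \<circ> inv_into U c) (at (c q)) (axis i 1)" for q
        using f by (simp add: V_def tan_scale_def coord_vec_def)
      have "smooth_on (c ` U) (\<lambda>x. frechet_derivative (f \<circ> inv_into U c) (at x) (axis i 1))"
        by (rule smooth_on_frechet_derivative[OF smooth_funsD[OF f U(1)]])
      then show "smooth_on (c ` U) (\<lambda>x. frechet_derivative (f \<circ> inv_into U c) (at (c (inv_into U c x))) (axis i 1))"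
        by (rule smooth_on_cong[OF chart_open_image[OF U(1)], rotated]) (simp add: f_inv_into_f)
    qed
  qed
  have \<xi>: "\<xi> j \<in> smooth_funs A" for j
  proof (rule ext[of _ "\<lambda>q. c q $ j"])
    have "smooth_on (c ` U) (\<lambda>x. x $ j)"
      by (intro smooth_on_bounded_linear chart_open_image[OF U(1)] bounded_linear_vec_nth)
    then show "smooth_on (c ` U) (\<lambda>x. c (inv_into U c x) $ j)"
      by (rule smooth_on_cong[OF chart_open_image[OF U(1)], rotated]) (simp add: f_inv_into_f)
  qed (simp add: \<xi>_def)
  have VW: "V i q = coord_vec A (U, c) q i" if "q \<in> W" for q i
    using \<beta>(4)[of q] that by (simp add: V_def tan_scale_def W_def)
  have \<xi>W: "\<xi> j q = c q $ j" if "q \<in> W" for q j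
    using \<beta>(4)[of q] that by (simp add: \<xi>_def W_def)
  have V\<xi>: "V i q (\<xi> j) = (if i = j then 1 else 0)" if "q \<in> W" for q i j
  proof -
    have "((\<lambda>x. x $ j) has_derivative (\<lambda>x. x $ j)) (at (c q))"
      by (intro bounded_linear_imp_has_derivative bounded_linear_vec_nth)
    then have "(\<xi> j \<circ> inv_into U c has_derivative (\<lambda>x. x $ j)) (at (c q))"
      by (rule has_derivative_transform_within_open[of _ _ _ _ "c ` W"])
         (use that W(2) in \<open>auto simp: \<xi>W chart_inv[OF U(1)] subset_iff intro: chart_image_open_subset[OF U(1) W(1,2)]\<close>)
    then have "frechet_derivative (\<xi> j \<circ> inv_into U c) (at (c q)) = (\<lambda>x. x $ j)"
      by (rule frechet_derivative_at[symmetric])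
    then show ?thesis
      using VW[OF that] \<xi>[of j] by (simp add: coord_vec_def axis_def)
  qed
  have exp: "v f = (\<Sum>k\<in>UNIV. v (\<xi> k) * V k q f)" if q: "q \<in> W" and v: "v \<in> tangent_space A q" for q v f
  proof (cases "f \<in> smooth_funs A")
    case False
    then show ?thesis using tangent_nonsmooth[OF v] tangent_nonsmooth[OF vector_fieldsD(1)[OF V]] by simp
  next
    case f: True
    have "c q \<in> ?B" using q cW by auto
    moreover have "smooth_on ?B (f \<circ> inv_into U c)"
      by (rule smooth_on_subset[OF smooth_funsD[OF f U(1)]]) (use cW W(2) in auto)
    ultimately obtain G where G: "\<And>b. smooth_on ?B (G b)"
      "\<And>b. G b (c q) = frechet_derivative (f \<circ> inv_into U c) (at (c q)) b"
      "\<And>x. x \<in> ?B \<Longrightarrow> (f \<circ> inv_into U c) x = (f \<circ> inv_into U c) (c q) + (\<Sum>b\<in>Basis. ((x - c q) \<bullet> b) * G b x)"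
      by (rule hadamard[OF open_ball convex_ball]) (rule that)
    \<comment> \<open>A second bump function, centred at q, turns the Hadamard coefficients,
      available only on the ball, into global smooth functions.\<close>
    obtain \<psi> N K where \<psi>: "\<psi> \<in> smooth_funs A" "open N" "q \<in> N" "N \<subseteq> W" "\<And>r. r \<in> N \<Longrightarrow> \<psi> r = 1"
      "compact K" "K \<subseteq> W" "\<And>r. r \<notin> K \<Longrightarrow> \<psi> r = 0"
      by (rule exists_bump[OF W(1) q]) (rule that)
    define H where "H j r = \<psi> r * G (axis j 1) (c r)" for j r
    have H: "H j \<in> smooth_funs A" for j
    proof (rule smooth_funs_extend[OF U(1) W(1,2) compact_imp_closed[OF \<psi>(6)] \<psi>(7)])
      have o: "open (c ` W)" by (simp add: cW)
      have "smooth_on (c ` W) (\<lambda>x. \<psi> (inv_into U c x) * G (axis j 1) x)"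
        by (intro smooth_on_mult o smooth_on_subset[OF smooth_funsD'[OF \<psi>(1) U(1)]] image_mono W(2) G(1)[folded cW])
      then show "smooth_on (c ` W) (\<lambda>x. H j (inv_into U c x))"
        by (rule smooth_on_cong[OF o, rotated]) (use W(2) in \<open>auto simp: H_def chart_inv[OF U(1)] subset_iff\<close>)
    qed (simp add: H_def \<psi>)
    have f_eq: "f r = f q + (\<Sum>j\<in>UNIV. (\<xi> j r - \<xi> j q) * H j r)" if r: "r \<in> N" for r
    proof -
      have rW: "r \<in> W" using r \<psi>(4) by blast
      then have "c r \<in> ?B" using cW by blast
      from G(3)[OF this] have "f r = f q + (\<Sum>j\<in>UNIV. ((c r - c q) \<bullet> axis j 1) * G (axis j 1) (c r))"
        using chart_inv[OF U(1) subsetD[OF W(2) rW]] chart_inv[OF U(1) subsetD[OF W(2) q]]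
        unfolding sum_Basis_axis by simp
      then show ?thesis
        using \<psi>(5)[OF r] \<xi>W[OF rW] \<xi>W[OF q] by (simp add: H_def inner_axis)
    qed
    have s: "(\<lambda>r. \<Sum>j\<in>UNIV. (\<xi> j r - \<xi> j q) * H j r) \<in> smooth_funs A"
      by (intro smooth_funs_sum smooth_funs_mult smooth_funs_diff \<xi> H smooth_funs_const)
    have "v f = v (\<lambda>r. f q + (\<Sum>j\<in>UNIV. (\<xi> j r - \<xi> j q) * H j r))"
      by (rule tangent_local[OF v \<psi>(2,3) f _ f_eq]) (use s in auto)
    also have "\<dots> = (\<Sum>j\<in>UNIV. v (\<lambda>r. (\<xi> j r - \<xi> j q) * H j r))"
      using tangent_add[OF v smooth_funs_const s] tangent_const[OF v]
      by (simp add: tangent_sum[OF v] smooth_funs_mult smooth_funs_diff \<xi> H)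
    \<comment> \<open>The other Leibniz term carries the factor
      \<open>\<xi> j q - \<xi> j q\<close>.\<close>
    also have "\<dots> = (\<Sum>j\<in>UNIV. H j q * v (\<xi> j))"
      using tangent_mult[OF v smooth_funs_diff[OF \<xi> smooth_funs_const] H] tangent_diff[OF v \<xi> smooth_funs_const] tangent_const[OF v]
      by simp
    also have "\<dots> = (\<Sum>k\<in>UNIV. v (\<xi> k) * V k q f)"
      using \<psi>(3,5) VW[OF q] f by (simp add: H_def G(2) coord_vec_def mult.commute)
    finally show ?thesis .
  qed
  have "frame_on W V \<xi>"
    unfolding frame_on_def
  proof (intro conjI allI ballI)
    show "v = (\<lambda>f. \<Sum>k\<in>UNIV. v (\<xi> k) * V k q f)" if "q \<in> W" "v \<in> tangent_space A q" for q v
      using exp[OF that] by (rule HOL.ext)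
  qed (use W V \<xi> V\<xi> in simp_all)
  then show ?thesis by (rule that[OF _ W(3,2) VW])
qed

lemma exists_frame_at: obtains W V \<xi> where "frame_on W V \<xi>" "p \<in> W"
  by (metis chart_exists exists_frame)

text \<open>Near p, X f is a combination of frame derivatives of f with the components of X as
  coefficients, so only the components need to be smooth.\<close>

lemma vector_fieldsI:
  assumes "\<And>p. X p \<in> tangent_space A p"
    and "\<And>p. \<exists>W V \<xi> F. p \<in> W \<and> frame_on W V \<xi> \<and> (\<forall>k. F k \<in> smooth_funs A \<and> (\<forall>q\<in>W. X q (\<xi> k) = F k q))"
  shows "X \<in> vector_fields A"
  unfolding vector_fields_def mem_Collect_eq
proof (intro conjI allI ballI assms(1) smooth_funs_local)
  fix f p assume f: "f \<in> smooth_funs A"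
  obtain W V \<xi> F where W: "p \<in> W" "frame_on W V \<xi>" "\<And>k. F k \<in> smooth_funs A" "\<And>k q. q \<in> W \<Longrightarrow> X q (\<xi> k) = F k q"
    using assms(2)[of p] by blast
  have "\<forall>q\<in>W. X q f = (\<Sum>k\<in>UNIV. F k q * V k q f)"
  proof
    fix q assume q: "q \<in> W"
    show "X q f = (\<Sum>k\<in>UNIV. F k q * V k q f)"
      using frame_expand[OF W(2) q assms(1), of f] unfolding W(4)[OF q] .
  qed
  moreover have "(\<lambda>q. \<Sum>k\<in>UNIV. F k q * V k q f) \<in> smooth_funs A"
    using W(3) vector_fieldsD(2)[OF frameD(2)[OF W(2)] f] by (intro smooth_funs_sum smooth_funs_mult)
  ultimately show "\<exists>W F. open W \<and> p \<in> W \<and> F \<in> smooth_funs A \<and> (\<forall>q\<in>W. X q f = F q)"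
    using W(1) frameD(1)[OF W(2)] by (intro exI[of _ W] exI[of _ "\<lambda>q. \<Sum>k\<in>UNIV. F k q * V k q f"]) simp
qed

text \<open>\<open>ext_deriv\<close> takes vector fields, not vectors; extending with constant
  coefficients in a cut-off frame turns its identities into pointwise ones.\<close>

lemma extend_tangent:
  assumes "v \<in> tangent_space A p"
  obtains X where "X \<in> vector_fields A" "X p = v"
proof -
  obtain W V \<xi> where W: "frame_on W V \<xi>" "p \<in> W" by (rule exists_frame_at)
  show ?thesis
  proof (rule that)
    have "(\<lambda>q f. \<Sum>k\<in>UNIV. tan_scale (v (\<xi> k)) (V k q) f) \<in> vector_fields A"
      by (intro vector_fields_sum vector_fields_scale smooth_funs_const frameD[OF W(1)])
    then show "(\<lambda>q f. \<Sum>k\<in>UNIV. v (\<xi> k) * V k q f) \<in> vector_fields A"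
      by (simp add: tan_scale_def)
    show "(\<lambda>f. \<Sum>k\<in>UNIV. v (\<xi> k) * V k p f) = v"
      using frame_expand[OF W assms] by (rule HOL.ext[symmetric])
  qed
qed

end


section \<open>Determinants\<close>

text \<open>Along the segment from the identity to M all matrices are positive definite, hence
  nonsingular, and the determinant starts at 1; otherwise the intermediate value theorem would
  produce a kernel vector.\<close>

lemma det_pos_if_positive_definite:
  fixes M :: "real ^ 'n ^ 'n"
  assumes "\<And>x. x \<noteq> 0 \<Longrightarrow> x \<bullet> (M *v x) > 0"
  shows "det M > 0"
proof (rule ccontr)
  assume "\<not> det M > 0"
  define N where "N t = (1 - t) *\<^sub>R mat 1 + t *\<^sub>R M" for t
  have "continuous_on {0..1} (\<lambda>t. det (N t))"
    unfolding det_def N_def by (auto intro!: continuous_intros)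
  moreover have "det (N 1) \<le> 0" "0 \<le> det (N 0)"
    using \<open>\<not> det M > 0\<close> by (simp_all add: N_def)
  ultimately obtain t where t: "0 \<le> t" "t \<le> 1" "det (N t) = 0"
    using IVT2'[of "\<lambda>t. det (N t)" 1 0 0] by auto
  then have "\<not> (\<forall>x. N t *v x = 0 \<longrightarrow> x = 0)"
    using matrix_left_invertible_ker[of "N t"] invertible_left_inverse[of "N t"] invertible_det_nz[of "N t"] by blast
  then obtain x where x: "N t *v x = 0" "x \<noteq> 0" by blast
  have "x \<bullet> (N t *v x) = (1 - t) * (x \<bullet> x) + t * (x \<bullet> (M *v x))"
    by (simp add: N_def matrix_vector_mult_add_rdistrib scaleR_matrix_vector_assoc[symmetric] inner_add_right)
  moreover have "(1 - t) * (x \<bullet> x) + t * (x \<bullet> (M *v x)) > 0"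
    using t(1,2) x(2) assms[OF x(2)] by (cases "t = 1") (auto intro!: add_pos_nonneg)
  ultimately show False using x(1) by simp
qed

text \<open>The trace computation behind the divergence formula: \<open>m\<close> is the matrix of the nondegenerate
  bilinear form \<open>d\<theta> + \<theta> \<otimes> \<theta>\<close>, for which the Reeb vector \<open>e\<close> is dual to \<open>\<theta>\<close> on both sides.\<close>

lemma trace_lie_derivative:
  fixes m Mi J :: "real ^ 'n ^ 'n" and t e d :: "real ^ 'n"
  assumes inv: "m ** Mi = mat 1" "Mi ** m = mat 1"
    and e: "m *v e = t" "e v* m = t" "t \<bullet> e = 1"
  shows "trace ((\<chi> i j. l * (m $ i $ j + t $ i * t $ j) + (d $ i * t $ j - d $ j * t $ i)
      - (\<Sum>k\<in>UNIV. J $ i $ k * m $ k $ j) - (\<Sum>k\<in>UNIV. J $ j $ k * m $ i $ k)) ** Mi)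
    = l * (real CARD('n) + 1) - 2 * trace J"
proof -
  \<comment> \<open>The rank-one matrix a b^T: products with other matrices act on one factor only,
    and its trace is the inner product.\<close>
  define P where "P a b = (\<chi> i j. a $ i * b $ j)" for a b :: "real ^ 'n"
  have O1: "P a b ** N = P a (b v* N)" for a b N
    by (vector P_def matrix_matrix_mult_def vector_matrix_mult_def) (simp add: sum_distrib_left mult_ac)
  have O2: "N ** P a b = P (N *v a) b" for a b N
    by (vector P_def matrix_matrix_mult_def matrix_vector_mult_def) (simp add: sum_distrib_left sum_distrib_right mult_ac)
  have O3: "trace (P a b) = a \<bullet> b" for a b
    by (simp add: trace_def P_def inner_vec_def)
  have add: "(B + C) ** N = B ** N + C ** N" and diff: "(B - C) ** N = B ** N - C ** N"
    and scale: "(r *\<^sub>R B) ** N = r *\<^sub>R (B ** N)" for B C N :: "real ^ 'n ^ 'n" and r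
    by (simp_all add: vec_eq_iff matrix_matrix_mult_def algebra_simps sum.distrib sum_subtractf sum_distrib_left)
  have tr: "trace (transpose B) = trace B" "trace (r *\<^sub>R B) = r * trace B" for B :: "real ^ 'n ^ 'n" and r
    by (simp_all add: trace_def transpose_def sum_distrib_left)
  have t1: "t v* Mi = e"
    unfolding e(2)[symmetric] vector_matrix_mul_assoc inv by simp
  have t2: "Mi *v t = e"
    unfolding e(1)[symmetric] matrix_vector_mul_assoc inv by simp
  have eq: "(\<chi> i j. l * (m $ i $ j + t $ i * t $ j) + (d $ i * t $ j - d $ j * t $ i)
      - (\<Sum>k\<in>UNIV. J $ i $ k * m $ k $ j) - (\<Sum>k\<in>UNIV. J $ j $ k * m $ i $ k))
    = (l *\<^sub>R m + l *\<^sub>R P t t) + (P d t - P t d) - J ** m - m ** transpose J"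
    by (simp add: vec_eq_iff P_def matrix_matrix_mult_def transpose_def algebra_simps)
  \<comment> \<open>The dimension comes from \<open>m ** Mi = mat 1\<close>, the additional l from
    \<theta> \<otimes> \<theta>, whose trace against \<open>Mi\<close> is t \<bullet> e = 1.\<close>
  have "trace ((l *\<^sub>R m + l *\<^sub>R P t t) ** Mi) = l * real CARD('n) + l"
    by (simp add: add scale inv O1 O3 t1 trace_add tr trace_I e(3))
  \<comment> \<open>Both rank-one terms have trace d \<bullet> e, because e is dual to t on either
    side of \<open>m\<close>; so the differential of the conformal factor drops out.\<close>
  moreover have "trace ((P d t - P t d) ** Mi) = 0"
  proof -
    have "trace (P t d ** Mi) = trace (Mi ** P t d)" by (rule trace_mul_sym)
    then show ?thesis
      by (simp add: diff trace_sub O1 O2 O3 t1 t2 inner_commute)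
  qed
  moreover have "trace (J ** m ** Mi) = trace J"
    by (simp add: matrix_mul_assoc[symmetric] inv)
  moreover have "trace (m ** transpose J ** Mi) = trace J"
    using trace_mul_sym[of "m ** transpose J" Mi]
    by (simp add: matrix_mul_assoc inv tr)
  ultimately show ?thesis
    unfolding eq diff add trace_add trace_sub
    by (simp add: algebra_simps)
qed

text \<open>Jacobi's formula for the derivative of a determinant, with N as the derivative: the rows
  of N = (N Mi) m are combinations of those of m, and replacing row i leaves only the diagonal
  coefficient.\<close>

lemma sum_det_row_replace:
  fixes m Mi N :: "real ^ 'n ^ 'n"
  assumes "Mi ** m = mat 1"
  shows "(\<Sum>i\<in>UNIV. det (\<chi> r s. if r = i then N $ i $ s else m $ r $ s)) = trace (N ** Mi) * det m"
proof -
  define B where "B = N ** Mi"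
  have N: "N = B ** m" by (simp add: B_def matrix_mul_assoc[symmetric] assms)
  have "det (\<chi> r s. if r = i then N $ i $ s else m $ r $ s) = B $ i $ i * det m" for i
  proof -
    have "(\<chi> r s. if r = i then N $ i $ s else m $ r $ s) =
        (\<chi> r. if r = i then \<Sum>k\<in>UNIV. (B $ i) $ k *s row k m else row r m)"
      by (auto simp: vec_eq_iff N matrix_matrix_mult_def row_def)
    then show ?thesis using cramer_lemma_transpose[of i "B $ i" m] by simp
  qed
  then show ?thesis by (simp add: trace_def B_def sum_distrib_right)
qed

section \<open>Determinants with smooth entries\<close>

context smooth_manifold
begin

lemma smooth_funs_det:
  assumes "\<And>i j. M i j \<in> smooth_funs A"
  shows "(\<lambda>q. det ((\<chi> i j. M i j q) :: real ^ 'n ^ 'n)) \<in> smooth_funs A"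
  unfolding det_def vec_lambda_beta
  by (intro smooth_funs_sum smooth_funs_mult smooth_funs_prod smooth_funs_const assms)

lemma tangent_prod:
  assumes v: "v \<in> tangent_space A p" and "finite I" "\<And>i. i \<in> I \<Longrightarrow> f i \<in> smooth_funs A"
  shows "v (\<lambda>q. \<Prod>i\<in>I. f i q) = (\<Sum>i\<in>I. v (f i) * (\<Prod>j\<in>I - {i}. f j p))"
  using assms(2,3)
proof (induction I rule: finite_induct)
  case empty
  then show ?case by (simp add: tangent_const[OF v])
next
  case (insert x F)
  have "v (\<lambda>q. f x q * (\<Prod>i\<in>F. f i q)) = f x p * v (\<lambda>q. \<Prod>i\<in>F. f i q) + (\<Prod>i\<in>F. f i p) * v (f x)"
    using insert.prems by (intro tangent_mult[OF v]) auto
  also have "f x p * v (\<lambda>q. \<Prod>i\<in>F. f i q) = (\<Sum>i\<in>F. v (f i) * (f x p * (\<Prod>j\<in>F - {i}. f j p)))"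
    using insert by (simp add: sum_distrib_left mult_ac)
  also have "\<dots> = (\<Sum>i\<in>F. v (f i) * (\<Prod>j\<in>insert x F - {i}. f j p))"
  proof (intro sum.cong refl arg_cong2[where f = "(*)"])
    fix i assume "i \<in> F"
    then have "insert x F - {i} = insert x (F - {i})" using insert.hyps by auto
    then show "f x p * (\<Prod>j\<in>F - {i}. f j p) = (\<Prod>j\<in>insert x F - {i}. f j p)"
      using insert.hyps by simp
  qed
  finally show ?case using insert.hyps by (simp add: mult.commute)
qed

text \<open>The Leibniz rule on the permutation expansion, regrouped by the row that is
  differentiated.\<close>

lemma tangent_det:
  assumes v: "v \<in> tangent_space A p" and M: "\<And>i j. M i j \<in> smooth_funs A"
  shows "v (\<lambda>q. det ((\<chi> i j. M i j q) :: real ^ 'n ^ 'n) ) =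
    (\<Sum>i\<in>(UNIV :: 'n::finite set). det (\<chi> r s. if r = i then v (M i s) else M r s p))"
proof -
  have "v (\<lambda>q. det ((\<chi> i j. M i j q) :: real ^ 'n ^ 'n)) =
      (\<Sum>\<sigma> | \<sigma> permutes (UNIV :: 'n set). of_int (sign \<sigma>) * (\<Sum>i\<in>UNIV. v (M i (\<sigma> i)) * (\<Prod>j\<in>UNIV - {i}. M j (\<sigma> j) p)))"
    unfolding det_def vec_lambda_beta
    by (simp add: tangent_sum[OF v] tangent_scale[OF v] smooth_funs_prod smooth_funs_mult M tangent_prod[OF v])
  also have "\<dots> = (\<Sum>i\<in>UNIV. \<Sum>\<sigma> | \<sigma> permutes (UNIV :: 'n set). of_int (sign \<sigma>) * (v (M i (\<sigma> i)) * (\<Prod>j\<in>UNIV - {i}. M j (\<sigma> j) p)))"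
    unfolding sum_distrib_left by (rule sum.swap)
  also have "\<dots> = (\<Sum>i\<in>UNIV. det (\<chi> r s. if r = i then v (M i s) else M r s p))"
    unfolding det_def vec_lambda_beta
    by (intro sum.cong refl arg_cong2[where f = "(*)"], subst prod.remove[of UNIV])
       (auto intro!: prod.cong)
  finally show ?thesis .
qed

end


section \<open>Contact metric manifolds\<close>

context smooth_manifold
begin

lemma linear_form_zero:
  assumes "linear_form_on (tangent_space A p) \<alpha>"
  shows "\<alpha> (\<lambda>f. 0) = 0"
proof -
  have "\<alpha> (tan_scale 0 (\<lambda>f. 0)) = 0 * \<alpha> (\<lambda>f. 0)"
    using assms tangent_space_zero unfolding linear_form_on_def by blast
  then show ?thesis by (simp add: tan_scale_def)
qed

lemma tangent_space_lincomb:
  assumes "\<And>i. i \<in> I \<Longrightarrow> w i \<in> tangent_space A p"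
  shows "(\<lambda>f. \<Sum>i\<in>I. a i * w i f) \<in> tangent_space A p"
  by (rule tangent_space_sum[OF tangent_space_scale[OF assms], unfolded tan_scale_def])

lemma linear_form_sum:
  assumes \<alpha>: "linear_form_on (tangent_space A p) \<alpha>" and "\<And>i. i \<in> I \<Longrightarrow> w i \<in> tangent_space A p"
  shows "\<alpha> (\<lambda>f. \<Sum>i\<in>I. a i * w i f) = (\<Sum>i\<in>I. a i * \<alpha> (w i))"
  using assms(2)
proof (induction I rule: infinite_finite_induct)
  case (insert x F)
  have 1: "tan_scale (a x) (w x) \<in> tangent_space A p" using insert.prems by auto
  have 2: "(\<lambda>f. \<Sum>i\<in>F. a i * w i f) \<in> tangent_space A p"
    using insert.prems by (intro tangent_space_lincomb) auto
  have "(\<lambda>f. \<Sum>i\<in>insert x F. a i * w i f) = tan_add (tan_scale (a x) (w x)) (\<lambda>f. \<Sum>i\<in>F. a i * w i f)"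
    using insert.hyps by (simp add: tan_add_def tan_scale_def)
  then show ?case
    using \<alpha> 1 2 insert unfolding linear_form_on_def by simp
qed (simp_all add: linear_form_zero[OF \<alpha>])

lemma linear_form_frame:
  assumes "linear_form_on (tangent_space A q) \<alpha>" "frame_on W V \<xi>" "q \<in> W" "v \<in> tangent_space A q"
  shows "\<alpha> v = (\<Sum>k\<in>UNIV. v (\<xi> k) * \<alpha> (V k q))"
proof -
  have "v = (\<lambda>f. \<Sum>k\<in>UNIV. v (\<xi> k) * V k q f)"
    by (rule HOL.ext) (rule frame_expand[OF assms(2-4)])
  then have "\<alpha> v = \<alpha> (\<lambda>f. \<Sum>k\<in>UNIV. v (\<xi> k) * V k q f)" by simp
  then show ?thesis
    using linear_form_sum[OF assms(1), of UNIV "\<lambda>k. V k q" "\<lambda>k. v (\<xi> k)"] vector_fieldsD(1)[OF frameD(2)[OF assms(2)]]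
    by simp
qed

text \<open>Column j holds the coordinates of L (V j), so composition of endomorphisms becomes the
  matrix product in the same order.\<close>

definition endo_matrix :: "('d \<Rightarrow> 'm vfield) \<Rightarrow> ('d \<Rightarrow> 'm \<Rightarrow> real) \<Rightarrow> 'm \<Rightarrow> ('m tangent \<Rightarrow> 'm tangent) \<Rightarrow> real ^ 'd ^ 'd" where
  "endo_matrix V \<xi> q L = (\<chi> k j. L (V j q) (\<xi> k))"

lemma endo_matrix_compose:
  assumes W: "frame_on W V \<xi>" "q \<in> W"
    and L: "\<And>f. linear_form_on (tangent_space A q) (\<lambda>u. L u f)"
    and L': "\<And>u. u \<in> tangent_space A q \<Longrightarrow> L' u \<in> tangent_space A q"
  shows "endo_matrix V \<xi> q L ** endo_matrix V \<xi> q L' = endo_matrix V \<xi> q (\<lambda>u. L (L' u))"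
proof -
  have "L (L' (V j q)) (\<xi> k) = (\<Sum>i\<in>UNIV. L' (V j q) (\<xi> i) * L (V i q) (\<xi> k))" for j k
    by (rule linear_form_frame[OF L W L'[OF vector_fieldsD(1)[OF frameD(2)[OF W(1)]]]])
  then show ?thesis
    by (simp add: endo_matrix_def matrix_matrix_mult_def vec_eq_iff mult.commute)
qed

lemma lie_bracket_swap: "lie_bracket X Y p = tan_scale (- 1) (lie_bracket Y X p)"
  by (simp add: lie_bracket_def tan_scale_def)

text \<open>Stated as the derivation property of bracketing with X, the form in which the Lie
  derivative of d\<theta> consumes it.\<close>

lemma jacobi_identity:
  assumes X: "X \<in> vector_fields A" and Y: "Y \<in> vector_fields A" and Z: "Z \<in> vector_fields A"
  shows "lie_bracket X (lie_bracket Y Z) p =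
    tan_add (lie_bracket (lie_bracket X Y) Z p) (lie_bracket Y (lie_bracket X Z) p)"
proof
  fix f
  note D = tangent_diff[OF vector_fieldsD(1)[OF X]] tangent_diff[OF vector_fieldsD(1)[OF Y]]
    tangent_diff[OF vector_fieldsD(1)[OF Z]]
  note C = tangent_const[OF vector_fieldsD(1)[OF X]] tangent_const[OF vector_fieldsD(1)[OF Y]]
    tangent_const[OF vector_fieldsD(1)[OF Z]]
  note N = tangent_nonsmooth[OF vector_fieldsD(1)[OF X]] tangent_nonsmooth[OF vector_fieldsD(1)[OF Y]]
    tangent_nonsmooth[OF vector_fieldsD(1)[OF Z]]
  note S = vector_fieldsD(2)[OF X] vector_fieldsD(2)[OF Y] vector_fieldsD(2)[OF Z]
  show "lie_bracket X (lie_bracket Y Z) p f =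
      tan_add (lie_bracket (lie_bracket X Y) Z p) (lie_bracket Y (lie_bracket X Z) p) f"
  proof (cases "f \<in> smooth_funs A")
    case True
    then show ?thesis by (simp add: lie_bracket_def tan_add_def D S)
  next
    case False
    then show ?thesis by (simp add: lie_bracket_def tan_add_def N C)
  qed
qed

end

section \<open>Pointwise algebra of contact metric structures\<close>

locale contact_metric_manifold = smooth_manifold A
  for A :: "('m::t2_space, 'd::finite) chart set" +
  fixes n :: nat and \<theta> :: "'m \<Rightarrow> 'm tangent \<Rightarrow> real" and E :: "'m vfield"
    and g :: "'m \<Rightarrow> 'm tangent \<Rightarrow> 'm tangent \<Rightarrow> real" and \<phi> :: "'m \<Rightarrow> 'm tangent \<Rightarrow> 'm tangent"
  assumes card: "CARD('d) = 2 * n + 1"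
    and one_form: "\<theta> \<in> one_forms A"
    and reeb: "reeb_field A \<theta> E"
    and metric: "riemannian_metric A g"
    and theta_eq: "u \<in> tangent_space A p \<Longrightarrow> \<theta> p u = g p u (E p)"
    and endo: "\<phi> \<in> endo_fields A"
    and phi_phi: "u \<in> tangent_space A p \<Longrightarrow> \<phi> p (\<phi> p u) = tan_add (tan_scale (- 1) u) (tan_scale (\<theta> p u) (E p))"
    and ext_deriv_eq: "X \<in> vector_fields A \<Longrightarrow> Y \<in> vector_fields A \<Longrightarrow> ext_deriv \<theta> X Y p = g p (X p) (\<phi> p (Y p))"
begin

lemma E_field [simp]: "E \<in> vector_fields A" and theta_E [simp]: "\<theta> p (E p) = 1"
  and ext_deriv_E: "X \<in> vector_fields A \<Longrightarrow> ext_deriv \<theta> E X p = 0"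
  using reeb unfolding reeb_field_def by auto

lemma E_tangent [simp]: "E p \<in> tangent_space A p"
  by (rule vector_fieldsD) simp

lemma theta_linear: "linear_form_on (tangent_space A p) (\<theta> p)"
  and theta_smooth [intro]: "X \<in> vector_fields A \<Longrightarrow> (\<lambda>p. \<theta> p (X p)) \<in> smooth_funs A"
  using one_form unfolding one_forms_def by auto

lemma theta_add: "u \<in> tangent_space A p \<Longrightarrow> v \<in> tangent_space A p \<Longrightarrow> \<theta> p (tan_add u v) = \<theta> p u + \<theta> p v"
  and theta_scale: "u \<in> tangent_space A p \<Longrightarrow> \<theta> p (tan_scale a u) = a * \<theta> p u"
  using theta_linear unfolding linear_form_on_def by auto

lemma g_linear: "u \<in> tangent_space A p \<Longrightarrow> linear_form_on (tangent_space A p) (g p u)"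
  and g_sym: "u \<in> tangent_space A p \<Longrightarrow> v \<in> tangent_space A p \<Longrightarrow> g p u v = g p v u"
  and g_pos: "u \<in> tangent_space A p \<Longrightarrow> u \<noteq> (\<lambda>f. 0) \<Longrightarrow> g p u u > 0"
  and g_smooth [intro]: "X \<in> vector_fields A \<Longrightarrow> Y \<in> vector_fields A \<Longrightarrow> (\<lambda>p. g p (X p) (Y p)) \<in> smooth_funs A"
  using metric unfolding riemannian_metric_def by auto

lemma g_add: "u \<in> tangent_space A p \<Longrightarrow> v \<in> tangent_space A p \<Longrightarrow> w \<in> tangent_space A p \<Longrightarrow>
    g p u (tan_add v w) = g p u v + g p u w"
  and g_scale: "u \<in> tangent_space A p \<Longrightarrow> v \<in> tangent_space A p \<Longrightarrow> g p u (tan_scale a v) = a * g p u v"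
  using g_linear unfolding linear_form_on_def by auto

lemma phi_tangent [intro]: "u \<in> tangent_space A p \<Longrightarrow> \<phi> p u \<in> tangent_space A p"
  and phi_add: "u \<in> tangent_space A p \<Longrightarrow> v \<in> tangent_space A p \<Longrightarrow> \<phi> p (tan_add u v) = tan_add (\<phi> p u) (\<phi> p v)"
  and phi_scale: "u \<in> tangent_space A p \<Longrightarrow> \<phi> p (tan_scale a u) = tan_scale a (\<phi> p u)"
  and phi_field [intro]: "X \<in> vector_fields A \<Longrightarrow> (\<lambda>p. \<phi> p (X p)) \<in> vector_fields A"
  using endo unfolding endo_fields_def by auto

text \<open>d\<theta> is antisymmetric because the bracket is; the vectors are extended to fields to
  see this pointwise.\<close>

lemma g_phi_antisym:
  assumes "u \<in> tangent_space A p" "v \<in> tangent_space A p"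
  shows "g p u (\<phi> p v) = - g p v (\<phi> p u)"
proof -
  obtain X where X: "X \<in> vector_fields A" "X p = u" by (rule extend_tangent[OF assms(1)])
  obtain Y where Y: "Y \<in> vector_fields A" "Y p = v" by (rule extend_tangent[OF assms(2)])
  have "ext_deriv \<theta> X Y p = - ext_deriv \<theta> Y X p"
    using theta_scale[OF vector_fieldsD(1)[OF lie_bracket_vector_fields[OF X(1) Y(1)]]]
    unfolding ext_deriv_def lie_bracket_swap[of Y X] by simp
  then show ?thesis
    unfolding ext_deriv_eq[OF X(1) Y(1)] ext_deriv_eq[OF Y(1) X(1)] X Y .
qed

lemma g_nondegenerate:
  assumes "u \<in> tangent_space A p" "\<And>v. v \<in> tangent_space A p \<Longrightarrow> g p v u = 0"
  shows "u = (\<lambda>f. 0)"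
  using g_pos[OF assms(1)] assms by force

lemma g_E_phi [simp]: "u \<in> tangent_space A p \<Longrightarrow> g p (E p) (\<phi> p u) = 0"
  by (metis E_field ext_deriv_E ext_deriv_eq extend_tangent)

text \<open>\<open>E\<close> lies in the kernel of d\<theta>, so \<phi> E is orthogonal to every
  tangent vector.\<close>

lemma phi_E [simp]: "\<phi> p (E p) = (\<lambda>f. 0)"
  by (rule g_nondegenerate) (auto simp: g_phi_antisym[of _ p "E p"])

lemma theta_phi [simp]: "u \<in> tangent_space A p \<Longrightarrow> \<theta> p (\<phi> p u) = 0"
  by (simp add: theta_eq phi_tangent g_sym[of "\<phi> p u" p "E p"])

lemma g_frame:
  assumes "frame_on W V \<xi>" "q \<in> W" "u \<in> tangent_space A q" "v \<in> tangent_space A q"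
  shows "g q u v = (\<Sum>k\<in>UNIV. v (\<xi> k) * g q u (V k q))"
  by (rule linear_form_frame[OF g_linear[OF assms(3)] assms(1,2,4)])

definition metric_matrix :: "('d \<Rightarrow> 'm vfield) \<Rightarrow> 'm \<Rightarrow> real ^ 'd ^ 'd" where
  "metric_matrix V q = (\<chi> i j. g q (V i q) (V j q))"

definition contact_matrix :: "('d \<Rightarrow> 'm vfield) \<Rightarrow> 'm \<Rightarrow> real ^ 'd ^ 'd" where
  "contact_matrix V q = (\<chi> i j. g q (V i q) (\<phi> q (V j q)) + \<theta> q (V i q) * \<theta> q (V j q))"

lemma metric_matrix_vec:
  assumes W: "frame_on W V \<xi>" "q \<in> W"
  shows "(metric_matrix V q *v x) $ i = g q (V i q) (\<lambda>f. \<Sum>k\<in>UNIV. x $ k * V k q f)"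
proof -
  note T = vector_fieldsD(1)[OF frameD(2)[OF W(1)]]
  have "g q (V i q) (\<lambda>f. \<Sum>k\<in>UNIV. x $ k * V k q f) = (\<Sum>k\<in>UNIV. x $ k * g q (V i q) (V k q))"
    by (rule linear_form_sum[OF g_linear[OF T] T])
  then show ?thesis by (simp add: metric_matrix_def matrix_vector_mult_def mult.commute)
qed

lemma det_metric_matrix_pos:
  assumes W: "frame_on W V \<xi>" "q \<in> W"
  shows "det (metric_matrix V q) > 0"
proof (rule det_pos_if_positive_definite)
  fix x :: "real ^ 'd" assume x: "x \<noteq> 0"
  note T = vector_fieldsD(1)[OF frameD(2)[OF W(1)]]
  let ?u = "\<lambda>f. \<Sum>k\<in>UNIV. x $ k * V k q f"
  have u: "?u \<in> tangent_space A q"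
    by (intro tangent_space_lincomb T)
  have "?u (\<xi> j) = x $ j" for j
    by (simp add: frameD(4)[OF W] if_distrib cong: if_cong)
  then have "?u \<noteq> (\<lambda>f. 0)" using x by (metis vec_eq_iff zero_index)
  then have "g q ?u ?u > 0" by (rule g_pos[OF u])
  also have "g q ?u ?u = (\<Sum>k\<in>UNIV. x $ k * g q ?u (V k q))"
    by (rule linear_form_sum[OF g_linear[OF u]]) (rule T)
  also have "\<dots> = x \<bullet> (metric_matrix V q *v x)"
    by (simp add: inner_vec_def metric_matrix_vec[OF W] g_sym[OF u T])
  finally show "x \<bullet> (metric_matrix V q *v x) > 0" .
qed

text \<open>The endomorphism \<open>\<psi> = \<phi> + \<theta> \<otimes> E\<close> satisfies \<open>\<psi>\<^sup>4 = 1\<close>, so \<open>(det \<psi>)\<^sup>2 = 1\<close>, and it turns the metric into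
  the form \<open>d\<theta> + \<theta> \<otimes> \<theta>\<close>.\<close>

lemma det_contact_matrix:
  assumes W: "frame_on W V \<xi>" "q \<in> W"
  shows "(det (contact_matrix V q))\<^sup>2 = (det (metric_matrix V q))\<^sup>2"
proof -
  note T = vector_fieldsD(1)[OF frameD(2)[OF W(1)]]
  define \<psi> where "\<psi> u = tan_add (\<phi> q u) (tan_scale (\<theta> q u) (E q))" for u
  define P where "P = endo_matrix V \<xi> q \<psi>"
  have \<psi>T: "\<psi> u \<in> tangent_space A q" if "u \<in> tangent_space A q" for u
    using that by (simp add: \<psi>_def tangent_space_add tangent_space_scale phi_tangent)
  have \<psi>lin: "linear_form_on (tangent_space A q) (\<lambda>u. \<psi> u f)" for f
    by (auto simp: linear_form_on_def \<psi>_def phi_add phi_scale theta_add theta_scale)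
       (auto simp: tan_add_def tan_scale_def algebra_simps)
  \<comment> \<open>So \<psi>^2 is -1 on the kernel of \<theta> and fixes \<open>E\<close>; squaring
    again gives the identity.\<close>
  have 2: "\<psi> (\<psi> u) = tan_add (tan_scale (- 1) u) (tan_scale (2 * \<theta> q u) (E q))" if "u \<in> tangent_space A q" for u
  proof -
    have "\<phi> q (\<psi> u) = tan_add (tan_scale (- 1) u) (tan_scale (\<theta> q u) (E q))"
      using that by (simp add: \<psi>_def phi_add phi_scale phi_tangent tangent_space_scale phi_phi)
        (simp add: tan_add_def tan_scale_def)
    moreover have "\<theta> q (\<psi> u) = \<theta> q u"
      using that by (simp add: \<psi>_def theta_add theta_scale phi_tangent tangent_space_scale)
    ultimately show ?thesis
      unfolding \<psi>_def[of "\<psi> u"] by (simp add: tan_add_def tan_scale_def algebra_simps)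
  qed
  have 4: "\<psi> (\<psi> (\<psi> (\<psi> u))) = u" if u: "u \<in> tangent_space A q" for u
  proof -
    have "\<theta> q (\<psi> (\<psi> u)) = \<theta> q u"
      unfolding 2[OF u] using u by (simp add: theta_add theta_scale tangent_space_scale)
    then show ?thesis
      unfolding 2[OF \<psi>T[OF \<psi>T[OF u]]] unfolding 2[OF u] by (simp add: tan_add_def tan_scale_def algebra_simps)
  qed
  have PP: "P ** P = endo_matrix V \<xi> q (\<lambda>u. \<psi> (\<psi> u))"
    unfolding P_def by (rule endo_matrix_compose[of W V \<xi> q \<psi> \<psi>, OF W \<psi>lin \<psi>T])
  have lin2: "linear_form_on (tangent_space A q) (\<lambda>u. \<psi> (\<psi> u) f)" for f
    unfolding linear_form_on_def
    by (intro conjI ballI allI; simp only: 2 theta_add theta_scale tangent_space_add tangent_space_scale)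
       (simp_all add: tan_add_def tan_scale_def algebra_simps)
  have "(P ** P) ** (P ** P) = endo_matrix V \<xi> q (\<lambda>u. \<psi> (\<psi> (\<psi> (\<psi> u))))"
    unfolding PP by (rule endo_matrix_compose[of W V \<xi> q "\<lambda>u. \<psi> (\<psi> u)" "\<lambda>u. \<psi> (\<psi> u)", OF W lin2 \<psi>T[OF \<psi>T]])
  also have "\<dots> = mat 1"
    by (simp add: endo_matrix_def 4[OF T] frameD(4)[OF W] mat_def vec_eq_iff)
  finally have "det ((P ** P) ** (P ** P)) = 1" by simp
  then have "((det P)\<^sup>2)\<^sup>2 = 1"
    by (simp add: det_mul power2_eq_square)
  then have "(det P)\<^sup>2 = 1"
    by (metis abs_power2 abs_square_eq_1)
  moreover have "contact_matrix V q = metric_matrix V q ** P"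
  proof -
    have "g q (V i q) (\<phi> q (V j q)) + \<theta> q (V i q) * \<theta> q (V j q) = (\<Sum>k\<in>UNIV. g q (V i q) (V k q) * \<psi> (V j q) (\<xi> k))" for i j
    proof -
      have "g q (V i q) (\<psi> (V j q)) = g q (V i q) (\<phi> q (V j q)) + \<theta> q (V i q) * \<theta> q (V j q)"
        using T by (simp add: \<psi>_def g_add g_scale phi_tangent tangent_space_scale theta_eq[OF T])
      then show ?thesis
        using g_frame[OF W T[of i] \<psi>T[OF T[of j]]] by (simp add: mult.commute)
    qed
    then show ?thesis
      by (simp add: vec_eq_iff contact_matrix_def metric_matrix_def matrix_matrix_mult_def P_def endo_matrix_def)
  qed
  ultimately show ?thesis by (simp add: det_mul power_mult_distrib)
qed

end


section \<open>Contact fields\<close>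

text \<open>Inverting the convex combination (1 - \<beta>) + \<beta> s instead of s keeps the
  denominator positive everywhere and changes nothing where the bump function is 1.\<close>

lemma (in smooth_manifold) smooth_inverse_local:
  assumes s: "s \<in> smooth_funs A" and W: "open W" "p \<in> W" and pos: "\<And>q. q \<in> W \<Longrightarrow> s q > 0"
  obtains N r where "open N" "p \<in> N" "N \<subseteq> W" "r \<in> smooth_funs A" "\<And>q. q \<in> N \<Longrightarrow> r q = inverse (s q)"
proof -
  obtain \<beta> N K where \<beta>: "\<beta> \<in> smooth_funs A" "\<And>q. 0 \<le> \<beta> q" "\<And>q. \<beta> q \<le> 1" "open N" "p \<in> N" "N \<subseteq> W"
    "\<And>q. q \<in> N \<Longrightarrow> \<beta> q = 1" "compact K" "K \<subseteq> W" "\<And>q. q \<notin> K \<Longrightarrow> \<beta> q = 0"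
    by (rule exists_bump[OF W]) (rule that)
  define r where "r q = inverse ((1 - \<beta> q) + \<beta> q * s q)" for q
  have "(1 - \<beta> q) + \<beta> q * s q > 0" for q
  proof (cases "q \<in> K")
    case True
    then have "s q > 0" using pos \<beta>(9) by blast
    then show ?thesis
      using \<beta>(2,3)[of q] by (cases "\<beta> q = 0") (auto intro!: add_nonneg_pos)
  next
    case False
    then show ?thesis by (simp add: \<beta>(10))
  qed
  then have "r \<in> smooth_funs A"
    unfolding r_def
    by (intro smooth_funs_inverse smooth_funs_add smooth_funs_diff smooth_funs_mult smooth_funs_const \<beta>(1) s)
       (metis less_irrefl)
  then show ?thesis
    by (rule that[OF \<beta>(4-6)]) (simp add: r_def \<beta>(7))
qed

context contact_metric_manifold
begin

text \<open>For a contact field this is the \<lambda> in L_Y \<theta> = \<lambda> \<theta>. The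
  explicit formula avoids a choice of \<lambda> and shows its smoothness.\<close>

definition conformal_factor :: "'m vfield \<Rightarrow> 'm \<Rightarrow> real" where
  "conformal_factor Y p = E p (\<lambda>q. \<theta> q (Y q))"

lemma conformal_factor_smooth [intro]: "Y \<in> vector_fields A \<Longrightarrow> conformal_factor Y \<in> smooth_funs A"
  unfolding conformal_factor_def by (intro vector_fieldsD(2)[OF E_field] theta_smooth)

lemma theta_swap: "X \<in> vector_fields A \<Longrightarrow> Y \<in> vector_fields A \<Longrightarrow>
    \<theta> p (lie_bracket X Y p) = - \<theta> p (lie_bracket Y X p)"
  using theta_scale[OF vector_fieldsD(1)[OF lie_bracket_vector_fields[of Y X]], of p "- 1"]
  unfolding lie_bracket_swap[of X Y] by simp

lemma contact_fieldD:
  assumes "Y \<in> contact_fields A \<theta>"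
  shows "Y \<in> vector_fields A"
    and "X \<in> vector_fields A \<Longrightarrow>
      \<theta> p (lie_bracket Y X p) = Y p (\<lambda>q. \<theta> q (X q)) - conformal_factor Y p * \<theta> p (X p)"
proof -
  obtain l where Y: "Y \<in> vector_fields A"
    and l: "\<And>X p. X \<in> vector_fields A \<Longrightarrow> lie_deriv_form Y \<theta> X p = l p * \<theta> p (X p)"
    using assms unfolding contact_fields_def by blast
  show "Y \<in> vector_fields A" by (rule Y)
  \<comment> \<open>Testing L_Y \<theta> = l \<theta> on \<open>E\<close> gives l = \<theta> [E, Y],
    and d\<theta>(E, Y) = 0 turns this into E (\<theta> Y).\<close>
  have "l p = conformal_factor Y p" for p
    using l[OF E_field, of p] ext_deriv_E[OF Y, of p] theta_swap[OF Y E_field, of p]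
    by (simp add: lie_deriv_form_def ext_deriv_def conformal_factor_def tangent_const[OF vector_fieldsD(1)[OF Y]])
  then show "X \<in> vector_fields A \<Longrightarrow>
      \<theta> p (lie_bracket Y X p) = Y p (\<lambda>q. \<theta> q (X q)) - conformal_factor Y p * \<theta> p (X p)"
    using l[of X p] by (simp add: lie_deriv_form_def)
qed

text \<open>At each point the Gram matrix is inverted; smoothness of the resulting field follows
  from Cramer's rule, which writes its components as quotients of determinants with smooth
  entries.\<close>

lemma exists_gradient:
  assumes f: "f \<in> smooth_funs A"
  obtains X where "X \<in> vector_fields A" "\<And>p v. v \<in> tangent_space A p \<Longrightarrow> g p (X p) v = v f"
proof -
  have "\<exists>u\<in>tangent_space A q. \<forall>v\<in>tangent_space A q. g q u v = v f" for q
  proof -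
    obtain W V \<xi> where W: "frame_on W V \<xi>" "q \<in> W" by (rule exists_frame_at)
    note T = vector_fieldsD(1)[OF frameD(2)[OF W(1)]]
    obtain Gi where Gi: "metric_matrix V q ** Gi = mat 1"
      using det_metric_matrix_pos[OF W] invertible_det_nz[of "metric_matrix V q"] unfolding invertible_def by auto
    define x where "x = Gi *v (\<chi> i. V i q f)"
    have x: "metric_matrix V q *v x = (\<chi> i. V i q f)"
      by (simp add: x_def matrix_vector_mul_assoc Gi)
    let ?u = "\<lambda>f. \<Sum>k\<in>UNIV. x $ k * V k q f"
    have u: "?u \<in> tangent_space A q" by (intro tangent_space_lincomb T)
    have "g q ?u v = v f" if v: "v \<in> tangent_space A q" for v
    proof -
      have "g q ?u v = (\<Sum>k\<in>UNIV. v (\<xi> k) * g q (V k q) ?u)"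
        using g_frame[OF W u v] by (simp add: g_sym[OF u T])
      also have "\<dots> = v f"
        by (simp add: metric_matrix_vec[OF W, symmetric] x frame_expand[OF W v, symmetric])
      finally show ?thesis .
    qed
    with u show ?thesis by blast
  qed
  then obtain X where X: "\<And>q. X q \<in> tangent_space A q" "\<And>q v. v \<in> tangent_space A q \<Longrightarrow> g q (X q) v = v f"
    by metis
  have "X \<in> vector_fields A"
  proof (rule vector_fieldsI[OF X(1)])
    fix p
    obtain W V \<xi> where W: "frame_on W V \<xi>" "p \<in> W" by (rule exists_frame_at)
    note T = vector_fieldsD(1)[OF frameD(2)[OF W(1)]]
    have "(\<lambda>q. det (metric_matrix V q)) \<in> smooth_funs A"
      unfolding metric_matrix_def by (intro smooth_funs_det g_smooth frameD[OF W(1)])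
    then obtain N r where N: "open N" "p \<in> N" "N \<subseteq> W" "r \<in> smooth_funs A"
      "\<And>q. q \<in> N \<Longrightarrow> r q = inverse (det (metric_matrix V q))"
      by (rule smooth_inverse_local[OF _ frameD(1)[OF W(1)] W(2) det_metric_matrix_pos[OF W(1)]]) (assumption, rule that)
    define F where "F k q = det (\<chi> i j. if j = k then V i q f else g q (V i q) (V j q)) * r q" for k q
    have FS: "F k \<in> smooth_funs A" for k
    proof -
      have "(\<lambda>q. if j = k then V i q f else g q (V i q) (V j q)) \<in> smooth_funs A" for i j
        using vector_fieldsD(2)[OF frameD(2)[OF W(1)] f] g_smooth[OF frameD(2)[OF W(1)] frameD(2)[OF W(1)]]
        by (cases "j = k") simp_all
      then show ?thesis unfolding F_def by (intro smooth_funs_mult smooth_funs_det N(4))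
    qed
    have "X q (\<xi> k) = F k q" if q: "q \<in> N" for q k
    proof -
      have qW: "q \<in> W" using q N(3) by blast
      have "metric_matrix V q *v (\<chi> k. X q (\<xi> k)) = (\<chi> i. V i q f)"
      proof -
        have "(\<Sum>k\<in>UNIV. X q (\<xi> k) * g q (V i q) (V k q)) = V i q f" for i
          using g_frame[OF W(1) qW T[of i] X(1)] X(2)[OF T[of i]] g_sym[OF T[of i] X(1)] by simp
        then show ?thesis by (simp add: vec_eq_iff metric_matrix_def matrix_vector_mult_def mult.commute)
      qed
      then have "(\<chi> k. X q (\<xi> k)) =
          (\<chi> k. det (\<chi> i j. if j = k then (\<chi> i. V i q f) $ i else metric_matrix V q $ i $ j) / det (metric_matrix V q))"
        using cramer[of "metric_matrix V q"] det_metric_matrix_pos[OF W(1) qW] by simp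
      moreover have "(\<chi> i j. if j = k then (\<chi> i. V i q f) $ i else metric_matrix V q $ i $ j) =
          (\<chi> i j. if j = k then V i q f else g q (V i q) (V j q))"
        by (simp add: vec_eq_iff metric_matrix_def)
      ultimately show ?thesis
        by (simp add: vec_eq_iff F_def N(5)[OF q] divide_inverse)
    qed
    then show "\<exists>W V \<xi> F. p \<in> W \<and> frame_on W V \<xi> \<and> (\<forall>k. F k \<in> smooth_funs A \<and> (\<forall>q\<in>W. X q (\<xi> k) = F k q))"
      using N frame_on_subset[OF W(1) N(1,3)] FS
      by (intro exI[of _ N] exI[of _ V] exI[of _ \<xi>] exI[of _ F]) simp
  qed
  then show ?thesis using that X(2) by blast
qed

text \<open>The witness is \<open>f E - \<phi> (grad f)\<close>.\<close>

lemma exists_contact_field: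
  assumes f: "f \<in> smooth_funs A"
  obtains u where "u \<in> contact_fields A \<theta>" "\<And>p. \<theta> p (u p) = f p"
proof -
  obtain D where D: "D \<in> vector_fields A" "\<And>p v. v \<in> tangent_space A p \<Longrightarrow> g p (D p) v = v f"
    by (rule exists_gradient[OF f]) (rule that)
  note DT = vector_fieldsD(1)[OF D(1)]
  define u where "u p = tan_add (tan_scale (f p) (E p)) (tan_scale (- 1) (\<phi> p (D p)))" for p
  have u: "u \<in> vector_fields A"
    unfolding u_def by (intro vector_fields_add vector_fields_scale f smooth_funs_const phi_field D E_field)
  have \<theta>u: "\<theta> p (u p) = f p" for p
    by (simp add: u_def theta_add theta_scale tangent_space_scale phi_tangent DT)
  \<comment> \<open>\<phi> kills the multiple of \<open>E\<close> in u, and \<phi>^2 = -1 + \<theta>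
    \<otimes> E acts on the gradient; this makes d\<theta>(X, u) equal to X f - (E f) \<theta>(X),
    the equation of a contact field.\<close>
  have \<phi>u: "\<phi> p (u p) = tan_add (D p) (tan_scale (- E p f) (E p))" for p
  proof -
    have "\<theta> p (D p) = E p f" using D(2)[of "E p" p] theta_eq[OF DT] by simp
    then show ?thesis
      by (simp add: u_def phi_add phi_scale tangent_space_scale phi_tangent DT phi_phi)
         (simp add: tan_add_def tan_scale_def)
  qed
  have "lie_deriv_form u \<theta> X p = E p f * \<theta> p (X p)" if X: "X \<in> vector_fields A" for X p
  proof -
    note XT = vector_fieldsD(1)[OF X]
    have "ext_deriv \<theta> X u p = X p f - E p f * \<theta> p (X p)"
      unfolding ext_deriv_eq[OF X u] \<phi>u
      by (simp add: g_add g_scale tangent_space_scale XT DT theta_eq g_sym[OF XT DT] D(2))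
    moreover have "ext_deriv \<theta> X u p = X p f - u p (\<lambda>q. \<theta> q (X q)) + \<theta> p (lie_bracket u X p)"
      unfolding ext_deriv_def \<theta>u theta_swap[OF X u] by simp
    ultimately show ?thesis by (simp add: lie_deriv_form_def)
  qed
  then have "u \<in> contact_fields A \<theta>"
    using u unfolding contact_fields_def by (auto intro!: exI[of _ "\<lambda>p. E p f"])
  then show ?thesis using \<theta>u by (rule that)
qed

text \<open>The stream function f fixes d\<theta>(w, u) = w f - (E f) \<theta>(w) for all w, hence
  \<phi> u; applying \<phi> again recovers u up to its component along \<open>E\<close>, which is f
  itself.\<close>

lemma contact_field_eqI:
  assumes u: "u \<in> contact_fields A \<theta>" and v: "v \<in> contact_fields A \<theta>"
    and eq: "\<And>p. \<theta> p (u p) = \<theta> p (v p)"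
  shows "u = v"
proof
  fix p
  have T: "u p \<in> tangent_space A p" "v p \<in> tangent_space A p"
    using contact_fieldD(1) u v vector_fieldsD(1) by blast+
  have *: "g p w (\<phi> p (u p)) = w (\<lambda>q. \<theta> q (u q)) - conformal_factor u p * \<theta> p w"
    if uc: "u \<in> contact_fields A \<theta>" and w: "w \<in> tangent_space A p" for u w
  proof -
    obtain X where X: "X \<in> vector_fields A" "X p = w" by (rule extend_tangent[OF w])
    have "ext_deriv \<theta> X u p = w (\<lambda>q. \<theta> q (u q)) - conformal_factor u p * \<theta> p w"
      unfolding ext_deriv_def theta_swap[OF X(1) contact_fieldD(1)[OF uc]] contact_fieldD(2)[OF uc X(1)] X(2) by simp
    then show ?thesis using ext_deriv_eq[OF X(1) contact_fieldD(1)[OF uc]] X(2) by simp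
  qed
  let ?w = "tan_add (\<phi> p (u p)) (tan_scale (- 1) (\<phi> p (v p)))"
  have "?w = (\<lambda>f. 0)"
  proof (rule g_nondegenerate)
    show "?w \<in> tangent_space A p"
      by (intro tangent_space_add tangent_space_scale phi_tangent T)
    show "g p w ?w = 0" if "w \<in> tangent_space A p" for w
      using that by (simp add: g_add g_scale tangent_space_scale phi_tangent T *[OF u] *[OF v] conformal_factor_def eq)
  qed
  then have "\<phi> p (u p) = \<phi> p (v p)"
    by (auto simp: tan_add_def tan_scale_def fun_eq_iff)
  then have "\<phi> p (\<phi> p (u p)) = \<phi> p (\<phi> p (v p))" by simp
  then show "u p = v p"
    unfolding phi_phi[OF T(1)] phi_phi[OF T(2)] eq
    by (auto simp: tan_add_def tan_scale_def fun_eq_iff)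
qed

section \<open>Divergence of contact fields\<close>

text \<open>The Lie derivative commutes with d, so L_Y d\<theta> = d(\<lambda> \<theta>) = \<lambda>
  d\<theta> + d\<lambda> \<and> \<theta>, written out on two fields.\<close>

lemma lie_derivative_ext_deriv:
  assumes Y: "Y \<in> contact_fields A \<theta>" and Z1: "Z1 \<in> vector_fields A" and Z2: "Z2 \<in> vector_fields A"
  shows "Y p (ext_deriv \<theta> Z1 Z2) = ext_deriv \<theta> (lie_bracket Y Z1) Z2 p + ext_deriv \<theta> Z1 (lie_bracket Y Z2) p
    + conformal_factor Y p * ext_deriv \<theta> Z1 Z2 p + Z1 p (conformal_factor Y) * \<theta> p (Z2 p) - Z2 p (conformal_factor Y) * \<theta> p (Z1 p)"
proof -
  note YF = contact_fieldD(1)[OF Y] and B = contact_fieldD(2)[OF Y]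
  note T = vector_fieldsD(1)[OF YF] vector_fieldsD(1)[OF Z1] vector_fieldsD(1)[OF Z2]
  note S = vector_fieldsD(2)[OF YF] vector_fieldsD(2)[OF Z1] vector_fieldsD(2)[OF Z2]
  define a where "a Z q = \<theta> q (Z q)" for Z :: "'m vfield" and q
  have a: "a Z \<in> smooth_funs A" if "Z \<in> vector_fields A" for Z
    unfolding a_def by (rule theta_smooth[OF that])
  have Z12: "lie_bracket Z1 Z2 \<in> vector_fields A" by (intro lie_bracket_vector_fields Z1 Z2)
  have bb: "(\<lambda>q. \<theta> q (lie_bracket Y Z q)) = (\<lambda>q. Y q (a Z) - conformal_factor Y q * a Z q)" if "Z \<in> vector_fields A" for Z
    unfolding a_def by (rule HOL.ext) (rule B[OF that])
  have 1: "Y p (ext_deriv \<theta> Z1 Z2) = Y p (\<lambda>q. Z1 q (a Z2)) - Y p (\<lambda>q. Z2 q (a Z1)) - Y p (a (lie_bracket Z1 Z2))"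
  proof -
    have "ext_deriv \<theta> Z1 Z2 = (\<lambda>q. Z1 q (a Z2) - Z2 q (a Z1) - a (lie_bracket Z1 Z2) q)"
      by (simp add: ext_deriv_def a_def[abs_def] fun_eq_iff)
    then show ?thesis
      by (simp add: tangent_diff[OF T(1)] S a Z1 Z2 Z12 smooth_funs_diff)
  qed
  have d: "Z p (\<lambda>q. Y q (a Z') - conformal_factor Y q * a Z' q) = Z p (\<lambda>q. Y q (a Z')) - (conformal_factor Y p * Z p (a Z') + a Z' p * Z p (conformal_factor Y))"
    if "Z \<in> vector_fields A" "Z' \<in> vector_fields A" for Z Z'
    using that tangent_diff[OF vector_fieldsD(1)[OF that(1)]] tangent_mult[OF vector_fieldsD(1)[OF that(1)]]
    by (simp add: S a conformal_factor_smooth YF smooth_funs_mult)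
  have 2: "ext_deriv \<theta> (lie_bracket Y Z1) Z2 p = Y p (\<lambda>q. Z1 q (a Z2)) - Z1 p (\<lambda>q. Y q (a Z2))
      - (Z2 p (\<lambda>q. Y q (a Z1)) - (conformal_factor Y p * Z2 p (a Z1) + a Z1 p * Z2 p (conformal_factor Y))) - \<theta> p (lie_bracket (lie_bracket Y Z1) Z2 p)"
    unfolding ext_deriv_def bb[OF Z1] d[OF Z2 Z1] by (simp add: lie_bracket_def[of Y Z1] a_def[abs_def])
  have 3: "ext_deriv \<theta> Z1 (lie_bracket Y Z2) p = (Z1 p (\<lambda>q. Y q (a Z2)) - (conformal_factor Y p * Z1 p (a Z2) + a Z2 p * Z1 p (conformal_factor Y)))
      - (Y p (\<lambda>q. Z2 q (a Z1)) - Z2 p (\<lambda>q. Y q (a Z1))) - \<theta> p (lie_bracket Z1 (lie_bracket Y Z2) p)"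
    unfolding ext_deriv_def bb[OF Z2] d[OF Z1 Z2] by (simp add: lie_bracket_def[of Y Z2] a_def[abs_def])
  \<comment> \<open>The Jacobi identity trades the two nested brackets for \<theta> [Y, [Z1, Z2]],
    which the contact condition evaluates.\<close>
  have 4: "\<theta> p (lie_bracket (lie_bracket Y Z1) Z2 p) + \<theta> p (lie_bracket Z1 (lie_bracket Y Z2) p)
      = Y p (a (lie_bracket Z1 Z2)) - conformal_factor Y p * a (lie_bracket Z1 Z2) p"
  proof -
    have "\<theta> p (lie_bracket Y (lie_bracket Z1 Z2) p) = \<theta> p (lie_bracket (lie_bracket Y Z1) Z2 p) + \<theta> p (lie_bracket Z1 (lie_bracket Y Z2) p)"
      unfolding jacobi_identity[OF YF Z1 Z2]
      by (intro theta_add vector_fieldsD(1) lie_bracket_vector_fields YF Z1 Z2)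
    then show ?thesis using fun_cong[OF bb[OF Z12], of p] by simp
  qed
  have 5: "ext_deriv \<theta> Z1 Z2 p = Z1 p (a Z2) - Z2 p (a Z1) - a (lie_bracket Z1 Z2) p"
    by (simp add: ext_deriv_def a_def[abs_def])
  show ?thesis
    unfolding 1 2 3 5 using 4 by (simp add: a_def[abs_def] algebra_simps)
qed

text \<open>V_i (\<xi> k) is constant on W, so only the derivative of the component Y (\<xi> k)
  survives in the commutator.\<close>

lemma lie_bracket_frame:
  assumes W: "frame_on W V \<xi>" "q \<in> W" and Y: "Y \<in> vector_fields A"
  shows "lie_bracket Y (V i) q (\<xi> k) = - V i q (\<lambda>r. Y r (\<xi> k))"
proof -
  have "Y q (\<lambda>r. V i r (\<xi> k)) = Y q (\<lambda>r. if i = k then 1 else 0)"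
    by (rule tangent_local[OF vector_fieldsD(1)[OF Y] frameD(1)[OF W(1)] W(2)
          vector_fieldsD(2)[OF frameD(2)[OF W(1)] frameD(3)[OF W(1)]] smooth_funs_const frameD(4)[OF W(1)]])
  then show ?thesis by (simp add: lie_bracket_def tangent_const[OF vector_fieldsD(1)[OF Y]])
qed

text \<open>The Lie derivative of m = d\<theta> + \<theta> \<otimes> \<theta> is \<lambda> d\<theta>
  + d\<lambda> \<and> \<theta> + 2 \<lambda> \<theta> \<otimes> \<theta>, hence the additional t_i
  t_j beside m_ij; the brackets [Y, V_i] and [Y, V_j] contribute the two sums with J.\<close>

lemma lie_derivative_contact_matrix:
  assumes W: "frame_on W V \<xi>" "q \<in> W" and Y: "Y \<in> contact_fields A \<theta>"
  defines "J \<equiv> (\<chi> i k. V i q (\<lambda>r. Y r (\<xi> k)))" and "t \<equiv> (\<chi> i. \<theta> q (V i q))" and "d \<equiv> (\<chi> i. V i q (conformal_factor Y))"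
  shows "Y q (\<lambda>r. contact_matrix V r $ i $ j) =
    conformal_factor Y q * (contact_matrix V q $ i $ j + t $ i * t $ j) + (d $ i * t $ j - d $ j * t $ i)
    - (\<Sum>k\<in>UNIV. J $ i $ k * contact_matrix V q $ k $ j) - (\<Sum>k\<in>UNIV. J $ j $ k * contact_matrix V q $ i $ k)"
proof -
  note YF = contact_fieldD(1)[OF Y] and VF = frameD(2)[OF W(1)]
  note T = vector_fieldsD(1)[OF VF]
  have LF: "lie_bracket Y (V i) \<in> vector_fields A" for i by (intro lie_bracket_vector_fields YF VF)
  note LT = vector_fieldsD(1)[OF LF]
  define M where "M u v = g q u (\<phi> q v) + \<theta> q u * \<theta> q v" for u v
  have m: "contact_matrix V q $ i $ j = M (V i q) (V j q)" for i j
    by (simp add: contact_matrix_def M_def)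
  have lin1: "linear_form_on (tangent_space A q) (\<lambda>u. M u v)" if "v \<in> tangent_space A q" for v
    using that
    by (simp add: linear_form_on_def M_def g_phi_antisym[of _ q v] phi_add phi_scale g_add g_scale phi_tangent theta_add theta_scale
        tangent_space_add tangent_space_scale algebra_simps)
  have lin2: "linear_form_on (tangent_space A q) (M u)" if "u \<in> tangent_space A q" for u
    using that
    by (simp add: linear_form_on_def M_def phi_add phi_scale g_add g_scale phi_tangent theta_add theta_scale algebra_simps)
  have M1: "M (lie_bracket Y (V i) q) (V j q) = - (\<Sum>k\<in>UNIV. J $ i $ k * contact_matrix V q $ k $ j)"
    unfolding linear_form_frame[OF lin1[OF T] W LT] lie_bracket_frame[OF W YF] m J_def by (simp add: sum_negf)
  have M2: "M (V i q) (lie_bracket Y (V j) q) = - (\<Sum>k\<in>UNIV. J $ j $ k * contact_matrix V q $ i $ k)"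
    unfolding linear_form_frame[OF lin2[OF T] W LT] lie_bracket_frame[OF W YF] m J_def by (simp add: sum_negf)
  have OS: "(\<lambda>r. g r (V i r) (\<phi> r (V j r))) \<in> smooth_funs A"
    by (intro g_smooth VF phi_field)
  have TS: "(\<lambda>r. \<theta> r (V i r)) \<in> smooth_funs A" for i by (intro theta_smooth VF)
  have "Y q (\<lambda>r. contact_matrix V r $ i $ j) = Y q (\<lambda>r. g r (V i r) (\<phi> r (V j r)))
      + (\<theta> q (V i q) * Y q (\<lambda>r. \<theta> r (V j r)) + \<theta> q (V j q) * Y q (\<lambda>r. \<theta> r (V i r)))"
    using tangent_add[OF vector_fieldsD(1)[OF YF] OS smooth_funs_mult[OF TS TS]] tangent_mult[OF vector_fieldsD(1)[OF YF] TS TS]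
    by (simp add: contact_matrix_def)
  also have "Y q (\<lambda>r. g r (V i r) (\<phi> r (V j r))) = g q (lie_bracket Y (V i) q) (\<phi> q (V j q)) + g q (V i q) (\<phi> q (lie_bracket Y (V j) q))
    + conformal_factor Y q * g q (V i q) (\<phi> q (V j q)) + V i q (conformal_factor Y) * \<theta> q (V j q) - V j q (conformal_factor Y) * \<theta> q (V i q)"
  proof -
    have "(\<lambda>r. g r (V i r) (\<phi> r (V j r))) = ext_deriv \<theta> (V i) (V j)"
      by (simp add: ext_deriv_eq VF fun_eq_iff)
    then show ?thesis
      unfolding ext_deriv_eq[OF LF VF, symmetric] ext_deriv_eq[OF VF LF, symmetric] 
      using lie_derivative_ext_deriv[OF Y VF[of i] VF[of j], of q] by (simp add: ext_deriv_eq VF)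
  qed
  finally show ?thesis
    using M1 M2 contact_fieldD(2)[OF Y VF[of i], of q] contact_fieldD(2)[OF Y VF[of j], of q] by (simp add: m M_def t_def d_def algebra_simps)
qed

text \<open>In a coordinate frame the divergence is the sum of V_k (Y (\<xi> k)) plus Y D / (2 D),
  with D the Gram determinant, so this is div Y = (n + 1) \<lambda>. The factor 2 (n + 1) is the
  dimension plus 1 from the trace computation.\<close>

lemma divergence_det_metric_matrix:
  assumes W: "frame_on W V \<xi>" "q \<in> W" and Y: "Y \<in> contact_fields A \<theta>"
  shows "Y q (\<lambda>r. det (metric_matrix V r)) =
    (2 * (real n + 1) * conformal_factor Y q - 2 * (\<Sum>k\<in>UNIV. V k q (\<lambda>r. Y r (\<xi> k)))) * det (metric_matrix V q)"
proof -
  note YF = contact_fieldD(1)[OF Y] and VF = frameD(2)[OF W(1)]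
  note T = vector_fieldsD(1)[OF VF] and YT = vector_fieldsD(1)[OF YF]
  define c where "c = 2 * (real n + 1) * conformal_factor Y q - 2 * (\<Sum>k\<in>UNIV. V k q (\<lambda>r. Y r (\<xi> k)))"
  define J where "J = (\<chi> i k. V i q (\<lambda>r. Y r (\<xi> k)))"
  define t where "t = (\<chi> i. \<theta> q (V i q))"
  define d where "d = (\<chi> i. V i q (conformal_factor Y))"
  define e where "e = (\<chi> k. E q (\<xi> k))"
  define m where "m = contact_matrix V q"
  define D where "D r = det (metric_matrix V r)" for r
  define D' where "D' r = det (contact_matrix V r)" for r
  have Dpos: "D r > 0" if "r \<in> W" for r using det_metric_matrix_pos[OF W(1) that] by (simp add: D_def)
  have DD: "(D' r)\<^sup>2 = (D r)\<^sup>2" if "r \<in> W" for r using det_contact_matrix[OF W(1) that] by (simp add: D_def D'_def)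
  have "det m \<noteq> 0" using DD[OF W(2)] Dpos[OF W(2)] by (auto simp: m_def D'_def[symmetric])
  then obtain Mi where inv: "m ** Mi = mat 1" "Mi ** m = mat 1"
    using invertible_det_nz[of m] unfolding invertible_def by auto
  have e1: "m *v e = t"
  proof -
    have "g q (V i q) (\<phi> q (E q)) = (\<Sum>k\<in>UNIV. E q (\<xi> k) * g q (V i q) (\<phi> q (V k q)))" for i
      by (rule linear_form_frame[OF _ W E_tangent])
         (simp add: linear_form_on_def T phi_add phi_scale g_add g_scale phi_tangent)
    moreover have "g q (V i q) (\<phi> q (E q)) = 0" for i
      by (simp add: linear_form_zero[OF g_linear[OF T]])
    moreover have "(\<Sum>k\<in>UNIV. E q (\<xi> k) * (\<theta> q (V i q) * \<theta> q (V k q))) = \<theta> q (V i q)" for i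
      using linear_form_frame[OF theta_linear W E_tangent]
      by (simp add: sum_distrib_left[symmetric] mult.left_commute[of _ "\<theta> q (V i q)"])
    ultimately show ?thesis
      by (simp add: vec_eq_iff m_def e_def t_def contact_matrix_def matrix_vector_mult_def algebra_simps sum.distrib)
  qed
  have e2: "e v* m = t"
  proof -
    have "g q (V i q) (\<phi> q (E q)) = (\<Sum>k\<in>UNIV. E q (\<xi> k) * g q (V i q) (\<phi> q (V k q)))" for i
      by (rule linear_form_frame[OF _ W E_tangent])
         (simp add: linear_form_on_def T phi_add phi_scale g_add g_scale phi_tangent)
    then have "(\<Sum>k\<in>UNIV. E q (\<xi> k) * g q (V k q) (\<phi> q (V i q))) = 0" for i
      unfolding g_phi_antisym[OF T T[of i]] by (simp add: linear_form_zero[OF g_linear[OF T]] sum_negf)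
    moreover have "(\<Sum>k\<in>UNIV. E q (\<xi> k) * (\<theta> q (V i q) * \<theta> q (V k q))) = \<theta> q (V i q)" for i
      using linear_form_frame[OF theta_linear W E_tangent]
      by (simp add: sum_distrib_left[symmetric] mult.left_commute[of _ "\<theta> q (V i q)"])
    ultimately show ?thesis
      by (simp add: vec_eq_iff m_def e_def t_def contact_matrix_def vector_matrix_mult_def algebra_simps sum.distrib)
  qed
  have e3: "t \<bullet> e = 1"
    using linear_form_frame[OF theta_linear W E_tangent]
    by (simp add: inner_vec_def t_def e_def mult.commute)
  have MS: "(\<lambda>r. contact_matrix V r $ i $ j) \<in> smooth_funs A" for i j
    unfolding contact_matrix_def vec_lambda_beta
    by (intro smooth_funs_add smooth_funs_mult g_smooth theta_smooth phi_field VF)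
  have D'eq: "D' = (\<lambda>r. det (\<chi> i j. contact_matrix V r $ i $ j))"
    by (simp add: D'_def fun_eq_iff)
  have D'S: "D' \<in> smooth_funs A" unfolding D'eq by (intro smooth_funs_det MS)
  have DS: "D \<in> smooth_funs A"
    unfolding D_def metric_matrix_def by (intro smooth_funs_det g_smooth VF)
  define N where "N = (\<chi> i j. Y q (\<lambda>r. contact_matrix V r $ i $ j))"
  have "Y q D' = (\<Sum>i\<in>UNIV. det (\<chi> r s. if r = i then N $ i $ s else m $ r $ s))"
    unfolding D'eq tangent_det[OF YT MS]
    by (intro sum.cong refl arg_cong[where f = det]) (simp add: vec_eq_iff N_def m_def)
  also have "\<dots> = trace (N ** Mi) * D' q"
    using sum_det_row_replace[OF inv(2)] by (simp add: m_def D'_def)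
  also have "trace (N ** Mi) = conformal_factor Y q * (real CARD('d) + 1) - 2 * trace J"
    unfolding N_def lie_derivative_contact_matrix[OF W Y] m_def[symmetric] J_def[symmetric] t_def[symmetric] d_def[symmetric]
    by (rule trace_lie_derivative[OF inv e1 e2 e3])
  also have "\<dots> = c" by (simp add: card c_def J_def trace_def algebra_simps)
  finally have "Y q D' = c * D' q" .
  \<comment> \<open>Differentiating D'^2 = D^2 passes the factor c from D' to D without deciding the
    sign of D' / D.\<close>
  moreover have "Y q (\<lambda>r. D' r * D' r) = Y q (\<lambda>r. D r * D r)"
    by (rule tangent_local[OF YT frameD(1)[OF W(1)] W(2)]) (use DD in \<open>auto simp: power2_eq_square intro: D'S DS\<close>)
  ultimately have "2 * (c * (D' q)\<^sup>2) = 2 * (D q * Y q D)"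
    by (simp add: tangent_mult[OF YT D'S D'S] tangent_mult[OF YT DS DS] power2_eq_square algebra_simps)
  then have "Y q D = c * D q"
    using DD[OF W(2)] Dpos[OF W(2)] by (simp add: power2_eq_square)
  then show ?thesis by (simp add: D_def[abs_def] c_def)
qed

end


section \<open>Integration and the divergence theorem\<close>

text \<open>Differentiation under translation: the integrals of the difference quotients of \<open>u\<close> vanish by
  translation invariance of Lebesgue measure, and they converge by dominated convergence.\<close>

lemma integral_derivative_compact_support:
  fixes u :: "'a::euclidean_space \<Rightarrow> real"
  assumes u: "\<And>x. (u has_derivative u' x) (at x)" and cont: "continuous_on UNIV (\<lambda>x. u' x b)"
    and K: "compact K" "\<And>x. x \<notin> K \<Longrightarrow> u x = 0"
  shows "integrable lborel (\<lambda>x. u' x b)" and "(LINT x|lborel. u' x b) = 0"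
proof -
  have ucont: "continuous_on UNIV u"
    using u has_derivative_continuous continuous_at_imp_continuous_on by blast
  have supp: "u' x b = 0" if "x \<notin> K" for x
  proof -
    have "(u has_derivative (\<lambda>v. 0)) (at x)"
      by (rule has_derivative_transform_within_open[of "\<lambda>x. 0" _ _ _ "- K"])
         (use that K compact_imp_closed[OF K(1)] in auto)
    then have "u' x = (\<lambda>v. 0)" using u[of x] has_derivative_unique by blast
    then show ?thesis by simp
  qed
  have int: "integrable lborel f" if "continuous_on UNIV f" "\<And>x. x \<notin> K \<Longrightarrow> f x = 0" for f :: "'a \<Rightarrow> real"
  proof -
    have "integrable lborel (\<lambda>x. indicator K x *\<^sub>R f x)"
      by (rule borel_integrable_compact[OF K(1) continuous_on_subset[OF that(1)]]) simp
    moreover have "(\<lambda>x. indicator K x *\<^sub>R f x) = f"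
    proof
      fix x
      show "indicator K x *\<^sub>R f x = f x" using that(2)[of x] by (cases "x \<in> K") auto
    qed
    ultimately show ?thesis by simp
  qed
  show i': "integrable lborel (\<lambda>x. u' x b)" by (rule int[OF cont supp])
  have iu: "integrable lborel u" by (rule int[OF ucont K(2)])
  have "bounded ((\<lambda>x. u' x b) ` K)"
    by (intro compact_imp_bounded compact_continuous_image continuous_on_subset[OF cont] K(1)) simp
  then obtain B where B: "\<And>x. x \<in> K \<Longrightarrow> \<bar>u' x b\<bar> \<le> B" "B > 0"
    unfolding bounded_pos by (auto simp: image_iff)
  have B': "\<bar>u' x b\<bar> \<le> B" for x
    using B supp[of x] by (cases "x \<in> K") auto
  obtain R where R: "\<And>x. x \<in> K \<Longrightarrow> norm x \<le> R"
    using compact_imp_bounded[OF K(1)] unfolding bounded_iff by auto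
  define h where "h n = inverse (real (Suc n))" for n
  have h: "0 < h n" "h n \<le> 1" for n by (auto simp: h_def inverse_le_1_iff)
  define s where "s n x = (u (x + h n *\<^sub>R b) - u x) / h n" for n x
  have D: "((\<lambda>t. u (x + t *\<^sub>R b)) has_real_derivative u' (x + t *\<^sub>R b) b) (at t)" for x t
  proof -
    have "((\<lambda>t. x + t *\<^sub>R b) has_derivative (\<lambda>r. r *\<^sub>R b)) (at t)"
      by (auto intro!: derivative_eq_intros)
    from has_derivative_compose[OF this u]
    have "((\<lambda>t. u (x + t *\<^sub>R b)) has_derivative (\<lambda>r. u' (x + t *\<^sub>R b) (r *\<^sub>R b))) (at t)" .
    moreover have "u' (x + t *\<^sub>R b) (r *\<^sub>R b) = u' (x + t *\<^sub>R b) b * r" for r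
      using linear_scale[OF has_derivative_linear[OF u]] by simp
    ultimately show ?thesis by (simp add: has_field_derivative_def)
  qed
  have "(\<lambda>n. integral\<^sup>L lborel (s n)) \<longlonglongrightarrow> (LINT x|lborel. u' x b)"
  proof (rule integral_dominated_convergence[where w = "\<lambda>x. indicator (cball 0 (R + norm b)) x *\<^sub>R B"])
    show "integrable lborel (\<lambda>x. indicator (cball 0 (R + norm b)) x *\<^sub>R B)"
      by (rule borel_integrable_compact) auto
    show "(\<lambda>x. u' x b) \<in> borel_measurable lborel" using i' by (rule borel_measurable_integrable)
    show "s n \<in> borel_measurable lborel" for n
    proof -
      have "continuous_on UNIV (s n)"
        unfolding s_def by (intro continuous_intros continuous_on_compose2[OF ucont]) (use h(1)[of n] in auto)
      then show ?thesis by (simp add: borel_measurable_continuous_onI)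
    qed
    show "AE x in lborel. (\<lambda>n. s n x) \<longlonglongrightarrow> u' x b"
    proof (rule AE_I2)
      fix x
      have "((\<lambda>t. (u (x + t *\<^sub>R b) - u (x + 0 *\<^sub>R b)) / (t - 0)) \<longlongrightarrow> u' x b) (at 0)"
        using D[of x 0] unfolding has_field_derivative_iff by simp
      moreover have "filterlim h (at 0) sequentially"
        unfolding filterlim_at h_def[abs_def] using LIMSEQ_inverse_real_of_nat by auto
      ultimately have "(\<lambda>n. (u (x + h n *\<^sub>R b) - u (x + 0 *\<^sub>R b)) / (h n - 0)) \<longlonglongrightarrow> u' x b"
        by (rule filterlim_compose)
      then show "(\<lambda>n. s n x) \<longlonglongrightarrow> u' x b" by (simp add: s_def)
    qed
    \<comment> \<open>The mean value theorem bounds the quotients by the bound of the derivative;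
      since \<open>h n\<close> is at most 1, they vanish outside the ball enlarged by the norm of
      b.\<close>
    show "AE x in lborel. norm (s n x) \<le> indicator (cball 0 (R + norm b)) x *\<^sub>R B" for n
    proof (rule AE_I2)
      fix x
      show "norm (s n x) \<le> indicator (cball 0 (R + norm b)) x *\<^sub>R B"
      proof (cases "x \<in> cball 0 (R + norm b)")
        case True
        obtain z where "u (x + h n *\<^sub>R b) - u (x + 0 *\<^sub>R b) = (h n - 0) * u' (x + z *\<^sub>R b) b"
          using MVT2[of 0 "h n" "\<lambda>t. u (x + t *\<^sub>R b)" "\<lambda>t. u' (x + t *\<^sub>R b) b"] D h(1)[of n] by blast
        then have "s n x = u' (x + z *\<^sub>R b) b" using h(1)[of n] by (simp add: s_def)
        then show ?thesis using True B' by simp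
      next
        case False
        have "norm (h n *\<^sub>R b) \<le> norm b"
          using h(1)[of n] h(2)[of n] by (simp add: mult_left_le_one_le)
        then have "norm x \<le> norm (x + h n *\<^sub>R b) + norm b"
          using norm_triangle_ineq4[of "x + h n *\<^sub>R b" "h n *\<^sub>R b"] by simp
        then have "x \<notin> K" "x + h n *\<^sub>R b \<notin> K"
          using False R[of x] R[of "x + h n *\<^sub>R b"] norm_ge_zero[of b] by auto
        then show ?thesis using False by (simp add: s_def K(2))
      qed
    qed
  qed
  moreover have "integral\<^sup>L lborel (s n) = 0" for n
  proof -
    have d: "distr lborel borel ((+) (h n *\<^sub>R b)) = (lborel :: 'a measure)" by (rule lborel_distr_plus)
    have m: "(+) (h n *\<^sub>R b) \<in> measurable lborel (borel :: 'a measure)" by simp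
    have um: "u \<in> borel_measurable borel" using ucont by (rule borel_measurable_continuous_onI)
    have "integrable lborel (\<lambda>x. u (h n *\<^sub>R b + x))"
      using iu integrable_distr_eq[OF m um] by (simp add: d)
    moreover have "(LINT x|lborel. u (h n *\<^sub>R b + x)) = integral\<^sup>L lborel u"
      using integral_distr[OF m um] by (simp add: d)
    ultimately show ?thesis
      unfolding s_def by (simp add: add.commute iu)
  qed
  ultimately show "(LINT x|lborel. u' x b) = 0"
    by (simp add: LIMSEQ_const_iff)
qed

section \<open>The Riemannian volume in a chart\<close>

context contact_metric_manifold
begin

lemma gram_eq:
  assumes "\<And>i. V i q = coord_vec A (U, c) q i"
  shows "gram A g (U, c) q = metric_matrix V q"
  by (simp add: gram_def metric_matrix_def assms)

text \<open>\<open>riemannian_volume\<close> prescribes only the measures of Borel sets inside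
  charts; written as a pushforward of a density on coordinate space, the volume on W can be used in
  integrals. The point p0 is a default value making the inverse chart total; the density is 0
  wherever it is taken.\<close>

lemma volume_density:
  fixes p0 :: 'm
  assumes vol: "riemannian_volume A g \<mu>" and U: "(U, c) \<in> A" and W: "frame_on W V \<xi>" "W \<subseteq> U"
    and VW: "\<forall>q\<in>W. \<forall>i. V i q = coord_vec A (U, c) q i"
  defines "\<rho> \<equiv> \<lambda>x. indicator (c ` W) x * sqrt (det (metric_matrix V (inv_into U c x)))"
    and "\<Phi> \<equiv> \<lambda>x. if x \<in> c ` W then inv_into U c x else p0"
  shows "\<rho> \<in> borel_measurable borel" and "\<Phi> \<in> measurable borel borel"
    and "density \<mu> (indicator W) = distr (density lborel (\<lambda>x. ennreal (\<rho> x))) borel \<Phi>"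
proof -
  have Wo: "open W" by (rule frameD[OF W(1)])
  have o: "open (c ` W)" by (rule chart_image_open_subset[OF U Wo W(2)])
  have inv: "continuous_on (c ` W) (inv_into U c)"
    by (rule continuous_on_subset[OF chart_inv_continuous[OF U]]) (use W(2) in auto)
  have "(\<lambda>q. det (metric_matrix V q)) \<in> smooth_funs A"
    unfolding metric_matrix_def by (intro smooth_funs_det g_smooth frameD[OF W(1)])
  then have cont: "continuous_on (c ` W) (\<lambda>x. sqrt (det (metric_matrix V (inv_into U c x))))"
    by (intro continuous_intros continuous_on_compose2[OF smooth_funs_continuous inv]) auto
  have "(\<lambda>x. if x \<in> c ` W then sqrt (det (metric_matrix V (inv_into U c x))) else 0) \<in> borel_measurable borel"
    using o cont by (intro borel_measurable_continuous_on_if) auto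
  moreover have "\<rho> = (\<lambda>x. if x \<in> c ` W then sqrt (det (metric_matrix V (inv_into U c x))) else 0)"
    by (auto simp: \<rho>_def indicator_def)
  ultimately show \<rho>: "\<rho> \<in> borel_measurable borel" by simp
  show \<Phi>: "\<Phi> \<in> measurable borel borel"
    unfolding \<Phi>_def using o inv by (intro borel_measurable_continuous_on_if) auto
  have sets: "sets \<mu> = sets borel" using vol by (simp add: riemannian_volume_def)
  then have space: "space \<mu> = UNIV" using sets_eq_imp_space_eq by fastforce
  show "density \<mu> (indicator W) = distr (density lborel (\<lambda>x. ennreal (\<rho> x))) borel \<Phi>"
  proof (rule measure_eqI)
    fix S assume "S \<in> sets (density \<mu> (indicator W))"
    then have S: "S \<in> sets borel" using sets by simp
    have WS: "W \<inter> S \<in> sets borel" using S Wo by auto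
    have "emeasure (density \<mu> (indicator W)) S = emeasure \<mu> (W \<inter> S)"
    proof -
      have "emeasure (density \<mu> (indicator W)) S = (\<integral>\<^sup>+p. indicator W p * indicator S p \<partial>\<mu>)"
        using S Wo sets by (intro emeasure_density borel_measurable_indicator) simp_all
      also have "\<dots> = (\<integral>\<^sup>+p. indicator (W \<inter> S) p \<partial>\<mu>)"
        by (intro nn_integral_cong) (auto simp: indicator_def)
      also have "\<dots> = emeasure \<mu> (W \<inter> S)" using WS sets by (intro nn_integral_indicator) simp
      finally show ?thesis .
    qed
    also have "\<dots> = (\<integral>\<^sup>+x\<in>c ` (W \<inter> S). ennreal (sqrt (det (gram A g (U, c) (inv_into U c x)))) \<partial>lborel)"
      using vol U WS W(2) unfolding riemannian_volume_def by blast
    also have "\<dots> = (\<integral>\<^sup>+x. ennreal (\<rho> x) * indicator (\<Phi> -` S) x \<partial>lborel)"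
    proof (intro nn_integral_cong)
      fix x
      show "ennreal (sqrt (det (gram A g (U, c) (inv_into U c x)))) * indicator (c ` (W \<inter> S)) x = ennreal (\<rho> x) * indicator (\<Phi> -` S) x"
      proof (cases "x \<in> c ` W")
        case True
        then obtain q where q: "q \<in> W" "x = c q" by auto
        have iq: "inv_into U c x = q" using q chart_inv[OF U] W(2) by auto
        have "x \<in> c ` (W \<inter> S) \<longleftrightarrow> q \<in> S"
          using q chart_inj[OF U] W(2) by (auto simp: inj_on_def subset_iff)
        moreover have "\<Phi> x = q" using True iq by (simp add: \<Phi>_def)
        ultimately show ?thesis
          using True iq gram_eq[of V q U c, OF VW[rule_format, OF q(1)]] by (simp add: \<rho>_def indicator_def)
      next
        case False
        then have "x \<notin> c ` (W \<inter> S)" by auto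
        then show ?thesis using False by (simp add: \<rho>_def)
      qed
    qed
    also have "\<dots> = emeasure (density lborel (\<lambda>x. ennreal (\<rho> x))) (\<Phi> -` S)"
      using \<rho> measurable_sets[OF \<Phi> S] by (intro emeasure_density[symmetric]) auto
    also have "\<dots> = emeasure (distr (density lborel (\<lambda>x. ennreal (\<rho> x))) borel \<Phi>) S"
      using \<Phi> S by (subst emeasure_distr) auto
    finally show "emeasure (density \<mu> (indicator W)) S = emeasure (distr (density lborel (\<lambda>x. ennreal (\<rho> x))) borel \<Phi>) S" .
  qed (simp add: sets)
qed

lemma chart_integral:
  assumes vol: "riemannian_volume A g \<mu>" and U: "(U, c) \<in> A" and W: "frame_on W V \<xi>" "W \<subseteq> U"
    and VW: "\<forall>q\<in>W. \<forall>i. V i q = coord_vec A (U, c) q i"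
    and F: "F \<in> borel_measurable borel"
  shows "(LINT p|\<mu>. indicator W p * F p) =
    (LINT x|lborel. (indicator (c ` W) x * sqrt (det (metric_matrix V (inv_into U c x)))) * F (inv_into U c x))"
proof -
  fix p0 :: 'm
  define \<rho> where "\<rho> x = indicator (c ` W) x * sqrt (det (metric_matrix V (inv_into U c x)))" for x
  define \<Phi> where "\<Phi> x = (if x \<in> c ` W then inv_into U c x else p0)" for x
  note v = volume_density(1)[OF vol U W VW, folded \<rho>_def[abs_def]]
    volume_density(2,3)[OF vol U W VW, where ?p0.0 = p0, folded \<rho>_def \<Phi>_def[abs_def]]
  have sets: "sets \<mu> = sets borel" using vol by (simp add: riemannian_volume_def)
  have F\<mu>: "F \<in> borel_measurable \<mu>" using F sets measurable_cong_sets by blast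
  have \<rho>0: "0 \<le> \<rho> x" for x
  proof (cases "x \<in> c ` W")
    case True
    then obtain q where "q \<in> W" "inv_into U c x = q" using W(2) chart_inv[OF U] by auto
    then show ?thesis using det_metric_matrix_pos[OF W(1)] by (auto simp: \<rho>_def less_imp_le)
  qed (simp add: \<rho>_def)
  have "(LINT p|\<mu>. indicator W p * F p) = integral\<^sup>L (density \<mu> (indicator W)) F"
    using integral_density[OF F\<mu> borel_measurable_indicator, of W] frameD(1)[OF W(1)] sets
    by (simp add: ennreal_indicator)
  also have "\<dots> = (LINT x|density lborel (\<lambda>x. ennreal (\<rho> x)). F (\<Phi> x))"
    unfolding v(3) using v(2) F by (intro integral_distr) auto
  also have "\<dots> = (LINT x|lborel. \<rho> x *\<^sub>R F (\<Phi> x))"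
    using v(1) measurable_compose[OF v(2) F] \<rho>0 by (intro integral_density) auto
  also have "\<dots> = (LINT x|lborel. \<rho> x * F (inv_into U c x))"
    by (intro Bochner_Integration.integral_cong refl) (simp add: \<rho>_def \<Phi>_def indicator_def)
  finally show ?thesis by (simp add: \<rho>_def)
qed

text \<open>In the coordinates of a chart, with \<open>\<rho>\<close> the volume density, the integrand
  \<open>\<rho> (Y k + (n + 1) \<lambda> k)\<close> is the divergence of the compactly supported field \<open>k \<rho> Y\<close>.\<close>

lemma local_divergence:
  assumes vol: "riemannian_volume A g \<mu>" and U: "(U, c) \<in> A" and W: "frame_on W V \<xi>" "W \<subseteq> U"
    and VW: "\<forall>q\<in>W. \<forall>i. V i q = coord_vec A (U, c) q i"
    and Y: "Y \<in> contact_fields A \<theta>" and k: "k \<in> smooth_funs A"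
    and K: "compact K" "K \<subseteq> W" "\<And>q. q \<notin> K \<Longrightarrow> k q = 0"
  shows "(LINT p|\<mu>. Y p k + (real n + 1) * conformal_factor Y p * k p) = 0"
proof -
  note YF = contact_fieldD(1)[OF Y] and VF = frameD(2)[OF W(1)]
  note YT = vector_fieldsD(1)[OF YF] and VT = vector_fieldsD(1)[OF VF]
  define F where "F p = Y p k + (real n + 1) * conformal_factor Y p * k p" for p
  have FS: "F \<in> smooth_funs A"
    unfolding F_def by (intro smooth_funs_add smooth_funs_mult vector_fieldsD(2)[OF YF] k conformal_factor_smooth YF smooth_funs_const)
  have Kc: "closed K" using K(1) by (rule compact_imp_closed)
  have loc: "v f = 0" if "v \<in> tangent_space A q" "f \<in> smooth_funs A" "q \<notin> K" "\<And>r. r \<notin> K \<Longrightarrow> f r = 0" for v q f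
    using tangent_local[OF that(1), of "- K" f "\<lambda>r. 0"] that Kc tangent_const[OF that(1)] by auto
  have F0: "F q = 0" if "q \<notin> K" for q
    using loc[OF YT k that K(3)] K(3)[OF that] by (simp add: F_def)
  define D where "D r = det (metric_matrix V r)" for r
  have DS: "D \<in> smooth_funs A"
    unfolding D_def metric_matrix_def by (intro smooth_funs_det g_smooth VF)
  have Dpos: "D q > 0" if "q \<in> W" for q using det_metric_matrix_pos[OF W(1) that] by (simp add: D_def)
  define w where "w i q = k q * Y q (\<xi> i)" for i q
  have YS: "(\<lambda>q. Y q (\<xi> i)) \<in> smooth_funs A" for i
    by (intro vector_fieldsD(2)[OF YF] frameD[OF W(1)])
  have wS: "w i \<in> smooth_funs A" for i
    unfolding w_def by (intro smooth_funs_mult k YS)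
  have w0: "w i q = 0" if "q \<notin> K" for i q using K(3)[OF that] by (simp add: w_def)
  have o: "open (c ` W)" by (rule chart_image_open_subset[OF U frameD(1)[OF W(1)] W(2)])
  have Kim: "compact (c ` K)"
    using K W(2) by (intro compact_continuous_image continuous_on_subset[OF chart_continuous[OF U]]) auto
  have KW: "c ` K \<subseteq> c ` W" using K(2) by auto
  let ?inv = "inv_into U c"
  have invW: "?inv x \<in> W" "c (?inv x) = x" if "x \<in> c ` W" for x
    using that W(2) chart_inv[OF U] by (auto simp: subset_iff)
  have invK: "?inv x \<notin> K" if "x \<in> c ` W" "x \<notin> c ` K" for x
    using that invW[OF that(1)] by (metis imageI)
  define d where "d f x = frechet_derivative (f \<circ> ?inv) (at x)" for f :: "'m \<Rightarrow> real" and x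
  have dd: "(f \<circ> ?inv has_derivative d f x) (at x)" if "f \<in> smooth_funs A" "x \<in> c ` W" for f x
    unfolding d_def by (rule smooth_on_has_derivative[OF smooth_funsD[OF that(1) U]]) (use that(2) W(2) in auto)
  have dV: "d f x (axis i 1) = V i (?inv x) f" if "f \<in> smooth_funs A" "x \<in> c ` W" for f x i
    using VW[rule_format, OF invW(1)[OF that(2)], of i] invW(2)[OF that(2)] that(1) by (simp add: d_def coord_vec_def)
  \<comment> \<open>Extension by zero is harmless: the open sets c(W) and the complement of c(K)
    cover the coordinate space, and the function vanishes on the second.\<close>
  define u where "u i x = (if x \<in> c ` W then w i (?inv x) * sqrt (D (?inv x)) else 0)" for i x
  define u' where "u' i x = (if x \<in> c ` W then
    (\<lambda>v. w i (?inv x) * (d D x v * (inverse (sqrt (D (?inv x))) / 2)) + d (w i) x v * sqrt (D (?inv x))) else (\<lambda>v. 0))" for i x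
  have out: "x \<in> c ` W \<or> x \<in> - (c ` K)" for x using KW by auto
  have oK: "open (- (c ` K))" using compact_imp_closed[OF Kim] by auto
  have u0: "u i x = 0" if "x \<notin> c ` K" for i x
    using that invK w0 by (auto simp: u_def)
  have u'0: "u' i x (axis i 1) = 0" if "x \<notin> c ` K" for i x
  proof (cases "x \<in> c ` W")
    case True
    have "V i (?inv x) (w i) = 0"
      by (rule loc[OF VT wS invK[OF True that]]) (rule w0)
    then show ?thesis
      using True w0[OF invK[OF True that]] by (simp add: u'_def dV[OF wS True])
  qed (simp add: u'_def)
  have u: "(u i has_derivative u' i x) (at x)" for i x
  proof (cases "x \<in> c ` W")
    case True
    have "((\<lambda>x. sqrt ((D \<circ> ?inv) x)) has_derivative (\<lambda>v. d D x v * (inverse (sqrt ((D \<circ> ?inv) x)) / 2))) (at x)"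
      by (rule has_derivative_real_sqrt[OF _ dd[OF DS True]]) (simp add: Dpos[OF invW(1)[OF True]])
    from has_derivative_mult[OF dd[OF wS True] this]
    have "((\<lambda>x. (w i \<circ> ?inv) x * sqrt ((D \<circ> ?inv) x)) has_derivative u' i x) (at x)"
      using True by (simp add: u'_def)
    then show ?thesis
      by (rule has_derivative_transform_within_open[OF _ o True]) (simp add: u_def)
  next
    case False
    then have "x \<notin> c ` K" using KW by auto
    have "((\<lambda>x. 0) has_derivative (\<lambda>v. 0)) (at x)" by simp
    then have "(u i has_derivative (\<lambda>v. 0)) (at x)"
      by (rule has_derivative_transform_within_open[OF _ oK]) (use \<open>x \<notin> c ` K\<close> u0 in auto)
    then show ?thesis using False by (simp add: u'_def)
  qed
  have inv_cont: "continuous_on (c ` W) ?inv"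
    by (rule continuous_on_subset[OF chart_inv_continuous[OF U]]) (use W(2) in auto)
  have cinv: "continuous_on (c ` W) (\<lambda>x. f (?inv x))" if "f \<in> smooth_funs A" for f
    by (rule continuous_on_compose2[OF smooth_funs_continuous[OF that] inv_cont subset_UNIV])
  have uV: "u' i x (axis i 1) = w i (?inv x) * (V i (?inv x) D * (inverse (sqrt (D (?inv x))) / 2)) + V i (?inv x) (w i) * sqrt (D (?inv x))"
    if "x \<in> c ` W" for i x
    unfolding u'_def if_P[OF that] dV[OF DS that] dV[OF wS that] ..
  have u'cont: "continuous_on UNIV (\<lambda>x. u' i x (axis i 1))" for i
  proof -
    have "continuous_on (c ` W) (\<lambda>x. w i (?inv x) * (V i (?inv x) D * (inverse (sqrt (D (?inv x))) / 2)) + V i (?inv x) (w i) * sqrt (D (?inv x)))"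
    proof -
      have "sqrt (D (?inv x)) \<noteq> 0" if "x \<in> c ` W" for x
        using Dpos[OF invW(1)[OF that]] by simp
      then show ?thesis
        using cinv[OF wS] cinv[OF DS] cinv[OF vector_fieldsD(2)[OF VF DS]] cinv[OF vector_fieldsD(2)[OF VF wS]]
        by (intro continuous_on_add continuous_on_mult continuous_on_divide continuous_on_inverse continuous_on_real_sqrt continuous_on_const)
           simp_all
    qed
    then have 1: "continuous_on (c ` W) (\<lambda>x. u' i x (axis i 1))"
      by (rule continuous_on_eq) (simp add: uV)
    have 2: "continuous_on (- (c ` K)) (\<lambda>x. u' i x (axis i 1))"
      by (rule continuous_on_eq[of _ "\<lambda>x. 0"]) (simp_all add: u'0)
    have "continuous_on (c ` W \<union> - (c ` K)) (\<lambda>x. u' i x (axis i 1))"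
      by (rule continuous_on_open_Un[OF o oK 1 2])
    moreover have "c ` W \<union> - (c ` K) = UNIV" using KW by auto
    ultimately show ?thesis by simp
  qed
  have int: "integrable lborel (\<lambda>x. u' i x (axis i 1))" "(LINT x|lborel. u' i x (axis i 1)) = 0" for i
    by (rule integral_derivative_compact_support[OF u u'cont Kim], erule u0)+
  have pt: "(\<Sum>i\<in>UNIV. u' i x (axis i 1)) = indicator (c ` W) x * sqrt (D (?inv x)) * F (?inv x)" for x
  proof (cases "x \<in> c ` W")
    case True
    define q where "q = ?inv x"
    have q: "q \<in> W" using invW(1)[OF True] by (simp add: q_def)
    define s where "s = sqrt (D q)"
    have s: "s > 0" "D q = s * s" using Dpos[OF q] by (auto simp: s_def)
    define J where "J = (\<Sum>i\<in>UNIV. V i q (\<lambda>r. Y r (\<xi> i)))"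
    have "(\<Sum>i\<in>UNIV. u' i x (axis i 1)) =
        (\<Sum>i\<in>UNIV. w i q * (V i q D * (inverse s / 2)) + V i q (w i) * s)"
      by (simp add: uV[OF True] q_def s_def)
    also have "\<dots> = (\<Sum>i\<in>UNIV. k q * (inverse s / 2) * (Y q (\<xi> i) * V i q D) + s * k q * V i q (\<lambda>r. Y r (\<xi> i)) + s * (Y q (\<xi> i) * V i q k))"
      by (intro sum.cong refl) (simp add: w_def[abs_def] tangent_mult[OF VT k YS] algebra_simps)
    also have "\<dots> = k q * (inverse s / 2) * (\<Sum>i\<in>UNIV. Y q (\<xi> i) * V i q D) + s * k q * J + s * (\<Sum>i\<in>UNIV. Y q (\<xi> i) * V i q k)"
      by (simp only: sum.distrib sum_distrib_left J_def)
    also have "\<dots> = k q * (inverse s / 2) * Y q D + s * k q * J + s * Y q k"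
      unfolding frame_expand[OF W(1) q YT, symmetric] ..
    \<comment> \<open>The derivative of the square root of the Gram determinant supplies -J, which
      cancels the derivatives of the components of Y; only (n + 1) \<lambda> remains.\<close>
    also have "Y q D = (2 * (real n + 1) * conformal_factor Y q - 2 * J) * (s * s)"
      using divergence_det_metric_matrix[OF W(1) q Y] s(2) by (simp add: D_def[abs_def] J_def)
    also have "k q * (inverse s / 2) * ((2 * (real n + 1) * conformal_factor Y q - 2 * J) * (s * s)) + s * k q * J + s * Y q k = s * F q"
      using s(1) by (simp add: F_def field_simps)
    finally show ?thesis using True by (simp add: q_def s_def)
  next
    case False
    then show ?thesis by (simp add: u'_def)
  qed
  have "(LINT p|\<mu>. F p) = (LINT p|\<mu>. indicator W p * F p)"
    by (intro Bochner_Integration.integral_cong refl) (use F0 K(2) in \<open>auto simp: indicator_def\<close>)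
  also have "\<dots> = (LINT x|lborel. indicator (c ` W) x * sqrt (D (?inv x)) * F (?inv x))"
    using chart_integral[OF vol U W VW borel_measurable_continuous_onI[OF smooth_funs_continuous[OF FS]]]
    by (simp add: D_def)
  also have "\<dots> = (LINT x|lborel. (\<Sum>i\<in>UNIV. u' i x (axis i 1)))" by (simp only: pt)
  also have "\<dots> = 0" using int by (subst Bochner_Integration.integral_sum) auto
  finally show ?thesis by (simp add: F_def)
qed

end


section \<open>Global integration\<close>

locale compact_contact_metric_manifold = contact_metric_manifold A n \<theta> E g \<phi>
  for A :: "('m::t2_space, 'd::finite) chart set" and n \<theta> E g \<phi> +
  fixes \<mu> :: "'m measure"
  assumes compact: "compact (UNIV :: 'm set)"
    and volume: "riemannian_volume A g \<mu>"
begin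

lemma sets_volume: "sets \<mu> = sets borel"
  using volume by (simp add: riemannian_volume_def)

lemma space_volume: "space \<mu> = UNIV"
  using sets_eq_imp_space_eq[OF sets_volume] by simp

lemma emeasure_chart:
  "(U, c) \<in> A \<Longrightarrow> S \<in> sets borel \<Longrightarrow> S \<subseteq> U \<Longrightarrow>
    emeasure \<mu> S = (\<integral>\<^sup>+x\<in>c ` S. ennreal (sqrt (det (gram A g (U, c) (inv_into U c x)))) \<partial>lborel)"
  using volume unfolding riemannian_volume_def by blast

lemma finite_subcover:
  fixes N :: "'m \<Rightarrow> 'm set"
  assumes "\<And>p. open (N p)" "\<And>p. p \<in> N p"
  obtains P where "finite P" "UNIV \<subseteq> (\<Union>p\<in>P. N p)"
proof -
  have "UNIV \<subseteq> (\<Union>p\<in>UNIV. N p)" using assms(2) by blast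
  then obtain P where "P \<subseteq> UNIV" "finite P" "UNIV \<subseteq> (\<Union>p\<in>P. N p)"
    by (rule compactE_image[OF compact assms(1)])
  then show thesis using that by blast
qed

text \<open>The density is bounded on a compact subset of a chart, whose coordinate image has finite
  Lebesgue measure; compactness leaves finitely many such pieces. This makes every smooth function
  integrable.\<close>

lemma emeasure_volume_finite: "emeasure \<mu> UNIV < \<infinity>"
proof -
  have "\<exists>N. open N \<and> p \<in> N \<and> emeasure \<mu> N < \<infinity>" for p
  proof -
    obtain U c where U: "(U, c) \<in> A" "p \<in> U" by (rule chart_exists)
    obtain W V \<xi> where W: "frame_on W V \<xi>" "p \<in> W" "W \<subseteq> U" "\<And>q i. q \<in> W \<Longrightarrow> V i q = coord_vec A (U, c) q i"
      by (rule exists_frame[OF U]) (rule that)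
    obtain \<beta> N K where N: "\<beta> \<in> smooth_funs A" "\<And>q. 0 \<le> \<beta> q" "\<And>q. \<beta> q \<le> 1" "open N" "p \<in> N" "N \<subseteq> W"
      "\<And>q. q \<in> N \<Longrightarrow> \<beta> q = 1" "compact K" "K \<subseteq> W" "\<And>q. q \<notin> K \<Longrightarrow> \<beta> q = 0"
      by (rule exists_bump[OF frameD(1)[OF W(1)] W(2)]) (rule that)
    \<comment> \<open>The bump function is 1 on N and 0 off K.\<close>
    have NK: "N \<subseteq> K" using N(7,10) by force
    have KU: "K \<subseteq> U" using N(9) W(3) by blast
    have cK: "compact (c ` K)"
      by (intro compact_continuous_image continuous_on_subset[OF chart_continuous[OF U(1)]] N(8) KU)
    have "(\<lambda>q. det (metric_matrix V q)) \<in> smooth_funs A"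
      unfolding metric_matrix_def by (intro smooth_funs_det g_smooth frameD[OF W(1)])
    then have "continuous_on UNIV (\<lambda>q. sqrt (det (metric_matrix V q)))"
      by (intro continuous_on_real_sqrt smooth_funs_continuous)
    then have "bounded ((\<lambda>q. sqrt (det (metric_matrix V q))) ` K)"
      by (intro compact_imp_bounded compact_continuous_image N(8)) (rule continuous_on_subset, auto)
    then obtain B where B: "\<And>q. q \<in> K \<Longrightarrow> \<bar>sqrt (det (metric_matrix V q))\<bar> \<le> B"
      unfolding bounded_iff by auto
    have "emeasure \<mu> N \<le> emeasure \<mu> K"
      using NK compact_imp_closed[OF N(8)] by (intro emeasure_mono) (auto simp: sets_volume)
    also have "\<dots> = (\<integral>\<^sup>+x\<in>c ` K. ennreal (sqrt (det (gram A g (U, c) (inv_into U c x)))) \<partial>lborel)"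
      using compact_imp_closed[OF N(8)] by (intro emeasure_chart U(1) KU) auto
    also have "\<dots> \<le> (\<integral>\<^sup>+x. ennreal B * indicator (c ` K) x \<partial>lborel)"
    proof (intro nn_integral_mono)
      fix x
      show "ennreal (sqrt (det (gram A g (U, c) (inv_into U c x)))) * indicator (c ` K) x \<le> ennreal B * indicator (c ` K) x"
      proof (cases "x \<in> c ` K")
        case True
        then obtain q where q: "q \<in> K" "inv_into U c x = q" using chart_inv[OF U(1)] KU by auto
        have "gram A g (U, c) q = metric_matrix V q"
          using W(4) q(1) N(9) by (intro gram_eq) auto
        then show ?thesis
          using B[OF q(1)] q(2) by (intro mult_right_mono ennreal_leI) auto
      qed simp
    qed
    also have "\<dots> = ennreal B * emeasure lborel (c ` K)"
      using compact_imp_closed[OF cK] by (intro nn_integral_cmult_indicator) auto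
    also have "\<dots> < \<infinity>"
      using emeasure_bounded_finite[OF compact_imp_bounded[OF cK]] by (simp add: ennreal_mult_less_top)
    finally show ?thesis using N(4,5) by blast
  qed
  then obtain N where N: "\<And>p. open (N p)" "\<And>p. p \<in> N p" "\<And>p. emeasure \<mu> (N p) < \<infinity>"
    by metis
  obtain P where P: "finite P" "UNIV \<subseteq> (\<Union>p\<in>P. N p)"
    by (rule finite_subcover[OF N(1,2)])
  have "emeasure \<mu> UNIV \<le> emeasure \<mu> (\<Union>p\<in>P. N p)"
    using P(1) N(1) by (intro emeasure_mono P) (auto simp: sets_volume)
  also have "\<dots> \<le> (\<Sum>p\<in>P. emeasure \<mu> (N p))"
    using P(1) N(1) by (intro emeasure_subadditive_finite) (auto simp: sets_volume)
  also have "\<dots> < \<infinity>"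
    using N(3) P(1) by (simp add: ennreal_sum_less_top)
  finally show ?thesis .
qed

lemma smooth_measurable: "F \<in> smooth_funs A \<Longrightarrow> F \<in> borel_measurable \<mu>"
  using borel_measurable_continuous_onI[OF smooth_funs_continuous, of F] measurable_cong_sets[OF sets_volume refl] by blast

lemma smooth_integrable:
  assumes "F \<in> smooth_funs A"
  shows "integrable \<mu> F"
proof -
  interpret finite_measure \<mu>
    using emeasure_volume_finite by (intro finite_measureI) (simp add: space_volume less_top)
  have "bounded (range F)"
    by (intro compact_imp_bounded compact_continuous_image compact smooth_funs_continuous assms)
  then obtain B where "\<And>q. \<bar>F q\<bar> \<le> B" unfolding bounded_iff by auto
  then show ?thesis
    by (intro integrable_const_bound[of _ B] smooth_measurable assms) auto
qed

text \<open>The density is positive, so null sets inside a chart have Lebesgue-null coordinate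
  images, and the nonempty open set where F is nonzero near p cannot be null. This is the
  definiteness behind the uniqueness of B.\<close>

lemma integral_square_eq_0:
  assumes F: "F \<in> smooth_funs A" and zero: "(LINT p|\<mu>. F p * F p) = 0"
  shows "F p = 0"
proof (rule ccontr)
  assume Fp: "F p \<noteq> 0"
  have FF: "(\<lambda>p. F p * F p) \<in> smooth_funs A" by (intro smooth_funs_mult F)
  have ae: "AE q in \<mu>. F q * F q = 0"
    using zero integral_nonneg_eq_0_iff_AE[OF smooth_integrable[OF FF]] by simp
  obtain U c where U: "(U, c) \<in> A" "p \<in> U" by (rule chart_exists)
  obtain W V \<xi> where W: "frame_on W V \<xi>" "p \<in> W" "W \<subseteq> U" "\<And>q i. q \<in> W \<Longrightarrow> V i q = coord_vec A (U, c) q i"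
    by (rule exists_frame[OF U]) (rule that)
  define S where "S = W \<inter> F -` (- {0})"
  have S: "open S" "p \<in> S" "S \<subseteq> W" "S \<subseteq> U"
    unfolding S_def using W Fp
    by (auto intro!: continuous_open_preimage continuous_on_subset[OF smooth_funs_continuous[OF F]] frameD(1)[OF W(1)])
  have cS: "open (c ` S)" by (rule chart_image_open_subset[OF U(1) S(1,4)])
  have "emeasure \<mu> S = 0"
  proof -
    have "AE q in \<mu>. q \<notin> S" using ae by eventually_elim (auto simp: S_def)
    then have "S \<in> null_sets \<mu>"
      using S(1) by (subst AE_iff_null_sets) (auto simp: sets_volume)
    then show ?thesis by auto
  qed
  then have e0: "(\<integral>\<^sup>+x\<in>c ` S. ennreal (sqrt (det (gram A g (U, c) (inv_into U c x)))) \<partial>lborel) = 0"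
    using emeasure_chart[OF U(1) _ S(4)] S(1) by simp
  have e1: "(\<integral>\<^sup>+x\<in>c ` S. ennreal (sqrt (det (gram A g (U, c) (inv_into U c x)))) \<partial>lborel) =
      (\<integral>\<^sup>+x. ennreal (if x \<in> c ` S then sqrt (det (metric_matrix V (inv_into U c x))) else 0) \<partial>lborel)"
  proof (intro nn_integral_cong)
    fix x
    show "ennreal (sqrt (det (gram A g (U, c) (inv_into U c x)))) * indicator (c ` S) x =
        ennreal (if x \<in> c ` S then sqrt (det (metric_matrix V (inv_into U c x))) else 0)"
    proof (cases "x \<in> c ` S")
      case True
      then obtain q where q: "q \<in> S" "inv_into U c x = q" using chart_inv[OF U(1)] S(4) by auto
      have "gram A g (U, c) q = metric_matrix V q"
        using W(4) q(1) S(3) by (intro gram_eq) auto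
      then show ?thesis using True q(2) by simp
    qed simp
  qed
  note zero' = e0[unfolded e1]
  have "(\<lambda>x. if x \<in> c ` S then sqrt (det (metric_matrix V (inv_into U c x))) else 0) \<in> borel_measurable borel"
  proof -
    have "(\<lambda>q. det (metric_matrix V q)) \<in> smooth_funs A"
      unfolding metric_matrix_def by (intro smooth_funs_det g_smooth frameD[OF W(1)])
    moreover have "continuous_on (c ` S) (inv_into U c)"
      by (rule continuous_on_subset[OF chart_inv_continuous[OF U(1)]]) (use S(4) in auto)
    ultimately have "continuous_on (c ` S) (\<lambda>x. sqrt (det (metric_matrix V (inv_into U c x))))"
      by (intro continuous_on_real_sqrt continuous_on_compose2[OF smooth_funs_continuous _ subset_UNIV])
    then show ?thesis using cS by (intro borel_measurable_continuous_on_if) auto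
  qed
  then have "AE x in lborel. ennreal (if x \<in> c ` S then sqrt (det (metric_matrix V (inv_into U c x))) else 0) = 0"
    using zero' nn_integral_0_iff_AE[of "\<lambda>x. ennreal (if x \<in> c ` S then sqrt (det (metric_matrix V (inv_into U c x))) else 0)" lborel]
    by simp
  then have "AE x in lborel. x \<notin> c ` S"
  proof eventually_elim
    case (elim x)
    show ?case
    proof
      assume x: "x \<in> c ` S"
      then obtain q where "q \<in> S" "inv_into U c x = q" using chart_inv[OF U(1)] S(4) by auto
      then have "det (metric_matrix V (inv_into U c x)) > 0"
        using det_metric_matrix_pos[OF W(1)] S(3) by auto
      with elim x show False by simp
    qed
  qed
  then have "c ` S \<in> null_sets lborel"
    using cS by (subst AE_iff_null_sets) auto
  then have "negligible (c ` S)"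
    unfolding negligible_iff_null_sets by (rule null_sets_completionI)
  then show False using open_not_negligible[OF cS] S(2) by auto
qed

text \<open>Bump functions whose sum s is positive everywhere split k into the summands \<beta>_p k
  / s, each supported in a single chart, where the local statement applies.\<close>

lemma divergence:
  assumes Y: "Y \<in> contact_fields A \<theta>" and k: "k \<in> smooth_funs A"
  shows "(LINT p|\<mu>. Y p k + (real n + 1) * conformal_factor Y p * k p) = 0"
proof -
  note YF = contact_fieldD(1)[OF Y]
  note YT = vector_fieldsD(1)[OF YF]
  \<comment> \<open>The local statement is kept for all smooth functions, because the quotient k / s
    to which it is applied is known only after the cover has been chosen.\<close>
  define Q where "Q p \<beta> N \<longleftrightarrow> \<beta> \<in> smooth_funs A \<and> (\<forall>q. 0 \<le> \<beta> q) \<and> open N \<and> p \<in> N \<and> (\<forall>q\<in>N. \<beta> q = 1) \<and>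
      (\<forall>k\<in>smooth_funs A. (LINT q|\<mu>. Y q (\<lambda>r. \<beta> r * k r) + (real n + 1) * conformal_factor Y q * (\<beta> q * k q)) = 0)"
    for p :: 'm and \<beta> N
  have "\<exists>\<beta> N. Q p \<beta> N" for p
  proof -
    obtain U c where U: "(U, c) \<in> A" "p \<in> U" by (rule chart_exists)
    obtain W V \<xi> where W: "frame_on W V \<xi>" "p \<in> W" "W \<subseteq> U" "\<And>q i. q \<in> W \<Longrightarrow> V i q = coord_vec A (U, c) q i"
      by (rule exists_frame[OF U]) (rule that)
    obtain \<beta> N K where N: "\<beta> \<in> smooth_funs A" "\<And>q. 0 \<le> \<beta> q" "\<And>q. \<beta> q \<le> 1" "open N" "p \<in> N" "N \<subseteq> W"
      "\<And>q. q \<in> N \<Longrightarrow> \<beta> q = 1" "compact K" "K \<subseteq> W" "\<And>q. q \<notin> K \<Longrightarrow> \<beta> q = 0"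
      by (rule exists_bump[OF frameD(1)[OF W(1)] W(2)]) (rule that)
    have "\<forall>q\<in>W. \<forall>i. V i q = coord_vec A (U, c) q i" using W(4) by blast
    then have "(LINT q|\<mu>. Y q (\<lambda>r. \<beta> r * k r) + (real n + 1) * conformal_factor Y q * (\<beta> q * k q)) = 0" if "k \<in> smooth_funs A" for k
      by (rule local_divergence[OF volume U(1) W(1,3) _ Y smooth_funs_mult[OF N(1) that] N(8,9)]) (simp add: N(10))
    then have "Q p \<beta> N" using N unfolding Q_def by blast
    then show ?thesis by blast
  qed
  then obtain \<beta> N where Q: "\<And>p. Q p (\<beta> p) (N p)" by metis
  then have \<beta>: "\<And>p. \<beta> p \<in> smooth_funs A" "\<And>p q. 0 \<le> \<beta> p q" "\<And>p. open (N p)" "\<And>p. p \<in> N p"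
    "\<And>p q. q \<in> N p \<Longrightarrow> \<beta> p q = 1"
    "\<And>p k. k \<in> smooth_funs A \<Longrightarrow>
      (LINT q|\<mu>. Y q (\<lambda>r. \<beta> p r * k r) + (real n + 1) * conformal_factor Y q * (\<beta> p q * k q)) = 0"
    unfolding Q_def by blast+
  obtain P where P: "finite P" "UNIV \<subseteq> (\<Union>p\<in>P. N p)"
    by (rule finite_subcover[OF \<beta>(3,4)])
  define s where "s q = (\<Sum>p\<in>P. \<beta> p q)" for q
  have spos: "s q > 0" for q
  proof -
    obtain p where p: "p \<in> P" "q \<in> N p" using P(2) by auto
    have "\<beta> p q \<le> s q" unfolding s_def by (rule member_le_sum[OF p(1) _ P(1)]) (rule \<beta>(2))
    then show ?thesis using \<beta>(5)[OF p(2)] by simp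
  qed
  have sS: "s \<in> smooth_funs A" unfolding s_def by (intro smooth_funs_sum \<beta>(1))
  define k' where "k' q = inverse (s q) * k q" for q
  have k'S: "k' \<in> smooth_funs A"
    unfolding k'_def by (intro smooth_funs_mult smooth_funs_inverse sS k) (use spos in \<open>metis less_irrefl\<close>)
  have bS: "(\<lambda>r. \<beta> p r * k' r) \<in> smooth_funs A" for p by (intro smooth_funs_mult \<beta>(1) k'S)
  have keq: "k = (\<lambda>q. \<Sum>p\<in>P. \<beta> p q * k' q)"
  proof
    fix q
    have "(\<Sum>p\<in>P. \<beta> p q * k' q) = s q * k' q" by (simp add: s_def sum_distrib_right)
    then show "k q = (\<Sum>p\<in>P. \<beta> p q * k' q)" using spos[of q] by (simp add: k'_def)
  qed
  have Yk: "Y q k = (\<Sum>p\<in>P. Y q (\<lambda>r. \<beta> p r * k' r))" for q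
    by (subst keq) (rule tangent_sum[OF YT bS])
  have "Y q k + (real n + 1) * conformal_factor Y q * k q =
      (\<Sum>p\<in>P. Y q (\<lambda>r. \<beta> p r * k' r) + (real n + 1) * conformal_factor Y q * (\<beta> p q * k' q))" for q
    unfolding Yk sum.distrib sum_distrib_left[symmetric] fun_cong[OF keq, of q] ..
  then have "(LINT q|\<mu>. Y q k + (real n + 1) * conformal_factor Y q * k q) =
      (LINT q|\<mu>. (\<Sum>p\<in>P. Y q (\<lambda>r. \<beta> p r * k' r) + (real n + 1) * conformal_factor Y q * (\<beta> p q * k' q)))"
    by (simp only:)
  also have "\<dots> = (\<Sum>p\<in>P. LINT q|\<mu>. Y q (\<lambda>r. \<beta> p r * k' r) + (real n + 1) * conformal_factor Y q * (\<beta> p q * k' q))"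
    by (intro Bochner_Integration.integral_sum smooth_integrable smooth_funs_add smooth_funs_mult smooth_funs_const
        conformal_factor_smooth YF bS vector_fieldsD(2)[OF YF])
  also have "\<dots> = 0" using \<beta>(6)[OF k'S] by simp
  finally show ?thesis .
qed

section \<open>Arnold's curvature formula\<close>

lemma contact_inner_eq:
  assumes "\<And>p. \<theta> p (X p) = f p" "\<And>p. \<theta> p (Z p) = h p"
  shows "contact_inner \<theta> \<mu> X Z = (LINT p|\<mu>. f p * h p)"
  by (simp add: contact_inner_def stream_fun_def assms)

lemma theta_ad:
  assumes "Y \<in> contact_fields A \<theta>" "Z \<in> vector_fields A"
  shows "\<theta> p (ad Y Z p) = conformal_factor Y p * \<theta> p (Z p) - Y p (\<lambda>q. \<theta> q (Z q))"
proof -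
  have "ad Y Z p = tan_scale (- 1) (lie_bracket Y Z p)" by (simp add: ad_def tan_scale_def)
  then show ?thesis
    using theta_scale[OF vector_fieldsD(1)[OF lie_bracket_vector_fields[OF contact_fieldD(1)[OF assms(1)] assms(2)]], of p "- 1"]
      contact_fieldD(2)[OF assms, of p] by simp
qed

text \<open>Integration by parts moves Y from the stream function of Z to that of X. Existence of a
  field with the resulting stream function and uniqueness of the adjoint then evaluate the definite
  description.\<close>

lemma coad_contact_field:
  assumes X: "X \<in> contact_fields A \<theta>" and Y: "Y \<in> contact_fields A \<theta>"
  shows "coad A \<theta> \<mu> X Y \<in> contact_fields A \<theta>"
    and "\<theta> p (coad A \<theta> \<mu> X Y p) = Y p (\<lambda>q. \<theta> q (X q)) + (real n + 2) * conformal_factor Y p * \<theta> p (X p)"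
proof -
  note XF = contact_fieldD(1)[OF X] and YF = contact_fieldD(1)[OF Y]
  define f where "f q = \<theta> q (X q)" for q
  have f: "f \<in> smooth_funs A" unfolding f_def by (rule theta_smooth[OF XF])
  define b where "b p = Y p f + (real n + 2) * conformal_factor Y p * f p" for p
  have b: "b \<in> smooth_funs A"
    unfolding b_def by (intro smooth_funs_add smooth_funs_mult smooth_funs_const conformal_factor_smooth YF f vector_fieldsD(2)[OF YF])
  have adj: "(LINT p|\<mu>. b p * \<theta> p (Z p)) = contact_inner \<theta> \<mu> X (ad Y Z)" if Z: "Z \<in> contact_fields A \<theta>" for Z
  proof -
    note ZF = contact_fieldD(1)[OF Z]
    define k where "k q = \<theta> q (Z q)" for q
    have k: "k \<in> smooth_funs A" unfolding k_def by (rule theta_smooth[OF ZF])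
    have S: "(\<lambda>p. f p * (conformal_factor Y p * k p - Y p k)) \<in> smooth_funs A"
      by (intro smooth_funs_mult smooth_funs_diff f k conformal_factor_smooth YF vector_fieldsD(2)[OF YF])
    have S': "(\<lambda>p. Y p (\<lambda>q. f q * k q) + (real n + 1) * conformal_factor Y p * (f p * k p)) \<in> smooth_funs A"
      by (intro smooth_funs_mult smooth_funs_add smooth_funs_const f k conformal_factor_smooth YF vector_fieldsD(2)[OF YF])
    \<comment> \<open>The two integrands differ by the divergence expression for f k, whose integral
      vanishes.\<close>
    have "b p * k p = f p * (conformal_factor Y p * k p - Y p k) + (Y p (\<lambda>q. f q * k q) + (real n + 1) * conformal_factor Y p * (f p * k p))" for p
      by (simp add: b_def tangent_mult[OF vector_fieldsD(1)[OF YF] f k] algebra_simps)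
    then have "(LINT p|\<mu>. b p * k p) = (LINT p|\<mu>. f p * (conformal_factor Y p * k p - Y p k))"
      using divergence[OF Y smooth_funs_mult[OF f k]] smooth_integrable[OF S] smooth_integrable[OF S'] by simp
    also have "\<dots> = contact_inner \<theta> \<mu> X (ad Y Z)"
      by (rule contact_inner_eq[symmetric]) (simp_all add: f_def k_def[abs_def] theta_ad[OF Y ZF])
    finally show ?thesis by (simp add: k_def)
  qed
  obtain W where W: "W \<in> contact_fields A \<theta>" "\<And>p. \<theta> p (W p) = b p"
    by (rule exists_contact_field[OF b]) (rule that)
  have "coad A \<theta> \<mu> X Y = W"
    unfolding coad_def
  proof (rule the_equality)
    show "W \<in> contact_fields A \<theta> \<and> (\<forall>Z\<in>contact_fields A \<theta>. contact_inner \<theta> \<mu> W Z = contact_inner \<theta> \<mu> X (ad Y Z))"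
      using W adj contact_inner_eq[of W b, OF W(2)] by simp
  next
    fix W' assume W': "W' \<in> contact_fields A \<theta> \<and>
      (\<forall>Z\<in>contact_fields A \<theta>. contact_inner \<theta> \<mu> W' Z = contact_inner \<theta> \<mu> X (ad Y Z))"
    define b' where "b' q = \<theta> q (W' q)" for q
    have b': "b' \<in> smooth_funs A" unfolding b'_def using W' by (intro theta_smooth contact_fieldD(1)) auto
    \<comment> \<open>Any other adjoint is tested against the contact field whose stream function is
      the difference of the two.\<close>
    have db: "(\<lambda>q. b' q - b q) \<in> smooth_funs A" by (intro smooth_funs_diff b b')
    obtain Z where Z: "Z \<in> contact_fields A \<theta>" "\<And>p. \<theta> p (Z p) = b' p - b p"
      by (rule exists_contact_field[OF db]) (rule that)
    have "(LINT p|\<mu>. b' p * (b' p - b p)) = contact_inner \<theta> \<mu> X (ad Y Z)"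
      using W' Z(1) contact_inner_eq[of W' b' Z "\<lambda>p. b' p - b p"] Z(2) by (simp add: b'_def)
    also have "\<dots> = (LINT p|\<mu>. b p * (b' p - b p))" using adj[OF Z(1)] Z(2) by simp
    finally have "(LINT p|\<mu>. (b' p - b p) * (b' p - b p)) = 0"
      using smooth_integrable[OF smooth_funs_mult[OF b' db]] smooth_integrable[OF smooth_funs_mult[OF b db]]
      by (simp add: left_diff_distrib[of "b' _" "b _"])
    then have "b' p - b p = 0" for p by (rule integral_square_eq_0[OF db])
    then show "W' = W"
      using W' W by (intro contact_field_eqI) (auto simp: b'_def)
  qed
  then show "coad A \<theta> \<mu> X Y \<in> contact_fields A \<theta>"
    and "\<theta> p (coad A \<theta> \<mu> X Y p) = Y p (\<lambda>q. \<theta> q (X q)) + (real n + 2) * conformal_factor Y p * \<theta> p (X p)"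
    using W by (simp_all add: b_def f_def[abs_def])
qed

text \<open>Needed for the sign of the denominator of the sectional curvature.\<close>

lemma cauchy_schwarz:
  assumes X: "X \<in> contact_fields A \<theta>" and Y: "Y \<in> contact_fields A \<theta>"
  shows "(contact_inner \<theta> \<mu> X Y)\<^sup>2 \<le> contact_inner \<theta> \<mu> X X * contact_inner \<theta> \<mu> Y Y"
proof -
  define f where "f q = \<theta> q (X q)" for q
  define h where "h q = \<theta> q (Y q)" for q
  have f: "f \<in> smooth_funs A" and h: "h \<in> smooth_funs A"
    unfolding f_def h_def by (intro theta_smooth contact_fieldD(1) X Y)+
  define a where "a = (LINT p|\<mu>. f p * f p)"
  define b where "b = (LINT p|\<mu>. h p * h p)"
  define s where "s = (LINT p|\<mu>. f p * h p)"
  have "s\<^sup>2 \<le> a * b"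
  proof (cases "b = 0")
    case True
    have "h p = 0" for p by (rule integral_square_eq_0[OF h]) (rule True[unfolded b_def])
    then show ?thesis by (simp add: s_def b_def)
  next
    case False
    have "b \<ge> 0" unfolding b_def by (rule Bochner_Integration.integral_nonneg) simp
    with False have "b > 0" by simp
    \<comment> \<open>The function b f - s h is orthogonal to h, and its squared norm is b (a b -
      s^2).\<close>
    have "0 \<le> (LINT p|\<mu>. (b * f p - s * h p) * (b * f p - s * h p))"
      by (rule Bochner_Integration.integral_nonneg) simp
    also have "\<dots> = (LINT p|\<mu>. b\<^sup>2 * (f p * f p) - 2 * b * s * (f p * h p) + s\<^sup>2 * (h p * h p))"
      by (intro Bochner_Integration.integral_cong refl) (simp add: algebra_simps power2_eq_square)
    also have "\<dots> = b\<^sup>2 * a - 2 * b * s * s + s\<^sup>2 * b"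
      by (simp add: a_def b_def s_def smooth_integrable smooth_funs_mult f h)
    also have "\<dots> = b * (a * b - s\<^sup>2)" by (simp add: algebra_simps power2_eq_square)
    finally have "0 \<le> a * b - s\<^sup>2" using \<open>b > 0\<close> by (metis zero_le_mult_iff not_less)
    then show ?thesis by simp
  qed
  moreover have "contact_inner \<theta> \<mu> X Y = s" "contact_inner \<theta> \<mu> X X = a" "contact_inner \<theta> \<mu> Y Y = b"
    unfolding s_def a_def b_def by (rule contact_inner_eq; simp only: f_def h_def)+
  ultimately show ?thesis by simp
qed

text \<open>All derivatives of stream functions are expressed through P and products of a conformal
  factor with a stream function; the integrand becomes a quadratic polynomial in these and is
  completed to a square pointwise, with no further integration by parts.\<close>

lemma arnold_C_nonneg:
  assumes X: "X \<in> contact_fields A \<theta>" and Y: "Y \<in> contact_fields A \<theta>"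
  shows "arnold_C A \<theta> \<mu> X Y \<ge> 0"
proof -
  note XF = contact_fieldD(1)[OF X] and YF = contact_fieldD(1)[OF Y]
  define f where "f q = \<theta> q (X q)" for q
  define h where "h q = \<theta> q (Y q)" for q
  have f: "f \<in> smooth_funs A" and h: "h \<in> smooth_funs A"
    unfolding f_def h_def by (intro theta_smooth XF YF)+
  define P where "P p = Y p f - conformal_factor Y p * f p" for p
  define c where "c = real n + 3"
  have PS: "P \<in> smooth_funs A"
    unfolding P_def by (intro smooth_funs_diff smooth_funs_mult conformal_factor_smooth YF f vector_fieldsD(2)[OF YF])
  have Yf: "Y p f = P p + conformal_factor Y p * f p" for p by (simp add: P_def)
  \<comment> \<open>Antisymmetry of the bracket gives \<theta> [X, Y] = - P, so the same P serves
    for both derivatives.\<close>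
  have Xh: "X p h = conformal_factor X p * h p - P p" for p
    using theta_swap[OF XF YF, of p] contact_fieldD(2)[OF X YF, of p] contact_fieldD(2)[OF Y XF, of p]
    by (simp add: P_def f_def[abs_def] h_def[abs_def])
  \<comment> \<open>\<theta> [Z, Z] = 0, so a contact field changes its own stream function by the
    conformal factor alone; hence B(X, X) and B(Y, Y) contain no P.\<close>
  have self: "Z p (\<lambda>q. \<theta> q (Z q)) = conformal_factor Z p * \<theta> p (Z p)" if "Z \<in> contact_fields A \<theta>" for Z p
    using theta_swap[OF contact_fieldD(1) contact_fieldD(1), OF that that, of p] contact_fieldD(2)[OF that contact_fieldD(1)[OF that], of p]
    by simp
  let ?B = "coad A \<theta> \<mu>"
  have B: "?B U V \<in> contact_fields A \<theta>" "?B U V p \<in> tangent_space A p"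
    "\<theta> p (?B U V p) = V p (\<lambda>q. \<theta> q (U q)) + (real n + 2) * conformal_factor V p * \<theta> p (U p)"
    if "U \<in> contact_fields A \<theta>" "V \<in> contact_fields A \<theta>" for U V p
    using coad_contact_field[OF that] vector_fieldsD(1)[OF contact_fieldD(1)] by auto
  have lin: "\<theta> p (vf_lincomb r (?B X Y) s (?B Y X) p) =
      r * (P p + c * (conformal_factor Y p * f p)) + s * (c * (conformal_factor X p * h p) - P p)" for r s p
  proof -
    have 1: "\<theta> p (?B X Y p) = P p + c * (conformal_factor Y p * f p)"
      using B(3)[OF X Y, of p] Yf[of p] by (simp add: f_def[abs_def] c_def algebra_simps)
    have 2: "\<theta> p (?B Y X p) = c * (conformal_factor X p * h p) - P p"
      using B(3)[OF Y X, of p] Xh[of p] by (simp add: h_def[abs_def] c_def algebra_simps)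
    show ?thesis
      by (simp add: vf_lincomb_def theta_add theta_scale tangent_space_scale B(2)[OF X Y] B(2)[OF Y X] 1 2)
  qed
  have BX: "\<theta> p (tan_scale (1/2) (?B X X p)) = c / 2 * (conformal_factor X p * f p)" for p
    using B(3)[OF X X, of p] self[OF X, of p]
    by (simp add: theta_scale B(2)[OF X X] f_def c_def algebra_simps)
  have BY: "\<theta> p (tan_scale (1/2) (?B Y Y p)) = c / 2 * (conformal_factor Y p * h p)" for p
    using B(3)[OF Y Y, of p] self[OF Y, of p]
    by (simp add: theta_scale B(2)[OF Y Y] h_def c_def algebra_simps)
  have a: "\<theta> p (tan_scale (1/2) (ad X Y p)) = P p / 2" for p
  proof -
    have "ad X Y p = tan_scale (- 1) (lie_bracket X Y p)" by (simp add: ad_def tan_scale_def)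
    then have "ad X Y p \<in> tangent_space A p"
      using tangent_space_scale[OF vector_fieldsD(1)[OF lie_bracket_vector_fields[OF XF YF]]] by simp
    then show ?thesis
      using theta_ad[OF X YF, of p] Xh[of p] by (simp add: theta_scale h_def[abs_def])
  qed
  let ?d = "\<lambda>p. c / 2 * (conformal_factor Y p * f p + conformal_factor X p * h p)"
  let ?b = "\<lambda>p. P p + c / 2 * (conformal_factor Y p * f p - conformal_factor X p * h p)"
  let ?a = "\<lambda>p. P p / 2"
  let ?BX = "\<lambda>p. c / 2 * (conformal_factor X p * f p)"
  let ?BY = "\<lambda>p. c / 2 * (conformal_factor Y p * h p)"
  have cf: "(\<lambda>p. conformal_factor U p * k p) \<in> smooth_funs A" if "U \<in> vector_fields A" "k \<in> smooth_funs A" for U k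
    by (intro smooth_funs_mult conformal_factor_smooth that)
  have S: "?d \<in> smooth_funs A" "?b \<in> smooth_funs A" "?BX \<in> smooth_funs A" "?BY \<in> smooth_funs A"
    by (intro smooth_funs_add smooth_funs_diff PS smooth_funs_mult[OF smooth_funs_const] cf XF YF f h)+
  have Sa: "?a \<in> smooth_funs A"
    using smooth_funs_mult[OF smooth_funs_const[of "1/2"] PS] by simp
  have gen: "(LINT p|\<mu>. u p) + 2 * (LINT p|\<mu>. v p) - 3 * (LINT p|\<mu>. w p) - 4 * (LINT p|\<mu>. z p)
      = (LINT p|\<mu>. u p + 2 * v p - 3 * w p - 4 * z p)"
    if "integrable \<mu> u" "integrable \<mu> v" "integrable \<mu> w" "integrable \<mu> z" for u v w z :: "'m \<Rightarrow> real"
    using that by simp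
  note I = smooth_integrable[OF smooth_funs_mult]
  have "arnold_C A \<theta> \<mu> X Y =
      (LINT p|\<mu>. ?d p * ?d p) + 2 * (LINT p|\<mu>. ?a p * ?b p) - 3 * (LINT p|\<mu>. ?a p * ?a p) - 4 * (LINT p|\<mu>. ?BX p * ?BY p)"
    unfolding arnold_C_def Let_def
    by (intro arg_cong2[where f = "(-)"] arg_cong2[where f = "(+)"] arg_cong2[where f = "(*)"] refl contact_inner_eq)
       (simp_all only: lin a BX BY, simp_all add: field_simps)
  also have "\<dots> = (LINT p|\<mu>. ?d p * ?d p + 2 * (?a p * ?b p) - 3 * (?a p * ?a p) - 4 * (?BX p * ?BY p))"
    by (rule gen[OF I[OF S(1) S(1)] I[OF Sa S(2)] I[OF Sa Sa] I[OF S(3) S(4)]])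
  \<comment> \<open>Of the P^2 in 2 a b, three quarters are taken by 3 a a; the remaining quarter is
    what completes the square.\<close>
  also have "\<dots> = (LINT p|\<mu>. (P p + c * (conformal_factor Y p * f p - conformal_factor X p * h p))\<^sup>2 / 4)"
    by (intro Bochner_Integration.integral_cong refl) (simp add: field_simps power2_eq_square)
  also have "\<dots> \<ge> 0" by (rule Bochner_Integration.integral_nonneg) simp
  finally show ?thesis .
qed

end


theorem theorem3p1:
  fixes A :: "('m::{t2_space, second_countable_topology}, 'd::finite) chart set"
    and n :: nat
    and \<theta> :: "'m \<Rightarrow> 'm tangent \<Rightarrow> real"
    and g :: "'m \<Rightarrow> 'm tangent \<Rightarrow> 'm tangent \<Rightarrow> real"
    and \<mu> :: "'m measure"
    and X Y :: "'m vfield"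
  assumes "CARD('d) = 2 * n + 1"
    and "smooth_atlas A"
    and "compact (UNIV :: 'm set)"
    and "orientable A"
    and "K_contact A n \<theta> g"
    and "riemannian_volume A g \<mu>"
    and "X \<in> contact_fields A \<theta>" and "Y \<in> contact_fields A \<theta>"
    and "vf_independent X Y"
  shows "sectional_curvature A \<theta> \<mu> X Y \<ge> 0"
proof -
  obtain E \<phi> where E: "reeb_field A \<theta> E" "riemannian_metric A g" "\<phi> \<in> endo_fields A" "\<theta> \<in> one_forms A"
    "\<forall>p. \<forall>u\<in>tangent_space A p. \<theta> p u = g p u (E p)"
    "\<forall>p. \<forall>u\<in>tangent_space A p. \<phi> p (\<phi> p u) = tan_add (tan_scale (- 1) u) (tan_scale (\<theta> p u) (E p))"
    "\<forall>X\<in>vector_fields A. \<forall>Y\<in>vector_fields A. \<forall>p. ext_deriv \<theta> X Y p = g p (X p) (\<phi> p (Y p))"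
    using assms(5) unfolding K_contact_def contact_form_def associated_metric_def by blast
  interpret compact_contact_metric_manifold A n \<theta> E g \<phi> \<mu>
    using assms E by unfold_locales auto
  show ?thesis
    unfolding sectional_curvature_def
    by (intro divide_nonneg_nonneg arnold_C_nonneg) (use assms cauchy_schwarz in auto)
qed

end
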